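(* Let $X>0$ be a random variable with moments of Gamma type, let $Y=\log X$, and let $\gamma,\delta,\varkappa,C_1,\rho_-$ be the associated parameters (see context). Suppose that $\rho_-=-\infty$ and $\gamma>0$. Then $$f_X(x)\sim C_3\,x^{-c_1-1}e^{-c_3x^{-1/\gamma}},\qquad x\to0,$$ $$f_Y(y)\sim\frac{C_1}{\sqrt{2\pi\gamma}}\,e^{-c_1(y-\varkappa)-\gamma e^{-(y-\varkappa)/\gamma}},\qquad y\to-\infty,$$ where $c_1:=(\delta+1/2)/\gamma$, $c_3:=\gamma e^{\varkappa/\gamma}$ and $C_3:=\dfrac{C_1}{\sqrt{2\pi\gamma}}\,e^{c_1\varkappa}$.
   Context: A positive random variable $X$ has moments of Gamma type if there exist integers $J,K\ge0$ and real constants $C$, $D>0$, $a_j\ne0$, $b_j$ ($1\le j\le J$), $a'_k\neq0$, $b'_k$ ($1\le k\le K$) such that $$\mathbb E\,X^s=F(s):=C D^s\,\frac{\prod_{j=1}^J\Gamma(a_js+b_j)}{\prod_{k=1}^K\Gamma(a'_ks+b'_k)}$$ for all real $s$ in some interval of positive length. $F$ is regarded as a meromorphic function on $\mathbb C$ (removable singularities removed). Let $\rho_-:=\max\{x<0:x\text{ is a pole of }F\}$, with $\rho_-=-\infty$ if there is no such pole. With $d=\log D$, define $$\gamma=\sum_{j}|a_j|-\sum_{k}|a'_k|,\quad \delta=\sum_j b_j-\sum_k b'_k-\frac{J-K}2,\quad \varkappa=\sum_j a_j\log|a_j|-\sum_k a'_k\log|a'_k|+d,$$ $$C_1=|C|\,(2\pi)^{(J-K)/2}\,\frac{\prod_j|a_j|^{b_j-1/2}}{\prod_k|a'_k|^{b'_k-1/2}}.$$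 When $\gamma>0$, $X$ and $Y$ are absolutely continuous with densities continuous on $(0,\infty)$ and $\mathbb R$, respectively; $f_X$ and $f_Y$ denote these. $f\sim g$ means $f/g\to1$; $x\to0$ is through positive values. *)

theory Defs
  imports
    "HOL-Probability.Probability"
    "HOL-Complex_Analysis.Complex_Analysis"
    "HOL-Library.Landau_Symbols"
begin

text \<open>
  A Gamma quotient is given by \<open>J\<close>, \<open>K\<close>, the constants \<open>C\<close>, \<open>D\<close> and the coefficients
  \<open>a j\<close>, \<open>b j\<close> for \<open>1 \<le> j \<le> J\<close> and \<open>a' k\<close>, \<open>b' k\<close> for \<open>1 \<le> k \<le> K\<close>.
  The library's \<open>Gamma\<close> takes the junk value 0 at its poles; taking \<open>remove_sings\<close> of the
  quotient restores the correct values at the removable singularities (and gives 0 at the poles).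
\<close>

definition gamma_quotient ::
  "nat \<Rightarrow> nat \<Rightarrow> real \<Rightarrow> real \<Rightarrow> (nat \<Rightarrow> real) \<Rightarrow> (nat \<Rightarrow> real) \<Rightarrow> (nat \<Rightarrow> real) \<Rightarrow> (nat \<Rightarrow> real)
    \<Rightarrow> complex \<Rightarrow> complex" where
  "gamma_quotient J K C D a b a' b' =
     remove_sings (\<lambda>s. of_real C * of_real D powr s *
       (\<Prod>j=1..J. Gamma (of_real (a j) * s + of_real (b j))) /
       (\<Prod>k=1..K. Gamma (of_real (a' k) * s + of_real (b' k))))"

text \<open>
  At a real pole of the quotient the right-hand side of the moment equation is 0, which is never a
  moment of a positive random variable; so the equation excludes poles from the interval.
\<close>

definition gamma_type_moments ::
  "'w measure \<Rightarrow> ('w \<Rightarrow> real) \<Rightarrow> nat \<Rightarrow> nat \<Rightarrow> real \<Rightarrow> real \<Rightarrow> (nat \<Rightarrow> real) \<Rightarrow> (nat \<Rightarrow> real)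
    \<Rightarrow> (nat \<Rightarrow> real) \<Rightarrow> (nat \<Rightarrow> real) \<Rightarrow> bool" where
  "gamma_type_moments M X J K C D a b a' b' \<longleftrightarrow>
     D > 0 \<and> (\<forall>j\<in>{1..J}. a j \<noteq> 0) \<and> (\<forall>k\<in>{1..K}. a' k \<noteq> 0) \<and>
     (\<exists>l u. l < u \<and> (\<forall>s\<in>{l<..<u}.
        integrable M (\<lambda>\<omega>. X \<omega> powr s) \<and>
        complex_of_real (\<integral>\<omega>. X \<omega> powr s \<partial>M) = gamma_quotient J K C D a b a' b' (of_real s)))"

text \<open>Poles of a Gamma quotient are isolated, so the maximum exists whenever there is a negative pole.\<close>

definition rho_minus :: "(complex \<Rightarrow> complex) \<Rightarrow> ereal" where
  "rho_minus F =
     (if \<exists>x::real. x < 0 \<and> is_pole F (of_real x)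
      then ereal (GREATEST x::real. x < 0 \<and> is_pole F (of_real x)) else -\<infinity>)"

definition par_gamma :: "nat \<Rightarrow> nat \<Rightarrow> (nat \<Rightarrow> real) \<Rightarrow> (nat \<Rightarrow> real) \<Rightarrow> real" where
  "par_gamma J K a a' = (\<Sum>j=1..J. \<bar>a j\<bar>) - (\<Sum>k=1..K. \<bar>a' k\<bar>)"

definition par_delta :: "nat \<Rightarrow> nat \<Rightarrow> (nat \<Rightarrow> real) \<Rightarrow> (nat \<Rightarrow> real) \<Rightarrow> real" where
  "par_delta J K b b' = (\<Sum>j=1..J. b j) - (\<Sum>k=1..K. b' k) - (real J - real K) / 2"

definition par_kappa ::
  "nat \<Rightarrow> nat \<Rightarrow> real \<Rightarrow> (nat \<Rightarrow> real) \<Rightarrow> (nat \<Rightarrow> real) \<Rightarrow> real" where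
  "par_kappa J K D a a' =
     (\<Sum>j=1..J. a j * ln \<bar>a j\<bar>) - (\<Sum>k=1..K. a' k * ln \<bar>a' k\<bar>) + ln D"

definition par_C1 ::
  "nat \<Rightarrow> nat \<Rightarrow> real \<Rightarrow> (nat \<Rightarrow> real) \<Rightarrow> (nat \<Rightarrow> real) \<Rightarrow> (nat \<Rightarrow> real) \<Rightarrow> (nat \<Rightarrow> real) \<Rightarrow> real" where
  "par_C1 J K C a b a' b' =
     \<bar>C\<bar> * (2 * pi) powr ((real J - real K) / 2) *
     (\<Prod>j=1..J. \<bar>a j\<bar> powr (b j - 1 / 2)) / (\<Prod>k=1..K. \<bar>a' k\<bar> powr (b' k - 1 / 2))"

end

(*
Put Y = ln X and m(z) = E exp(-z Y). Since F has no negative poles, Landau's theorem on Laplace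
transforms with nonnegative coefficients shows that m is finite, and equal to F(-z), on a whole
right half-plane. Reflecting the Gamma factors with a > 0 writes m as a quotient of Gamma functions
that is regular there, times a quotient of sine products. This quotient is holomorphic and
zero-free in a half-plane; it is bounded there, so its translates by large almost periods (Dirichlet)
become constant, and hence it is itself a constant, of modulus 1 when each sine is doubled.

Stirling's formula then gives m(z) / g^(z) -> 1 as Re z tends to infinity, uniformly in Im z, where
g^ is the Laplace transform of the claimed asymptotic density g of Y, an explicit multiple of
Gamma(gamma z + delta + 1/2). Fourier inversion on the line Re z = sigma bounds |f_Y(y) - g(y)|
by eps * exp(sigma y) * (integral of |g^| over that line); with sigma at the saddle point and
|Gamma(u + i t)| <= Gamma(u) / (1 + t^2 / (25 u)) this is at most a constant times eps * g(y).
*)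

theory Submission
  imports Defs "HOL-Real_Asymp.Real_Asymp"
begin

section \<open>Laplace transforms near the boundary of convergence\<close>

text \<open>The absence of negative poles is a cancellation between Gamma factors with unrelated
  parameters; no pairing of factors is assumed and none is constructed. Instead the quotient of sine
  products is shown constant analytically. It has no zeros: off the real axis no sine vanishes, and
  on it a zero would be a vanishing moment of a positive variable. The situation is thus symmetric
  under inversion, so the side of larger exponential type may be taken as denominator, which gives
  boundedness. Growth on a vertical line also shows that the positive \<open>a j\<close> and the
  positive \<open>a' k\<close> have equal sums; this turns gamma, defined through absolute values,
  into the coefficient of z ln z that Stirling's formula produces.

  The second obstacle is that no regularity of \<open>fY\<close> beyond continuity is available, so
  inversion is used only as an inequality. It follows by Gaussian smoothing from an integrable
  majorant of the transform of the tilted difference of the densities; the asymptotic relation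
  between the Laplace transforms supplies that majorant, whose integrability comes from the decay of
  Gamma.\<close>

lemma exp_abs_mult_le: "exp (r * \<bar>y\<bar> + x * y) \<le> exp ((x + r) * y) + exp ((x - r) * (y::real))"
  by (cases "y \<ge> 0") (auto simp: algebra_simps)

text \<open>Dominated convergence for the exponential series in \<open>w\<close>: the partial sums
  of absolute values stay below \<open>exp (norm w * |Y| + Re z * Y)\<close>, hence below the sum of
  the two exponentials assumed integrable.\<close>

lemma laplace_power_series:
  fixes M :: "'w measure" and Y :: "'w \<Rightarrow> real" and z w :: complex
  assumes [measurable]: "Y \<in> borel_measurable M"
    and int1: "integrable M (\<lambda>\<omega>. exp ((Re z + norm w) * Y \<omega>))"
    and int2: "integrable M (\<lambda>\<omega>. exp ((Re z - norm w) * Y \<omega>))"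
  shows "(\<lambda>n. (\<integral>\<omega>. of_real (Y \<omega>) ^ n * exp (z * of_real (Y \<omega>)) \<partial>M) / fact n * w ^ n) sums
           (\<integral>\<omega>. exp ((z + w) * of_real (Y \<omega>)) \<partial>M)"
proof -
  define t where "t = (\<lambda>n \<omega>. (w * of_real (Y \<omega>)) ^ n / fact n * exp (z * of_real (Y \<omega>)))"
  define B where "B = (\<lambda>\<omega>. exp ((Re z + norm w) * Y \<omega>) + exp ((Re z - norm w) * Y \<omega>))"
  have [measurable]: "t n \<in> borel_measurable M" for n unfolding t_def by measurable
  have bound: "(\<Sum>k\<in>K. norm (t k \<omega>)) \<le> B \<omega>" if "finite K" for K \<omega>
  proof -
    have "(\<Sum>k\<in>K. norm (t k \<omega>)) = (\<Sum>k\<in>K. (norm w * \<bar>Y \<omega>\<bar>) ^ k / fact k) * exp (Re z * Y \<omega>)"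
      by (simp add: t_def norm_mult norm_power norm_divide sum_distrib_right)
    also have "\<dots> \<le> exp (norm w * \<bar>Y \<omega>\<bar>) * exp (Re z * Y \<omega>)"
    proof (rule mult_right_mono)
      have "(\<lambda>k. (norm w * \<bar>Y \<omega>\<bar>) ^ k / fact k) sums exp (norm w * \<bar>Y \<omega>\<bar>)"
        using exp_converges[of "norm w * \<bar>Y \<omega>\<bar>"] by (simp add: field_simps)
      then show "(\<Sum>k\<in>K. (norm w * \<bar>Y \<omega>\<bar>) ^ k / fact k) \<le> exp (norm w * \<bar>Y \<omega>\<bar>)"
        using sum_le_suminf[of "\<lambda>k. (norm w * \<bar>Y \<omega>\<bar>) ^ k / fact k" K] that
        by (auto simp: sums_iff)
    qed simp
    also have "\<dots> \<le> B \<omega>"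
      unfolding B_def using exp_abs_mult_le[of "norm w" "Y \<omega>" "Re z"] by (simp add: exp_add)
    finally show ?thesis .
  qed
  have intB: "integrable M B" unfolding B_def using int1 int2 by simp
  have int_t: "integrable M (t n)" for n
  proof (rule Bochner_Integration.integrable_bound[OF intB])
    show "AE \<omega> in M. norm (t n \<omega>) \<le> norm (B \<omega>)"
      using bound[of "{n}"] by (auto simp: B_def)
  qed simp
  have "(\<lambda>n. \<integral>\<omega>. (\<Sum>k<n. t k \<omega>) \<partial>M) \<longlonglongrightarrow> (\<integral>\<omega>. exp ((z + w) * of_real (Y \<omega>)) \<partial>M)"
  proof (rule integral_dominated_convergence[OF _ _ intB])
    show "AE \<omega> in M. (\<lambda>n. \<Sum>k<n. t k \<omega>) \<longlonglongrightarrow> exp ((z + w) * of_real (Y \<omega>))"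
    proof (rule AE_I2)
      fix \<omega>
      have "(\<lambda>n. (w * of_real (Y \<omega>)) ^ n / fact n) sums exp (w * of_real (Y \<omega>))"
        using exp_converges[of "w * complex_of_real (Y \<omega>)"]
        by (simp add: scaleR_conv_of_real field_simps)
      then have "(\<lambda>n. t n \<omega>) sums (exp (w * of_real (Y \<omega>)) * exp (z * of_real (Y \<omega>)))"
        unfolding t_def by (rule sums_mult2)
      then show "(\<lambda>n. \<Sum>k<n. t k \<omega>) \<longlonglongrightarrow> exp ((z + w) * of_real (Y \<omega>))"
        by (simp add: sums_def algebra_simps flip: exp_add)
    qed
    show "AE \<omega> in M. norm (\<Sum>k<n. t k \<omega>) \<le> B \<omega>" for n
      by (intro AE_I2 order_trans[OF norm_sum bound]) simp
  qed auto
  moreover have "(\<integral>\<omega>. (\<Sum>k<n. t k \<omega>) \<partial>M) =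
      (\<Sum>k<n. (\<integral>\<omega>. of_real (Y \<omega>) ^ k * exp (z * of_real (Y \<omega>)) \<partial>M) / fact k * w ^ k)" for n
  proof -
    have "integral\<^sup>L M (t k) = (\<integral>\<omega>. of_real (Y \<omega>) ^ k * exp (z * of_real (Y \<omega>)) \<partial>M) / fact k * w ^ k" for k
    proof -
      have "t k = (\<lambda>\<omega>. (w ^ k / fact k) * (of_real (Y \<omega>) ^ k * exp (z * of_real (Y \<omega>))))"
        by (auto simp: t_def power_mult_distrib)
      then show ?thesis by (simp add: mult.commute)
    qed
    then show ?thesis using int_t by (subst Bochner_Integration.integral_sum) auto
  qed
  ultimately show ?thesis by (simp add: sums_def)
qed

text \<open>Local power series replace differentiation under the integral: around \<open>z\<close>
  the expansion is valid at each \<open>w\<close> for which \<open>Re z + norm (w - z)\<close> and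
  \<open>Re z - norm (w - z)\<close> both lie in \<open>S\<close>.\<close>

lemma laplace_holomorphic:
  fixes M :: "'w measure" and Y :: "'w \<Rightarrow> real"
  assumes [measurable]: "Y \<in> borel_measurable M" and "open S"
    and int: "\<And>x. x \<in> S \<Longrightarrow> integrable M (\<lambda>\<omega>. exp (x * Y \<omega>))"
  shows "(\<lambda>z. \<integral>\<omega>. exp (z * of_real (Y \<omega>)) \<partial>M) holomorphic_on {z. Re z \<in> S}"
proof -
  let ?m = "\<lambda>z. \<integral>\<omega>. exp (z * of_real (Y \<omega>)) \<partial>M"
  have "open (Re -` S)"
    using \<open>open S\<close> by (simp add: open_vimage continuous_on_Re continuous_on_id)
  then have op: "open {z. Re z \<in> S}" by (simp add: vimage_def)
  have "?m field_differentiable at z" if "Re z \<in> S" for z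
  proof -
    obtain e where e: "e > 0" "ball (Re z) e \<subseteq> S" using \<open>open S\<close> \<open>Re z \<in> S\<close> openE by blast
    have "?m holomorphic_on ball z e"
    proof (rule power_series_holomorphic)
      fix w assume w: "w \<in> ball z e"
      then have "norm (w - z) < e" by (simp add: dist_norm norm_minus_commute)
      then have "Re z + norm (w - z) \<in> S" "Re z - norm (w - z) \<in> S"
        using e(2) by (auto intro!: subsetD[OF e(2)] simp: dist_real_def)
      then show "(\<lambda>n. (\<integral>\<omega>. of_real (Y \<omega>) ^ n * exp (z * of_real (Y \<omega>)) \<partial>M) / fact n * (w - z) ^ n) sums ?m w"
        using laplace_power_series[OF assms(1) int int, of z "w - z"] by simp
    qed
    then show ?thesis using e(1) by (meson centre_in_ball holomorphic_on_imp_differentiable_at open_ball)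
  qed
  then show ?thesis using op by (auto simp: holomorphic_on_def intro: field_differentiable_at_within)
qed

text \<open>The local form of Landau's theorem. The moments \<open>c n\<close> are the Taylor
  coefficients of \<open>F\<close> at \<open>s\<close>, so their series converges on the whole disc
  of holomorphy. Odd moments have no sign, but adding the series at \<open>h\<close> and
  \<open>- h\<close> leaves even powers only, which are nonnegative functions of \<open>Y\<close>;
  summing them under the integral makes both exponentials integrable at any distance below
  \<open>r\<close> instead of \<open>e\<close>.\<close>

lemma laplace_extends:
  fixes M :: "'w measure" and Y :: "'w \<Rightarrow> real" and s r e :: real
  assumes [measurable]: "Y \<in> borel_measurable M"
    and e: "e > 0" and r: "r > 0"
    and int: "\<And>x. \<bar>x - s\<bar> < e \<Longrightarrow> integrable M (\<lambda>\<omega>. exp (x * Y \<omega>))"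
    and eq: "\<And>x. \<bar>x - s\<bar> < e \<Longrightarrow> F (of_real x) = of_real (\<integral>\<omega>. exp (x * Y \<omega>) \<partial>M)"
    and hol: "F holomorphic_on ball (of_real s) r"
    and x: "\<bar>x - s\<bar> < r"
  shows "integrable M (\<lambda>\<omega>. exp (x * Y \<omega>))" "F (of_real x) = of_real (\<integral>\<omega>. exp (x * Y \<omega>) \<partial>M)"
proof -
  define c where "c = (\<lambda>n. (\<integral>\<omega>. Y \<omega> ^ n * exp (s * Y \<omega>) \<partial>M) / fact n)"
  define d where "d = (\<lambda>n. (deriv ^^ n) F (of_real s) / fact n)"
  have cmpl: "(\<integral>\<omega>. exp (of_real y * of_real (Y \<omega>)) \<partial>M) = complex_of_real (\<integral>\<omega>. exp (y * Y \<omega>) \<partial>M)" for y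
    by (simp add: exp_of_real flip: of_real_mult)
  have c_cmpl: "(\<integral>\<omega>. of_real (Y \<omega>) ^ n * exp (of_real s * of_real (Y \<omega>)) \<partial>M) / fact n = complex_of_real (c n)" for n
    by (simp add: c_def exp_of_real flip: of_real_mult of_real_power)
  have c_sums: "(\<lambda>n. of_real (c n) * (of_real h) ^ n) sums complex_of_real (\<integral>\<omega>. exp ((s + h) * Y \<omega>) \<partial>M)"
    if "integrable M (\<lambda>\<omega>. exp ((s + \<bar>h\<bar>) * Y \<omega>))" "integrable M (\<lambda>\<omega>. exp ((s - \<bar>h\<bar>) * Y \<omega>))" for h :: real
    using laplace_power_series[OF assms(1), of "of_real s" "of_real h"] that
    by (simp add: c_cmpl cmpl flip: of_real_add)
  have d_sums: "(\<lambda>n. d n * (w - of_real s) ^ n) sums F w" if "w \<in> ball (of_real s) r" for w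
    unfolding d_def by (rule holomorphic_power_series[OF hol that])
  have dc: "d n = of_real (c n)" for n
  proof -
    define \<rho> where "\<rho> = min e r / 2"
    have \<rho>: "\<rho> > 0" "\<rho> < e" "\<rho> < r" using e r by (auto simp: \<rho>_def)
    \<comment> \<open>The two series are known to agree only at real points near \<open>s\<close>.
      That is enough: a nonzero power series vanishing at 0 has no other zero in a small disc,
      whereas the difference vanishes at the real point \<open>min \<rho> \<delta>\<close>.\<close>
    have "d n - of_real (c n) = 0"
    proof (rule ccontr)
      assume ne: "d n - of_real (c n) \<noteq> 0"
      define a where "a = (\<lambda>n. d n - complex_of_real (c n))"
      have sm: "(\<lambda>n. a n * (of_real h) ^ n) sums 0" if "\<bar>h\<bar> \<le> \<rho>" for h :: real
      proof -
        have 1: "(\<lambda>n. d n * (of_real h) ^ n) sums F (of_real (s + h))"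
          using d_sums[of "of_real (s + h)"] that \<rho> by (simp add: dist_norm)
        have 2: "(\<lambda>n. of_real (c n) * (of_real h) ^ n) sums F (of_real (s + h))"
          using c_sums[of h] eq[of "s + h"] int that \<rho> by simp
        show ?thesis using sums_diff[OF 1 2] by (simp add: a_def left_diff_distrib)
      qed
      have summ: "summable (\<lambda>n. a n * w ^ n)" if "norm w < \<rho>" for w
        using powser_inside[of a "of_real \<rho>" w] sm[of \<rho>] \<rho> that by (auto simp: sums_iff)
      have a0: "a 0 = 0" using sm[of 0] \<rho> by (simp add: powser_sums_zero_iff)
      obtain m where "a m \<noteq> 0" using ne by (auto simp: a_def)
      with a0 have "m > 0" by (cases m) auto
      obtain \<delta> where \<delta>: "0 < \<delta>" "\<And>z. z \<in> cball 0 \<delta> - {0} \<Longrightarrow> (\<Sum>n. a n * z ^ n) \<noteq> 0"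
      proof (rule powser_0_nonzero[of \<rho> 0 a "\<lambda>w. \<Sum>n. a n * w ^ n" m])
        show "(\<lambda>n. a n * (x - 0) ^ n) sums (\<Sum>n. a n * x ^ n)" if "norm (x - 0) < \<rho>" for x
          using summ[of x] that by (simp add: summable_sums)
      qed (use \<rho> a0 \<open>a m \<noteq> 0\<close> \<open>m > 0\<close> in auto)
      moreover have "(\<Sum>n. a n * of_real (min \<rho> \<delta>) ^ n) = 0"
        using sm[of "min \<rho> \<delta>"] \<rho> \<delta>(1) by (auto simp: sums_iff)
      ultimately have False using \<delta>(1) \<delta>(2)[of "of_real (min \<rho> \<delta>)"] \<rho> by (auto simp: min_def)
      then show False .
    qed
    then show ?thesis by simp
  qed
  define h where "h = \<bar>x - s\<bar>"
  have h: "0 \<le> h" "h < r" using x by (auto simp: h_def)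
  have "summable (\<lambda>n. c n * h ^ n)" "summable (\<lambda>n. c n * (-h) ^ n)"
  proof -
    have sc: "summable (\<lambda>n. complex_of_real (c n * y ^ n))" if "\<bar>y\<bar> < r" for y
      using d_sums[of "of_real (s + y)"] that by (auto simp: sums_iff dc dist_norm)
    then show "summable (\<lambda>n. c n * h ^ n)" "summable (\<lambda>n. c n * (-h) ^ n)"
      using h sc[of h] sc[of "- h"] by (simp_all only: summable_complex_of_real)
  qed
  then have "summable (\<lambda>n. c n * h ^ n + c n * (-h) ^ n)" by (rule summable_add)
  then have smm: "summable (\<lambda>n. 2 * (if even n then c n * h ^ n else 0))"
    by (rule summable_cong[THEN iffD1, rotated]) auto
  \<comment> \<open>A power of \<open>|Y|\<close> costs an arbitrarily small exponential, being up
    to a constant one term of the series of \<open>exp (\<rho> * |Y|)\<close>.\<close>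
  have int_n: "integrable M (\<lambda>\<omega>. Y \<omega> ^ n * exp (s * Y \<omega>))" for n
  proof -
    define \<rho> where "\<rho> = e / 2"
    have \<rho>: "0 < \<rho>" "\<rho> < e" using e by (auto simp: \<rho>_def)
    have "integrable M (\<lambda>\<omega>. fact n / \<rho> ^ n * (exp ((s + \<rho>) * Y \<omega>) + exp ((s - \<rho>) * Y \<omega>)))"
      using int[of "s + \<rho>"] int[of "s - \<rho>"] \<rho> by auto
    then show ?thesis
    proof (rule Bochner_Integration.integrable_bound)
      have "norm (y ^ n * exp (s * y)) \<le> fact n / \<rho> ^ n * (exp ((s + \<rho>) * y) + exp ((s - \<rho>) * y))" for y :: real
      proof -
        have "(\<rho> * \<bar>y\<bar>) ^ n / fact n \<le> exp (\<rho> * \<bar>y\<bar>)"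
        proof -
          have "(\<lambda>k. (\<rho> * \<bar>y\<bar>) ^ k / fact k) sums exp (\<rho> * \<bar>y\<bar>)"
            using exp_converges[of "\<rho> * \<bar>y\<bar>"] by (simp add: field_simps)
          then show ?thesis
            using sum_le_suminf[of "\<lambda>k. (\<rho> * \<bar>y\<bar>) ^ k / fact k" "{n}"] \<rho> by (auto simp: sums_iff)
        qed
        then have "\<bar>y\<bar> ^ n * exp (s * y) \<le> fact n / \<rho> ^ n * (exp (\<rho> * \<bar>y\<bar>) * exp (s * y))"
          using \<rho> by (simp add: field_simps power_mult_distrib)
        also have "\<dots> \<le> fact n / \<rho> ^ n * (exp ((s + \<rho>) * y) + exp ((s - \<rho>) * y))"
          using exp_abs_mult_le[of \<rho> y s] \<rho> by (intro mult_left_mono) (auto simp: exp_add)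
        finally show ?thesis by (simp add: abs_mult power_abs)
      qed
      then show "AE \<omega> in M. norm (Y \<omega> ^ n * exp (s * Y \<omega>))
          \<le> norm (fact n / \<rho> ^ n * (exp ((s + \<rho>) * Y \<omega>) + exp ((s - \<rho>) * Y \<omega>)))"
        by (intro AE_I2) (metis abs_ge_self order_trans real_norm_def)
    qed simp
  qed
  define t where "t = (\<lambda>n y. 2 * (if even n then (h * y) ^ n / fact n * exp (s * y) else 0 :: real))"
  have [measurable]: "t n \<in> borel_measurable borel" for n unfolding t_def by measurable
  have t_eq: "t n y = (2 * (if even n then h ^ n / fact n else 0)) * (y ^ n * exp (s * y))" for n y
    by (simp add: t_def power_mult_distrib)
  have t_int: "integrable M (\<lambda>\<omega>. t n (Y \<omega>))" for n unfolding t_eq using int_n[of n] by simp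
  have t_nn: "t n y \<ge> 0" for n y using h by (auto simp: t_def zero_le_even_power)
  have t_sums: "(\<lambda>n. t n y) sums (exp ((s + h) * y) + exp ((s - h) * y))" for y
  proof -
    have "(\<lambda>k. (h * y) ^ k / fact k) sums exp (h * y)" "(\<lambda>k. (- (h * y)) ^ k / fact k) sums exp (- (h * y))"
      using exp_converges[of "h * y"] exp_converges[of "- (h * y)"] by (simp_all add: field_simps)
    then have "(\<lambda>k. ((h * y) ^ k / fact k + (- (h * y)) ^ k / fact k) * exp (s * y)) sums
        ((exp (h * y) + exp (- (h * y))) * exp (s * y))"
      by (intro sums_mult2 sums_add)
    moreover have "((h * y) ^ k / fact k + (- (h * y)) ^ k / fact k) * exp (s * y) = t k y" for k
      by (auto simp: t_def)
    ultimately show ?thesis by (simp add: algebra_simps exp_diff exp_add exp_minus divide_inverse)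
  qed
  have "integrable M (\<lambda>\<omega>. \<Sum>n. t n (Y \<omega>))"
  proof (rule integrable_suminf)
    show "AE \<omega> in M. summable (\<lambda>n. norm (t n (Y \<omega>)))"
      using t_sums t_nn by (auto simp: sums_iff)
    have "(\<integral>\<omega>. norm (t n (Y \<omega>)) \<partial>M) = 2 * (if even n then c n * h ^ n else 0)" for n
    proof -
      have "(\<integral>\<omega>. norm (t n (Y \<omega>)) \<partial>M) = (\<integral>\<omega>. t n (Y \<omega>) \<partial>M)" using t_nn by simp
      also have "\<dots> = 2 * (if even n then c n * h ^ n else 0)" unfolding t_eq by (simp add: c_def)
      finally show ?thesis .
    qed
    then show "summable (\<lambda>n. \<integral>\<omega>. norm (t n (Y \<omega>)) \<partial>M)" using smm by simp
  qed (rule t_int)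
  then have "integrable M (\<lambda>\<omega>. exp ((s + h) * Y \<omega>) + exp ((s - h) * Y \<omega>))"
    using t_sums by (simp add: sums_iff)
  then have both: "integrable M (\<lambda>\<omega>. exp ((s + h) * Y \<omega>))" "integrable M (\<lambda>\<omega>. exp ((s - h) * Y \<omega>))"
    by (rule Bochner_Integration.integrable_bound; force simp: abs_of_nonneg add_nonneg_nonneg)+
  then show "integrable M (\<lambda>\<omega>. exp (x * Y \<omega>))"
    by (cases "x \<ge> s") (auto simp: h_def)
  have "(\<lambda>n. of_real (c n) * of_real (x - s) ^ n) sums complex_of_real (\<integral>\<omega>. exp (x * Y \<omega>) \<partial>M)"
    using c_sums[of "x - s"] both by (simp add: h_def)
  moreover have "(\<lambda>n. of_real (c n) * of_real (x - s) ^ n) sums F (of_real x)"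
    using d_sums[of "of_real x"] x by (simp add: dc dist_norm abs_minus_commute flip: of_real_diff)
  ultimately show "F (of_real x) = of_real (\<integral>\<omega>. exp (x * Y \<omega>) \<partial>M)"
    by (rule sums_unique2[symmetric])
qed

text \<open>Landau's argument: let \<open>s\<close> be the infimum of the left ends of intervals up
  to \<open>u\<close> on which the identity holds. If \<open>s\<close> is not a pole,
  \<open>laplace_extends\<close> carries the identity across it, which contradicts the choice of
  \<open>s\<close>.\<close>

lemma laplace_extends_left:
  fixes M :: "'w measure" and Y :: "'w \<Rightarrow> real" and l u :: real
  assumes "prob_space M" and Y [measurable]: "Y \<in> borel_measurable M"
    and lu: "l < u"
    and int: "\<And>x. l < x \<Longrightarrow> x < u \<Longrightarrow> integrable M (\<lambda>\<omega>. exp (x * Y \<omega>))"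
    and eq: "\<And>x. l < x \<Longrightarrow> x < u \<Longrightarrow> F (of_real x) = of_real (\<integral>\<omega>. exp (x * Y \<omega>) \<partial>M)"
    and ana: "\<And>x::real. \<not> is_pole F (of_real x) \<Longrightarrow> F analytic_on {of_real x}"
    and nopole: "\<And>x::real. x < 0 \<Longrightarrow> \<not> is_pole F (of_real x)"
    and "x < u"
  shows "integrable M (\<lambda>\<omega>. exp (x * Y \<omega>)) \<and> F (of_real x) = of_real (\<integral>\<omega>. exp (x * Y \<omega>) \<partial>M)"
proof -
  interpret prob_space M by fact
  define good where "good = (\<lambda>x. integrable M (\<lambda>\<omega>. exp (x * Y \<omega>)) \<and> F (of_real x) = of_real (\<integral>\<omega>. exp (x * Y \<omega>) \<partial>M))"
  define S where "S = {a. a < u \<and> (\<forall>x. a < x \<longrightarrow> x < u \<longrightarrow> good x)}"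
  have lS: "l \<in> S" using lu int eq by (auto simp: S_def good_def)
  have "good x"
  proof (rule ccontr)
    assume bad: "\<not> good x"
    have lb: "x \<le> a" if "a \<in> S" for a
    proof (rule ccontr)
      assume "\<not> x \<le> a"
      then have "good x" using that \<open>x < u\<close> by (simp add: S_def)
      then show False using bad by simp
    qed
    define s where "s = Inf S"
    have bdd: "bdd_below S" using lb by (auto intro!: bdd_belowI)
    have sl: "s \<le> l" unfolding s_def by (rule cInf_lower[OF lS bdd])
    have su: "s < u" using sl lu by simp
    have goods: "good y" if y: "s < y" "y < u" for y
    proof -
      obtain a where "a \<in> S" "a < y"
        using y(1) cInf_less_iff[of S y] lS bdd unfolding s_def by blast
      then show ?thesis using y by (auto simp: S_def)
    qed
    have np: "\<not> is_pole F (of_real s)"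
    proof (cases "s < 0")
      \<comment> \<open>A pole at a nonnegative \<open>s\<close> is not excluded by
        \<open>nopole\<close>. It is impossible because
        \<open>exp (y * Y) <= 1 + exp (t * Y)\<close> for \<open>0 <= y <= t\<close>: the transform
        stays bounded as \<open>y\<close> decreases to \<open>s\<close>, while
        \<open>norm (F z)\<close> tends to infinity at a pole.\<close>
      case False
      show ?thesis
      proof
        assume pole: "is_pole F (of_real s)"
        define t where "t = (s + u) / 2"
        have t: "s < t" "t < u" using su by (auto simp: t_def)
        define B where "B = 1 + (\<integral>\<omega>. exp (t * Y \<omega>) \<partial>M)"
        have "filterlim (\<lambda>z. norm (F z)) at_top (at (of_real s))"
          using pole by (simp add: is_pole_def filterlim_at_infinity_conv_norm_at_top)
        then have "eventually (\<lambda>z. norm (F z) \<ge> B + 1) (at (of_real s))"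
          by (simp add: filterlim_at_top)
        then obtain d where d: "d > 0" "\<And>z. z \<noteq> of_real s \<Longrightarrow> dist z (of_real s) < d \<Longrightarrow> norm (F z) \<ge> B + 1"
          unfolding eventually_at by blast
        define y where "y = s + min (d / 2) (t - s)"
        have y: "s < y" "y \<le> t" "y - s < d" using d(1) t by (auto simp: y_def min_def)
        have gy: "good y" "good t" using y t by (auto intro: goods)
        have "(\<integral>\<omega>. exp (y * Y \<omega>) \<partial>M) \<le> (\<integral>\<omega>. 1 + exp (t * Y \<omega>) \<partial>M)"
        proof (rule integral_mono)
          show "integrable M (\<lambda>\<omega>. exp (y * Y \<omega>))" "integrable M (\<lambda>\<omega>. 1 + exp (t * Y \<omega>))"
            using gy by (auto simp: good_def)
          show "exp (y * Y \<omega>) \<le> 1 + exp (t * Y \<omega>)" for \<omega>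
          proof (cases "Y \<omega> \<ge> 0")
            case True
            then have "exp (y * Y \<omega>) \<le> exp (t * Y \<omega>)" using y by (simp add: mult_right_mono)
            then show ?thesis by linarith
          next
            case neg: False
            have "y * Y \<omega> \<le> 0" using neg y False by (intro mult_nonneg_nonpos) auto
            then have "exp (y * Y \<omega>) \<le> 1" by simp
            then show ?thesis by (simp add: add_increasing2)
          qed
        qed
        also have "\<dots> = B" using gy by (simp add: B_def good_def prob_space)
        finally have "norm (F (of_real y)) \<le> B"
          using gy(1) by (simp add: good_def)
        moreover have "norm (F (of_real y)) \<ge> B + 1"
          using y by (intro d(2)) (auto simp: dist_norm simp flip: of_real_diff)
        ultimately show False by simp
      qed
    qed (use nopole in auto)
    then have "F analytic_on {of_real s}" by (rule ana)
    then obtain \<rho> where \<rho>: "\<rho> > 0" "F holomorphic_on ball (of_real s) \<rho>"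
      by (auto simp: analytic_on_def)
    \<comment> \<open>The expansion is centred at \<open>s + \<eta>\<close>, inside the known
      interval. The bound by half of \<open>u - s\<close> makes a neighbourhood of radius
      \<open>\<eta>\<close> good; the bound by \<open>\<rho> / 3\<close> keeps the disc of radius
      \<open>2 * \<rho> / 3\<close> inside the disc of holomorphy and lets it reach down to
      \<open>s - \<rho> / 3\<close>.\<close>
    define \<eta> where "\<eta> = min (\<rho> / 3) ((u - s) / 2)"
    have \<eta>: "\<eta> > 0" "\<eta> \<le> \<rho> / 3" "\<eta> \<le> (u - s) / 2" using \<rho>(1) su by (auto simp: \<eta>_def min_def)
    have sub: "ball (complex_of_real (s + \<eta>)) (2 * \<rho> / 3) \<subseteq> ball (of_real s) \<rho>"
    proof
      fix z assume z: "z \<in> ball (complex_of_real (s + \<eta>)) (2 * \<rho> / 3)"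
      have "dist (complex_of_real s) z \<le> dist (complex_of_real s) (of_real (s + \<eta>)) + dist (of_real (s + \<eta>)) z"
        by (rule dist_triangle)
      also have "dist (complex_of_real s) (of_real (s + \<eta>)) = \<eta>" using \<eta> by (simp add: dist_norm)
      finally show "z \<in> ball (of_real s) \<rho>" using z \<eta> by simp
    qed
    have near0: "good y" if "\<bar>y - (s + \<eta>)\<bar> < \<eta>" for y
    proof -
      have 1: "y - (s + \<eta>) < \<eta>" "- \<eta> < y - (s + \<eta>)" using that by arith+
      have "2 * \<eta> \<le> u - s" using \<eta>(3) by simp
      then show ?thesis using 1 by (intro goods) linarith+
    qed
    have hol: "F holomorphic_on ball (of_real (s + \<eta>)) (2 * \<rho> / 3)"
      by (rule holomorphic_on_subset[OF \<rho>(2) sub])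
    have r: "2 * \<rho> / 3 > 0" using \<rho>(1) by simp
    have near: "good y" if "\<bar>y - (s + \<eta>)\<bar> < 2 * \<rho> / 3" for y
      using laplace_extends[OF Y \<eta>(1) r near0[unfolded good_def, THEN conjunct1]
          near0[unfolded good_def, THEN conjunct2] hol that]
      unfolding good_def by blast
    have "s - \<rho> / 3 \<in> S"
      unfolding S_def
    proof (safe)
      show "s - \<rho> / 3 < u" using \<rho> su by simp
      fix y assume "s - \<rho> / 3 < y" "y < u"
      then show "good y" using near[of y] goods[of y] \<eta> \<rho>(1) by (cases "y > s") (simp_all add: abs_less_iff)
    qed
    then have "s \<le> s - \<rho> / 3" unfolding s_def by (rule cInf_lower[OF _ bdd])
    then show False using \<rho> by simp
  qed
  then show ?thesis by (simp add: good_def)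
qed

section \<open>Zero-free quotients of sine products\<close>

definition sin2 :: "real \<Rightarrow> real \<Rightarrow> complex \<Rightarrow> complex" where
  "sin2 a b z = 2 * sin (of_real pi * (of_real a * z + of_real b))"

lemma holomorphic_sin2 [holomorphic_intros]: "sin2 a b holomorphic_on A"
  unfolding sin2_def [abs_def] by (intro holomorphic_intros)

text \<open>Up to a unimodular factor a doubled sine is the difference of e^(iw) and e^(-iw), of
  moduli e^(-Im w) and e^(Im w), and both bounds are triangle inequalities. Doubling is what gives
  the dominant exponential the coefficient 1.\<close>

lemma norm_sin2_bounds:
  assumes "a > 0"
  shows "norm (sin2 a b z) \<le> exp (pi * a * \<bar>Im z\<bar>) + exp (- (pi * a * \<bar>Im z\<bar>))"
    and "norm (sin2 a b z) \<ge> exp (pi * a * \<bar>Im z\<bar>) - exp (- (pi * a * \<bar>Im z\<bar>))"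
proof -
  define w where "w = of_real pi * (of_real a * z + of_real b)"
  have Im: "Im w = pi * a * Im z" by (simp add: w_def)
  have absIm: "\<bar>Im w\<bar> = pi * a * \<bar>Im z\<bar>" using assms by (simp add: Im abs_mult)
  have n1: "norm (exp (\<i> * w)) = exp (- Im w)" "norm (exp (- (\<i> * w))) = exp (Im w)" by simp_all
  have eq: "norm (sin2 a b z) = norm (exp (\<i> * w) - exp (- (\<i> * w)))"
    by (simp add: sin2_def w_def[symmetric] sin_exp_eq norm_divide norm_mult)
  have s: "exp (- Im w) + exp (Im w) = exp \<bar>Im w\<bar> + exp (- \<bar>Im w\<bar>)"
    "\<bar>exp (- Im w) - exp (Im w)\<bar> = exp \<bar>Im w\<bar> - exp (- \<bar>Im w\<bar>)"
    by (cases "Im w \<ge> 0"; simp)+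
  show "norm (sin2 a b z) \<le> exp (pi * a * \<bar>Im z\<bar>) + exp (- (pi * a * \<bar>Im z\<bar>))"
    using norm_triangle_ineq4[of "exp (\<i> * w)" "exp (- (\<i> * w))"] s unfolding eq n1 absIm by linarith
  show "norm (sin2 a b z) \<ge> exp (pi * a * \<bar>Im z\<bar>) - exp (- (pi * a * \<bar>Im z\<bar>))"
    using norm_triangle_ineq3[of "exp (\<i> * w)" "exp (- (\<i> * w))"] s unfolding eq n1 absIm by linarith
qed

lemma sin2_nonzero:
  assumes "a > 0" "Im z \<noteq> 0"
  shows "sin2 a b z \<noteq> 0"
proof -
  have "pi * a * \<bar>Im z\<bar> > 0" using assms by simp
  then have "exp (pi * a * \<bar>Im z\<bar>) - exp (- (pi * a * \<bar>Im z\<bar>)) > 0" by simp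
  then show ?thesis using norm_sin2_bounds(2)[OF assms(1), of z b] by auto
qed

lemma norm_sin2_upper:
  assumes "a > 0"
  shows "norm (sin2 a b z) \<le> 2 * exp (pi * a * \<bar>Im z\<bar>)"
proof -
  have "exp (- (pi * a * \<bar>Im z\<bar>)) \<le> exp (pi * a * \<bar>Im z\<bar>)" using assms by simp
  then show ?thesis using norm_sin2_bounds(1)[OF assms, of b z] by linarith
qed

text \<open>From 1 / (e^v - e^(-v)) = e^(-v) (1 + 1 / (e^(2v) - 1)) and e^(2v) - 1 >= 2v. The
  singular factor \<open>1 + 1 / |Im z|\<close> is split off from the dependence on
  \<open>a\<close>, so that in a product of such bounds it simply becomes a power.\<close>

lemma norm_sin2_lower:
  assumes "a > 0" "Im z \<noteq> 0"
  shows "1 / norm (sin2 a b z) \<le> exp (- (pi * a * \<bar>Im z\<bar>)) * ((1 + 1 / (2 * pi * a)) * (1 + 1 / \<bar>Im z\<bar>))"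
proof -
  define v where "v = pi * a * \<bar>Im z\<bar>"
  have v: "v > 0" using assms by (simp add: v_def)
  have e2: "exp (2 * v) \<ge> 1 + 2 * v" by (rule exp_ge_add_one_self)
  have e2': "exp (2 * v) = exp v * exp v" by (simp flip: exp_add)
  have "1 / norm (sin2 a b z) \<le> 1 / (exp v - exp (- v))"
    using norm_sin2_bounds(2)[OF assms(1), of z b] v
    by (intro divide_left_mono mult_pos_pos) (auto simp: v_def sin2_nonzero assms)
  also have "\<dots> = exp (- v) * (exp (2 * v) / (exp (2 * v) - 1))"
    using v unfolding e2' by (simp add: exp_minus field_simps)
  also have "\<dots> \<le> exp (- v) * (1 + 1 / (2 * v))"
  proof (rule mult_left_mono)
    have "exp (2 * v) / (exp (2 * v) - 1) = 1 + 1 / (exp (2 * v) - 1)"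
      using v by (simp add: field_simps)
    also have "\<dots> \<le> 1 + 1 / (2 * v)"
    proof -
      have "2 * v \<le> exp (2 * v) - 1" using e2 by linarith
      then show ?thesis using v by (intro add_left_mono divide_left_mono mult_pos_pos) linarith+
    qed
    finally show "exp (2 * v) / (exp (2 * v) - 1) \<le> 1 + 1 / (2 * v)" .
  qed simp
  also have "\<dots> \<le> exp (- v) * ((1 + 1 / (2 * pi * a)) * (1 + 1 / \<bar>Im z\<bar>))"
  proof (rule mult_left_mono)
    have "1 / (2 * v) = 1 / (2 * pi * a) * (1 / \<bar>Im z\<bar>)" by (simp add: v_def)
    then show "1 + 1 / (2 * v) \<le> (1 + 1 / (2 * pi * a)) * (1 + 1 / \<bar>Im z\<bar>)"
      using assms by (simp only: distrib_left distrib_right) simp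
  qed simp
  finally show ?thesis by (simp add: v_def)
qed

text \<open>Multiplying by \<open>((z - x)\<^sup>2 - 1)\<^sup>k\<close>, which on the unit circle about \<open>x\<close> has
  modulus \<open>(2 \<bar>Im z\<bar>)\<^sup>k\<close>, compensates the singular bound near the real axis.\<close>

lemma bounded_by_Im_power_imp_bounded:
  fixes G :: "complex \<Rightarrow> complex"
  assumes hol: "G holomorphic_on {z. Re z < -R}" and "M \<ge> 0"
    and bd: "\<And>z. Re z < -R \<Longrightarrow> Im z \<noteq> 0 \<Longrightarrow> norm (G z) \<le> M * (1 + 1 / \<bar>Im z\<bar>) ^ k"
    and z0: "Re z0 < -R - 1"
  shows "norm (G z0) \<le> M * 4 ^ Suc k"
proof (cases "\<bar>Im z0\<bar> < 1")
  case False
  then have "norm (G z0) \<le> M * (1 + 1 / \<bar>Im z0\<bar>) ^ k" using bd[of z0] z0 by auto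
  also have "\<dots> \<le> M * 4 ^ k"
    using False \<open>M \<ge> 0\<close> by (intro mult_left_mono power_mono) (auto simp: field_simps)
  also have "\<dots> \<le> M * 4 ^ Suc k" using \<open>M \<ge> 0\<close> by (intro mult_left_mono) auto
  finally show ?thesis .
next
  case True
  define x where "x = complex_of_real (Re z0)"
  \<comment> \<open>The exponent is \<open>Suc k\<close> rather than \<open>k\<close> so that
    \<open>g\<close> vanishes at the two real points of the circle even for \<open>k = 0\<close>;
    \<open>bd\<close> gives no information there.\<close>
  define g where "g = (\<lambda>z. G z * ((z - x)\<^sup>2 - 1) ^ Suc k)"
  have sub: "cball x 1 \<subseteq> {z. Re z < -R}"
  proof
    fix z assume "z \<in> cball x 1"
    then have "\<bar>Re (z - x)\<bar> \<le> 1"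
      using abs_Re_le_cmod[of "z - x"] by (simp add: dist_norm norm_minus_commute)
    then show "z \<in> {z. Re z < -R}" using z0 by (simp add: x_def)
  qed
  have ghol: "g holomorphic_on cball x 1"
    unfolding g_def by (intro holomorphic_intros holomorphic_on_subset[OF hol sub])
  have "norm (g z0) \<le> M * 4 ^ Suc k"
  proof (rule maximum_modulus_frontier[of g "cball x 1"])
    show "g holomorphic_on interior (cball x 1)"
      by (rule holomorphic_on_subset[OF ghol interior_subset])
    show "continuous_on (closure (cball x 1)) g"
      using holomorphic_on_imp_continuous_on[OF ghol] by simp
    show "z0 \<in> cball x 1" using True by (simp add: x_def dist_norm cmod_def)
    fix z assume "z \<in> frontier (cball x 1)"
    then have z: "norm (z - x) = 1" by (simp add: frontier_cball dist_norm norm_minus_commute)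
    have Imz: "Im (z - x) = Im z" by (simp add: x_def)
    \<comment> \<open>On the circle 1 may be replaced by the squared modulus of
      \<open>z - x\<close>, so a factor \<open>z - x\<close> comes out; since \<open>x\<close> is
      real, the other factor is purely imaginary.\<close>
    have "(z - x)\<^sup>2 - 1 = (z - x)\<^sup>2 - (z - x) * cnj (z - x)"
      by (metis complex_norm_square z of_real_1 one_power2)
    also have "\<dots> = (z - x) * ((z - x) - cnj (z - x))" by (simp add: power2_eq_square algebra_simps)
    also have "(z - x) - cnj (z - x) = of_real (2 * Im z) * \<i>" by (simp add: complex_eq_iff x_def)
    also have "norm ((z - x) * (of_real (2 * Im z) * \<i>)) = 2 * \<bar>Im z\<bar>"
      by (simp only: norm_mult z norm_of_real) simp
    finally have n: "norm ((z - x)\<^sup>2 - 1) = 2 * \<bar>Im z\<bar>" .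
    show "norm (g z) \<le> M * 4 ^ Suc k"
    proof (cases "Im z = 0")
      case True
      then show ?thesis using n \<open>M \<ge> 0\<close> by (simp add: g_def)
    next
      case False
      have "\<bar>Im z\<bar> \<le> 1" using abs_Im_le_cmod[of "z - x"] z Imz by simp
      have "z \<in> cball x 1" using z by (simp add: dist_norm norm_minus_commute)
      then have "norm (G z) \<le> M * (1 + 1 / \<bar>Im z\<bar>) ^ k" using bd[of z] sub False by auto
      also have "\<dots> \<le> M * (1 + 1 / \<bar>Im z\<bar>) ^ Suc k"
        using \<open>M \<ge> 0\<close> by (intro mult_left_mono power_increasing) auto
      finally have "norm (g z) \<le> M * (1 + 1 / \<bar>Im z\<bar>) ^ Suc k * (2 * \<bar>Im z\<bar>) ^ Suc k"
        unfolding g_def norm_mult norm_power n by (intro mult_right_mono) auto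
      also have "\<dots> = M * ((1 + 1 / \<bar>Im z\<bar>) * (2 * \<bar>Im z\<bar>)) ^ Suc k"
        by (simp only: power_mult_distrib mult.assoc)
      \<comment> \<open>Origin of the 4: (1 + 1/t) 2t = 2t + 2 <= 4 for t = \<open>|Im z|\<close> at
        most 1.\<close>
      also have "\<dots> \<le> M * 4 ^ Suc k"
        using \<open>M \<ge> 0\<close> False \<open>\<bar>Im z\<bar> \<le> 1\<close>
        by (intro mult_left_mono power_mono) (auto simp: field_simps)
      finally show ?thesis .
    qed
  qed simp
  moreover have "norm (G z0) \<le> norm (g z0)"
  proof -
    \<comment> \<open>Since \<open>z0\<close> lies vertically above or below the centre, the
      multiplier has modulus \<open>1 + (Im z0)^2\<close> there, so removing it only improves the
      bound.\<close>
    have d: "z0 - x = \<i> * of_real (Im z0)" by (simp add: x_def complex_eq_iff)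
    have "(z0 - x)\<^sup>2 - 1 = - of_real (1 + (Im z0)\<^sup>2)" by (simp add: d power_mult_distrib)
    then have "norm ((z0 - x)\<^sup>2 - 1) = 1 + (Im z0)\<^sup>2" by (simp only: norm_minus_cancel norm_of_real) simp
    then have "norm ((z0 - x)\<^sup>2 - 1) ^ Suc k \<ge> 1" by (intro one_le_power) auto
    then show ?thesis by (simp add: g_def norm_mult norm_power mult_le_cancel_left1 del: power_Suc)
  qed
  ultimately show ?thesis by linarith
qed

text \<open>A translation by at least \<open>n\<close> makes room for a disc of radius
  \<open>n\<close>, on which Cauchy's inequality bounds the derivative by \<open>B / n\<close>.
  Hence any pointwise limit of such translates is constant.\<close>

lemma bounded_halfplane_translates:
  fixes G :: "complex \<Rightarrow> complex"
  assumes hol: "G holomorphic_on {z. Re z < -R}"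
    and bd: "\<And>z. Re z < -R \<Longrightarrow> norm (G z) \<le> B"
    and zw: "Re z < -R" "Re w < -R"
    and \<tau>: "\<And>n. \<tau> n \<ge> real n"
  shows "(\<lambda>n. G (z - of_real (\<tau> n)) - G (w - of_real (\<tau> n))) \<longlonglongrightarrow> 0"
proof (rule Lim_null_comparison)
  show "(\<lambda>n. B / real n * norm (z - w)) \<longlonglongrightarrow> 0" by real_asymp
  show "\<forall>\<^sub>F n in sequentially. norm (G (z - of_real (\<tau> n)) - G (w - of_real (\<tau> n))) \<le> B / real n * norm (z - w)"
    using eventually_gt_at_top[of 0]
  proof eventually_elim
    case (elim n)
    define S where "S = {z. Re z < -R - \<tau> n}"
    have S: "convex S" "open S" unfolding S_def
      by (auto intro: convex_halfspace_Re_lt open_halfspace_Re_lt)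
    have "S \<subseteq> {z. Re z < -R}" using \<tau>[of n] by (auto simp: S_def)
    have "norm (G (z - of_real (\<tau> n)) - G (w - of_real (\<tau> n))) \<le>
        B / real n * norm ((z - of_real (\<tau> n)) - (w - of_real (\<tau> n)))"
    proof (rule field_differentiable_bound[OF S(1)])
      fix \<zeta> assume \<zeta>: "\<zeta> \<in> S"
      have G\<zeta>: "(G has_field_derivative deriv G \<zeta>) (at \<zeta>)"
        using holomorphic_derivI[OF hol open_halfspace_Re_lt] \<zeta> \<open>S \<subseteq> _\<close> by blast
      then show "(G has_field_derivative deriv G \<zeta>) (at \<zeta> within S)" by (rule DERIV_subset) simp
      have sub: "cball \<zeta> (real n) \<subseteq> {z. Re z < -R}"
      proof
        fix u assume "u \<in> cball \<zeta> (real n)"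
        then have "\<bar>Re (u - \<zeta>)\<bar> \<le> real n"
          using abs_Re_le_cmod[of "u - \<zeta>"] by (simp add: dist_norm norm_minus_commute)
        then show "u \<in> {z. Re z < -R}" using \<zeta> \<tau>[of n] by (simp add: S_def)
      qed
      have "norm ((deriv ^^ 1) G \<zeta>) \<le> fact 1 * B / real n ^ 1"
      proof (rule Cauchy_inequality)
        show "G holomorphic_on ball \<zeta> (real n)"
          by (rule holomorphic_on_subset[OF hol order_trans[OF ball_subset_cball sub]])
        show "continuous_on (cball \<zeta> (real n)) G"
          by (rule continuous_on_subset[OF holomorphic_on_imp_continuous_on[OF hol] sub])
        fix u assume "norm (\<zeta> - u) = real n"
        then have "u \<in> cball \<zeta> (real n)" by (simp add: dist_norm)
        then show "norm (G u) \<le> B" using sub bd by auto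
      qed (use elim in simp)
      then show "norm (deriv G \<zeta>) \<le> B / real n" by simp
    qed (use zw in \<open>auto simp: S_def\<close>)
    then show ?case by simp
  qed
qed

text \<open>Dirichlet's theorem makes finitely many multiples close to integers at once. Since
  \<open>sin2 a b\<close> has period \<open>2 / a\<close>, the products
  \<open>\<alpha> i * \<tau> n\<close> must approach even integers, hence the halved frequencies in
  the proof.\<close>

lemma simultaneous_almost_periods:
  fixes \<alpha> \<beta> :: "nat \<Rightarrow> real"
  assumes "finite I" "finite L"
  obtains \<tau> :: "nat \<Rightarrow> real" and \<epsilon> \<epsilon>' :: "nat \<Rightarrow> nat \<Rightarrow> real" and p p' :: "nat \<Rightarrow> nat \<Rightarrow> int"
  where "\<And>n. \<tau> n \<ge> real n"
    and "\<And>n i. i \<in> I \<Longrightarrow> \<alpha> i * \<tau> n = 2 * of_int (p n i) + 2 * \<epsilon> n i"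
    and "\<And>n i. i \<in> L \<Longrightarrow> \<beta> i * \<tau> n = 2 * of_int (p' n i) + 2 * \<epsilon>' n i"
    and "\<And>i. i \<in> I \<Longrightarrow> (\<lambda>n. \<epsilon> n i) \<longlonglongrightarrow> 0" and "\<And>i. i \<in> L \<Longrightarrow> (\<lambda>n. \<epsilon>' n i) \<longlonglongrightarrow> 0"
proof -
  obtain N where N: "\<And>i. i \<in> I \<union> L \<Longrightarrow> i < N"
    using assms by (metis finite_UnI finite_nat_set_iff_bounded)
  \<comment> \<open>The two families are interleaved by parity of the index. The factor
    \<open>n\<close> is built into the frequencies so that \<open>\<tau> n\<close>, the product of
    \<open>n\<close> and Dirichlet's \<open>q n >= 1\<close>, grows even if the \<open>q n\<close>
    stay bounded.\<close>
  define \<theta> where "\<theta> = (\<lambda>n j. real n * (if even j then \<alpha> (j div 2) else \<beta> (j div 2)) / 2)"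
  have "\<exists>q p. 0 < q \<and> (\<forall>j<2 * N. \<bar>of_int q * \<theta> n j - of_int (p j)\<bar> < 1 / real (Suc n))" for n
    using Dirichlet_approx_simult[of "Suc n" "2 * N" "\<theta> n"] by (metis zero_less_Suc)
  then obtain q P where q: "\<And>n. 0 < q n"
    and P: "\<And>n j. j < 2 * N \<Longrightarrow> \<bar>of_int (q n :: int) * \<theta> n j - of_int (P n j)\<bar> < 1 / real (Suc n)"
    by metis
  define \<tau> where "\<tau> = (\<lambda>n. of_int (q n) * real n)"
  define e where "e = (\<lambda>n j. of_int (q n) * \<theta> n j - of_int (P n j))"
  have lim: "(\<lambda>n. e n j) \<longlonglongrightarrow> 0" if "j < 2 * N" for j
  proof (rule Lim_null_comparison)
    show "\<forall>\<^sub>F n in sequentially. norm (e n j) \<le> 1 / real (Suc n)"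
      using P[OF that] by (auto simp: e_def less_imp_le)
    show "(\<lambda>n. 1 / real (Suc n)) \<longlonglongrightarrow> 0" by real_asymp
  qed
  show thesis
  proof
    show "\<tau> n \<ge> real n" for n
    proof -
      have "1 * real n \<le> of_int (q n) * real n" using q[of n] by (intro mult_right_mono) auto
      then show ?thesis by (simp add: \<tau>_def)
    qed
    show "\<alpha> i * \<tau> n = 2 * of_int (P n (2 * i)) + 2 * e n (2 * i)" if "i \<in> I" for n i
      by (simp add: \<tau>_def e_def \<theta>_def)
    show "\<beta> i * \<tau> n = 2 * of_int (P n (2 * i + 1)) + 2 * e n (2 * i + 1)" if "i \<in> L" for n i
      by (simp add: \<tau>_def e_def \<theta>_def)
    show "(\<lambda>n. e n (2 * i)) \<longlonglongrightarrow> 0" if "i \<in> I" for i using N that by (intro lim) auto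
    show "(\<lambda>n. e n (2 * i + 1)) \<longlonglongrightarrow> 0" if "i \<in> L" for i using N[of i] that by (intro lim) auto
  qed
qed

lemma sin2_translate:
  assumes "a * t = 2 * of_int p + 2 * e"
  shows "sin2 a b (z - of_real t) = sin2 a (b - 2 * e) z"
proof -
  have "of_real pi * (of_real a * (z - of_real t) + of_real b) =
      of_real pi * (of_real a * z + of_real b) - of_real (pi * (a * t))"
    by (simp add: algebra_simps)
  also have "\<dots> = of_real pi * (of_real a * z + of_real (b - 2 * e)) - 2 * of_int p * of_real pi"
    unfolding assms by (simp add: algebra_simps)
  finally have eq: "of_real pi * (of_real a * (z - of_real t) + of_real b) =
      of_real pi * (of_real a * z + of_real (b - 2 * e)) - of_real (2 * pi * of_int p)"
    by (simp add: mult_ac)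
  have "sin (complex_of_real (2 * pi * of_int p)) = 0" "cos (complex_of_real (2 * pi * of_int p)) = 1"
    by (simp_all only: sin_of_real cos_of_real cos_int_2pin sin_int_2pin of_real_0 of_real_1)
  then show ?thesis
    unfolding sin2_def eq by (simp add: sin_diff)
qed

lemma sin2_tendsto:
  assumes "e \<longlonglongrightarrow> 0"
  shows "(\<lambda>n. sin2 a (b - 2 * e n) z) \<longlonglongrightarrow> sin2 a b z"
proof -
  have "(\<lambda>n. sin2 a (b - 2 * e n) z) \<longlonglongrightarrow> sin2 a (b - 2 * 0) z"
    unfolding sin2_def by (intro tendsto_intros assms)
  then show ?thesis by simp
qed

lemma sin2_asymp:
  assumes "a > 0"
  shows "((\<lambda>y. norm (sin2 a b (Complex x y)) / exp (pi * a * y)) \<longlongrightarrow> 1) at_top"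
proof (rule tendsto_sandwich)
  show "\<forall>\<^sub>F y in at_top. (exp (pi * a * y) - exp (- (pi * a * y))) / exp (pi * a * y) \<le> norm (sin2 a b (Complex x y)) / exp (pi * a * y)"
    using eventually_gt_at_top[of 0]
  proof eventually_elim
    case (elim y)
    then show ?case using norm_sin2_bounds(2)[OF assms, of "Complex x y" b] by (intro divide_right_mono) auto
  qed
  show "\<forall>\<^sub>F y in at_top. norm (sin2 a b (Complex x y)) / exp (pi * a * y) \<le> (exp (pi * a * y) + exp (- (pi * a * y))) / exp (pi * a * y)"
    using eventually_gt_at_top[of 0]
  proof eventually_elim
    case (elim y)
    then show ?case using norm_sin2_bounds(1)[OF assms, of b "Complex x y"] by (intro divide_right_mono) auto
  qed
  show "((\<lambda>y. (exp (pi * a * y) - exp (- (pi * a * y))) / exp (pi * a * y)) \<longlongrightarrow> 1) at_top"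
    "((\<lambda>y. (exp (pi * a * y) + exp (- (pi * a * y))) / exp (pi * a * y)) \<longlongrightarrow> 1) at_top"
    using assms by real_asymp+
qed

lemma prod_exp_linear:
  "finite I \<Longrightarrow> (\<Prod>i\<in>I. exp (c * \<alpha> i * y)) = exp (c * y * sum \<alpha> I :: real)"
  by (simp add: exp_sum sum_distrib_left mult_ac)

text \<open>By \<open>le\<close> the exponential growth of the numerator is absorbed by the
  denominator, so \<open>G\<close> is bounded off the real axis, and near it by the maximum
  principle above. Along almost periods the phases change by vanishing amounts, so \<open>G\<close>
  is the limit of its own translates, which the Cauchy estimate shows to be constant.\<close>

lemma sin2_quotient_constant_aux:
  fixes \<alpha> \<beta> \<alpha>' \<beta>' :: "nat \<Rightarrow> real" and G :: "complex \<Rightarrow> complex"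
  assumes fin: "finite I" "finite L"
    and pos: "\<And>i. i \<in> I \<Longrightarrow> \<alpha> i > 0" "\<And>i. i \<in> L \<Longrightarrow> \<alpha>' i > 0"
    and le: "sum \<alpha> I \<le> sum \<alpha>' L"
    and hol: "G holomorphic_on {z. Re z < -R}"
    and eq: "\<And>z. Re z < -R \<Longrightarrow> G z * (\<Prod>i\<in>L. sin2 (\<alpha>' i) (\<beta>' i) z) = (\<Prod>i\<in>I. sin2 (\<alpha> i) (\<beta> i) z)"
  shows "\<exists>c. norm c = 1 \<and> (\<forall>z. Re z < -R \<longrightarrow> G z = c) \<and> sum \<alpha> I = sum \<alpha>' L"
proof -
  define P where "P = (\<lambda>z. \<Prod>i\<in>I. sin2 (\<alpha> i) (\<beta> i) z)"
  define Q where "Q = (\<lambda>z. \<Prod>i\<in>L. sin2 (\<alpha>' i) (\<beta>' i) z)"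
  have P0: "P z \<noteq> 0" and Q0: "Q z \<noteq> 0" if "Im z \<noteq> 0" for z
    using that fin pos by (auto simp: P_def Q_def sin2_nonzero)
  have G: "G z = P z / Q z" if "Re z < -R" "Im z \<noteq> 0" for z
    using eq[of z] Q0[of z] that by (simp add: P_def Q_def field_simps)
  define M where "M = 2 ^ card I * (\<Prod>i\<in>L. 1 + 1 / (2 * pi * \<alpha>' i))"
  have M0: "M \<ge> 0" using pos unfolding M_def by (auto intro!: mult_nonneg_nonneg prod_nonneg add_nonneg_nonneg simp: less_imp_le)
  have bd: "norm (G z) \<le> M * (1 + 1 / \<bar>Im z\<bar>) ^ card L" if z: "Re z < -R" "Im z \<noteq> 0" for z
  proof -
    have "norm (G z) = norm (P z) * (\<Prod>i\<in>L. 1 / norm (sin2 (\<alpha>' i) (\<beta>' i) z))"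
      unfolding G[OF z] by (simp add: norm_divide Q_def prod_dividef prod_norm[symmetric])
    also have "\<dots> \<le> (\<Prod>i\<in>I. 2 * exp (pi * \<alpha> i * \<bar>Im z\<bar>)) *
        (\<Prod>i\<in>L. exp (- (pi * \<alpha>' i * \<bar>Im z\<bar>)) * ((1 + 1 / (2 * pi * \<alpha>' i)) * (1 + 1 / \<bar>Im z\<bar>)))"
    proof (rule mult_mono)
      show "norm (P z) \<le> (\<Prod>i\<in>I. 2 * exp (pi * \<alpha> i * \<bar>Im z\<bar>))"
        unfolding P_def prod_norm[symmetric] using pos by (intro prod_mono) (auto intro: norm_sin2_upper)
      show "(\<Prod>i\<in>L. 1 / norm (sin2 (\<alpha>' i) (\<beta>' i) z)) \<le>
        (\<Prod>i\<in>L. exp (- (pi * \<alpha>' i * \<bar>Im z\<bar>)) * ((1 + 1 / (2 * pi * \<alpha>' i)) * (1 + 1 / \<bar>Im z\<bar>)))"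
        using pos z by (intro prod_mono conjI norm_sin2_lower) auto
    qed (auto intro: prod_nonneg)
    also have "\<dots> = M * (1 + 1 / \<bar>Im z\<bar>) ^ card L * exp (pi * \<bar>Im z\<bar> * (sum \<alpha> I - sum \<alpha>' L))"
    proof -
      have "(\<Prod>i\<in>I. 2 * exp (pi * \<alpha> i * \<bar>Im z\<bar>)) = 2 ^ card I * exp (pi * \<bar>Im z\<bar> * sum \<alpha> I)"
        using fin by (simp add: prod.distrib prod_exp_linear)
      moreover have "(\<Prod>i\<in>L. exp (- (pi * \<alpha>' i * \<bar>Im z\<bar>)) * ((1 + 1 / (2 * pi * \<alpha>' i)) * (1 + 1 / \<bar>Im z\<bar>))) =
         exp (- (pi * \<bar>Im z\<bar> * sum \<alpha>' L)) * ((\<Prod>i\<in>L. 1 + 1 / (2 * pi * \<alpha>' i)) * (1 + 1 / \<bar>Im z\<bar>) ^ card L)"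
        using fin prod_exp_linear[of L "- pi" \<alpha>' "\<bar>Im z\<bar>"] by (simp add: prod.distrib)
      ultimately show ?thesis
        by (simp add: M_def right_diff_distrib exp_diff exp_minus field_simps)
    qed
    also have "\<dots> \<le> M * (1 + 1 / \<bar>Im z\<bar>) ^ card L * 1"
      using le M0 by (intro mult_left_mono) (auto simp: mult_nonneg_nonpos intro!: mult_nonneg_nonneg)
    finally show ?thesis by simp
  qed
  define B where "B = M * 4 ^ Suc (card L)"
  \<comment> \<open>The half-plane shrinks by 1 to make room for the unit discs of the maximum
    principle; \<open>const\<close> regains the lost strip, and the real axis, by analytic
    continuation.\<close>
  have bdB: "norm (G z) \<le> B" if "Re z < -(R + 1)" for z
    unfolding B_def by (rule bounded_by_Im_power_imp_bounded[OF hol M0 bd]) (use that in auto)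
  have hol1: "G holomorphic_on {z. Re z < -(R + 1)}" by (rule holomorphic_on_subset[OF hol]) auto
  obtain \<tau> \<epsilon> \<epsilon>' p p' where \<tau>: "\<And>n. \<tau> n \<ge> real n"
    and pI: "\<And>n i. i \<in> I \<Longrightarrow> \<alpha> i * \<tau> n = 2 * of_int (p n i) + 2 * \<epsilon> n i"
    and pL: "\<And>n i. i \<in> L \<Longrightarrow> \<alpha>' i * \<tau> n = 2 * of_int (p' n i) + 2 * \<epsilon>' n i"
    and eI: "\<And>i. i \<in> I \<Longrightarrow> (\<lambda>n. \<epsilon> n i) \<longlonglongrightarrow> 0" and eL: "\<And>i. i \<in> L \<Longrightarrow> (\<lambda>n. \<epsilon>' n i) \<longlonglongrightarrow> 0"
    using simultaneous_almost_periods[OF fin, of \<alpha> \<alpha>'] by metis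
  have lim: "(\<lambda>n. G (z - of_real (\<tau> n))) \<longlonglongrightarrow> G z" if z: "Re z < -R" "Im z \<noteq> 0" for z
  proof -
    have "G (z - of_real (\<tau> n)) = (\<Prod>i\<in>I. sin2 (\<alpha> i) (\<beta> i - 2 * \<epsilon> n i) z) / (\<Prod>i\<in>L. sin2 (\<alpha>' i) (\<beta>' i - 2 * \<epsilon>' n i) z)" for n
    proof -
      have "G (z - of_real (\<tau> n)) = P (z - of_real (\<tau> n)) / Q (z - of_real (\<tau> n))"
        using z \<tau>[of n] by (intro G) auto
      then show ?thesis unfolding P_def Q_def
        using sin2_translate[OF pI] sin2_translate[OF pL] by (simp cong: prod.cong)
    qed
    moreover have "(\<lambda>n. (\<Prod>i\<in>I. sin2 (\<alpha> i) (\<beta> i - 2 * \<epsilon> n i) z) / (\<Prod>i\<in>L. sin2 (\<alpha>' i) (\<beta>' i - 2 * \<epsilon>' n i) z)) \<longlonglongrightarrow> P z / Q z"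
      unfolding P_def Q_def using Q0[OF z(2)]
      by (intro tendsto_divide tendsto_prod sin2_tendsto eI eL) (auto simp: Q_def)
    ultimately show ?thesis using G[OF z] by simp
  qed
  define w0 where "w0 = Complex (-R - 2) 1"
  have Gw: "G z = G w0" if z: "Re z < -(R + 1)" "Im z \<noteq> 0" for z
  proof -
    have "(\<lambda>n. G (z - of_real (\<tau> n)) - G (w0 - of_real (\<tau> n))) \<longlonglongrightarrow> G z - G w0"
      using z by (intro tendsto_diff lim) (auto simp: w0_def)
    moreover have "(\<lambda>n. G (z - of_real (\<tau> n)) - G (w0 - of_real (\<tau> n))) \<longlonglongrightarrow> 0"
      using z by (intro bounded_halfplane_translates[OF hol1 bdB _ _ \<tau>]) (auto simp: w0_def)
    ultimately show ?thesis using LIMSEQ_unique by fastforce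
  qed
  have const: "G z = G w0" if "Re z < -R" for z
  proof (rule analytic_continuation_open[of "{z. Re z < -(R + 1)} \<inter> {z. Im z > 0}" "{z. Re z < -R}" G "\<lambda>_. G w0"])
    show "open ({z. Re z < -(R + 1)} \<inter> {z. Im z > 0})"
      by (intro open_Int open_halfspace_Re_lt open_halfspace_Im_gt)
    show "{z. Re z < -(R + 1)} \<inter> {z. Im z > 0} \<noteq> {}"
      by (auto simp: ex_in_conv[symmetric] intro!: exI[of _ w0] simp: w0_def)
    show "connected {z. Re z < -R}" by (intro convex_connected convex_halfspace_Re_lt)
  qed (use hol that Gw in \<open>auto intro: open_halfspace_Re_lt\<close>)
  \<comment> \<open>Each doubled sine is asymptotic in modulus to \<open>exp (pi * a * y)\<close>,
    whatever its phase, so the limit is exactly 1. With \<open>G\<close> constant and nonzero,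
    unequal sums would make the expression tend to infinity, and equal sums leave
    \<open>norm (G w0) = 1\<close>.\<close>
  have ratio: "((\<lambda>y. norm (G (Complex (-R - 2) y)) * exp (pi * (sum \<alpha>' L - sum \<alpha> I) * y)) \<longlongrightarrow> 1) at_top"
  proof -
    have "((\<lambda>y. (\<Prod>i\<in>I. norm (sin2 (\<alpha> i) (\<beta> i) (Complex (-R - 2) y)) / exp (pi * \<alpha> i * y)) /
        (\<Prod>i\<in>L. norm (sin2 (\<alpha>' i) (\<beta>' i) (Complex (-R - 2) y)) / exp (pi * \<alpha>' i * y))) \<longlongrightarrow> (\<Prod>i\<in>I. 1) / (\<Prod>i\<in>L. 1)) at_top"
      by (intro tendsto_divide tendsto_prod sin2_asymp pos) auto
    moreover have "\<forall>\<^sub>F y in at_top. (\<Prod>i\<in>I. norm (sin2 (\<alpha> i) (\<beta> i) (Complex (-R - 2) y)) / exp (pi * \<alpha> i * y)) /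
        (\<Prod>i\<in>L. norm (sin2 (\<alpha>' i) (\<beta>' i) (Complex (-R - 2) y)) / exp (pi * \<alpha>' i * y)) =
         norm (G (Complex (-R - 2) y)) * exp (pi * (sum \<alpha>' L - sum \<alpha> I) * y)"
      using eventually_gt_at_top[of 0]
    proof eventually_elim
      case (elim y)
      have "exp (pi * (sum \<alpha>' L - sum \<alpha> I) * y) = exp (pi * y * sum \<alpha>' L) / exp (pi * y * sum \<alpha> I)"
        by (simp add: exp_diff[symmetric] algebra_simps)
      moreover have "norm (G (Complex (-R - 2) y)) = (\<Prod>i\<in>I. norm (sin2 (\<alpha> i) (\<beta> i) (Complex (-R - 2) y))) /
          (\<Prod>i\<in>L. norm (sin2 (\<alpha>' i) (\<beta>' i) (Complex (-R - 2) y)))"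
        using elim by (simp add: G norm_divide P_def Q_def prod_norm)
      ultimately show ?case
        using fin by (simp only: prod_dividef prod_exp_linear) simp
    qed
    ultimately show ?thesis by (simp add: tendsto_cong)
  qed
  then have ratio': "((\<lambda>y. norm (G w0) * exp (pi * (sum \<alpha>' L - sum \<alpha> I) * y)) \<longlongrightarrow> 1) at_top"
    using const[of "Complex (-R - 2) _"] by simp
  have Gw0: "norm (G w0) > 0" using G[of w0] P0[of w0] Q0[of w0] by (simp add: w0_def)
  have eqs: "sum \<alpha> I = sum \<alpha>' L"
  proof (rule ccontr)
    assume "sum \<alpha> I \<noteq> sum \<alpha>' L"
    with le have d: "pi * (sum \<alpha>' L - sum \<alpha> I) > 0" by simp
    have "filterlim (\<lambda>y. norm (G w0) * exp (pi * (sum \<alpha>' L - sum \<alpha> I) * y)) at_top at_top"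
    proof (rule filterlim_tendsto_pos_mult_at_top[OF tendsto_const Gw0])
      define D where "D = pi * (sum \<alpha>' L - sum \<alpha> I)"
      have "D > 0" using d by (simp add: D_def)
      then have "filterlim (\<lambda>y. exp (D * y)) at_top at_top" by real_asymp
      then show "filterlim (\<lambda>y. exp (pi * (sum \<alpha>' L - sum \<alpha> I) * y)) at_top at_top" by (simp add: D_def)
    qed
    then show False using ratio' not_tendsto_and_filterlim_at_infinity[OF _ ratio'] filterlim_at_top_imp_at_infinity by auto
  qed
  with ratio' have "((\<lambda>y::real. norm (G w0)) \<longlongrightarrow> 1) at_top" by simp
  then have "norm (G w0) = 1" by (simp add: tendsto_const_iff)
  then show ?thesis using const eqs by blast
qed

text \<open>If the numerator has the larger type, the previous lemma applies to
  \<open>inverse G\<close>. This is holomorphic because \<open>G\<close> has no zeros: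
  \<open>nz\<close> covers the real axis, and elsewhere \<open>eq\<close> has a nonzero right-hand
  side. The equal sums so obtained contradict the case.\<close>

lemma sin2_quotient_constant:
  fixes \<alpha> \<beta> \<alpha>' \<beta>' :: "nat \<Rightarrow> real" and G :: "complex \<Rightarrow> complex"
  assumes fin: "finite I" "finite L"
    and pos: "\<And>i. i \<in> I \<Longrightarrow> \<alpha> i > 0" "\<And>i. i \<in> L \<Longrightarrow> \<alpha>' i > 0"
    and hol: "G holomorphic_on {z. Re z < -R}"
    and eq: "\<And>z. Re z < -R \<Longrightarrow> G z * (\<Prod>i\<in>L. sin2 (\<alpha>' i) (\<beta>' i) z) = (\<Prod>i\<in>I. sin2 (\<alpha> i) (\<beta> i) z)"
    and nz: "\<And>x. x < -R \<Longrightarrow> G (of_real x) \<noteq> 0"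
  shows "\<exists>c. norm c = 1 \<and> (\<forall>z. Re z < -R \<longrightarrow> G z = c) \<and> sum \<alpha> I = sum \<alpha>' L"
proof (cases "sum \<alpha> I \<le> sum \<alpha>' L")
  case True
  then show ?thesis using sin2_quotient_constant_aux[OF fin pos _ hol eq] by blast
next
  case False
  have nz': "G z \<noteq> 0" if "Re z < -R" for z
  proof (cases "Im z = 0")
    case True
    then have "z = of_real (Re z)" by (simp add: complex_eq_iff)
    then show ?thesis using nz[of "Re z"] that by metis
  next
    case False
    then show ?thesis using eq[OF that] fin pos by (auto simp: sin2_nonzero)
  qed
  have "\<exists>c. norm c = 1 \<and> (\<forall>z. Re z < -R \<longrightarrow> inverse (G z) = c) \<and> sum \<alpha>' L = sum \<alpha> I"
  proof (rule sin2_quotient_constant_aux[where \<alpha> = \<alpha>' and \<beta> = \<beta>' and \<alpha>' = \<alpha> and \<beta>' = \<beta>, OF fin(2,1) pos(2,1)])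
    show "(\<lambda>z. inverse (G z)) holomorphic_on {z. Re z < -R}"
      using nz' by (intro holomorphic_intros hol) auto
    show "inverse (G z) * (\<Prod>i\<in>I. sin2 (\<alpha> i) (\<beta> i) z) = (\<Prod>i\<in>L. sin2 (\<alpha>' i) (\<beta>' i) z)" if "Re z < -R" for z
      using eq[OF that, symmetric] nz'[OF that] by simp
  qed (use False in auto)
  then show ?thesis using nz' by (metis False inverse_inverse_eq norm_inverse inverse_1 order_refl)
qed

section \<open>Stirling asymptotics for large real part\<close>

text \<open>Stirling's main term without its constant; the factor \<open>sqrt (2 * pi)\<close> is
  determined separately by the duplication formula.\<close>

definition stirling_fun :: "complex \<Rightarrow> complex" where
  "stirling_fun z = exp ((z - 1 / 2) * ln z - z)"

text \<open>For \<open>Re z > 0\<close>, a logarithm of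
  \<open>stirling_fun (z + 1) / (z * stirling_fun z)\<close>, the defect of the main term in the
  functional equation of \<open>Gamma\<close>.\<close>

definition stirling_incr :: "complex \<Rightarrow> complex" where
  "stirling_incr z = (z + 1 / 2) * ln (1 + 1 / z) - 1"

lemma has_field_derivative_ln_1_plus:
  fixes u :: complex
  assumes "1 + u \<notin> \<real>\<^sub>\<le>\<^sub>0"
  shows "((\<lambda>u. ln (1 + u)) has_field_derivative inverse (1 + u)) (at u within S)"
proof -
  have eq: "(\<lambda>u::complex. ln (1 + u)) = (\<lambda>u. ln (u + 1))"
    by (intro ext arg_cong[of _ _ ln] add.commute)
  have "u + 1 \<notin> \<real>\<^sub>\<le>\<^sub>0" using assms by (subst add.commute)
  from DERIV_shift[THEN iffD1, OF has_field_derivative_Ln[OF this]]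
  have "((\<lambda>u. ln (u + 1)) has_field_derivative inverse (1 + u)) (at u)"
    by (subst (2) add.commute)
  then show ?thesis unfolding eq by (rule has_field_derivative_at_within)
qed

text \<open>Mean value inequality on the disc of radius \<open>norm x\<close>: the derivative of the
  remainder is u^2 / (1 + u), and \<open>norm (1 + u) >= 1 / 2\<close> there.\<close>

lemma norm_ln_1_plus_approx:
  fixes x :: complex
  assumes "norm x \<le> 1 / 2"
  shows "norm (ln (1 + x) - x + x\<^sup>2 / 2) \<le> 2 * norm x ^ 3"
proof -
  have re: "Re (1 + u) > 0" if "u \<in> cball 0 (norm x)" for u :: complex
  proof -
    have "norm u \<le> 1 / 2" using that assms by simp
    then have "\<bar>Re u\<bar> \<le> 1 / 2" using abs_Re_le_cmod[of u] by linarith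
    then have "1 + Re u > 0" by linarith
    then show ?thesis by simp
  qed
  have "norm ((ln (1 + x) - x + x\<^sup>2 / 2) - (ln (1 + 0) - 0 + 0\<^sup>2 / 2)) \<le> 2 * (norm x)\<^sup>2 * norm (x - 0)"
  proof (rule field_differentiable_bound[of "cball 0 (norm x)" _ "\<lambda>u. 1 / (1 + u) - 1 + u"])
    fix u :: complex assume u: "u \<in> cball 0 (norm x)"
    have nr: "1 + u \<notin> \<real>\<^sub>\<le>\<^sub>0" using re[OF u] by (auto simp: complex_nonpos_Reals_iff)
    then have "1 + u \<noteq> 0" by auto
    show "((\<lambda>u. ln (1 + u) - u + u\<^sup>2 / 2) has_field_derivative 1 / (1 + u) - 1 + u) (at u within cball 0 (norm x))"
    proof -
      have 2: "((\<lambda>u. u\<^sup>2 / 2) has_field_derivative u) (at u within cball 0 (norm x))"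
        by (auto intro!: derivative_eq_intros)
      show ?thesis using DERIV_add[OF DERIV_diff[OF has_field_derivative_ln_1_plus[OF nr] DERIV_ident] 2] by (simp add: inverse_eq_divide)
    qed
    have "1 / (1 + u) - 1 + u = u\<^sup>2 / (1 + u)"
    proof -
      have "1 / w - 1 + (w - 1) = (w - 1)\<^sup>2 / w" if "w \<noteq> 0" for w :: complex
        using that by (simp add: field_simps power2_eq_square)
      from this[of "1 + u"] show ?thesis using \<open>1 + u \<noteq> 0\<close> by simp
    qed
    moreover have "norm (1 + u) \<ge> 1 / 2"
      using norm_triangle_ineq2[of 1 "- u"] u assms by simp
    moreover have "(norm u)\<^sup>2 \<le> (norm x)\<^sup>2" using u by (intro power_mono) auto
    ultimately have "norm (1 / (1 + u) - 1 + u) \<le> (norm x)\<^sup>2 / (1 / 2)"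
      by (simp only: norm_divide norm_power) (intro frac_le; simp)
    then show "norm (1 / (1 + u) - 1 + u) \<le> 2 * (norm x)\<^sup>2" by simp
  qed auto
  then show ?thesis by (simp add: power3_eq_cube power2_eq_square mult.assoc)
qed

text \<open>The shift by 1/2 removes the term of order 1/z: with x = 1/z, (z + 1/2) (x - x^2/2) - 1
  = -x^2/4. Hence the increments are summable along \<open>z + k\<close>.\<close>

lemma norm_stirling_incr:
  assumes "norm z \<ge> 2"
  shows "norm (stirling_incr z) \<le> 4 / (norm z)\<^sup>2"
proof -
  define x where "x = 1 / z"
  define r where "r = ln (1 + x) - x + x\<^sup>2 / 2"
  have z0: "z \<noteq> 0" using assms by auto
  have nx: "norm x = 1 / norm z" by (simp add: x_def norm_divide)
  have nx2: "norm x \<le> 1 / 2" using assms z0 unfolding nx by (intro divide_left_mono) auto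
  have r: "norm r \<le> 2 * norm x ^ 3" unfolding r_def by (rule norm_ln_1_plus_approx[OF nx2])
  have "stirling_incr z = (z + 1 / 2) * (x - x\<^sup>2 / 2 + r) - 1" by (simp add: stirling_incr_def r_def x_def)
  also have "\<dots> = - x\<^sup>2 / 4 + (z + 1 / 2) * r"
    using z0 by (simp add: x_def field_simps power2_eq_square)
  also have "norm \<dots> \<le> norm x ^ 2 / 4 + (norm z + 1 / 2) * (2 * norm x ^ 3)"
    by (rule order_trans[OF norm_triangle_ineq])
       (auto simp: norm_mult norm_power norm_divide intro!: add_mono mult_mono r order_trans[OF norm_triangle_ineq])
  also have "\<dots> = (norm x)\<^sup>2 * (1 / 4 + 2 * (norm z * norm x) + norm x)"
    by (simp add: power2_eq_square power3_eq_cube algebra_simps)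
  also have "\<dots> \<le> (norm x)\<^sup>2 * 4" proof (rule mult_left_mono)
    have "norm z * norm x = 1" using z0 by (simp add: nx)
    then show "1 / 4 + 2 * (norm z * norm x) + norm x \<le> 4" using nx2 by simp
  qed simp
  finally show ?thesis by (simp add: nx power_divide)
qed

text \<open>Both arguments lie strictly between -pi/2 and pi/2, so their sum stays on the principal
  branch.\<close>

lemma ln_add_right_half:
  fixes z b :: complex
  assumes "Re z > 0" "Re (1 + b / z) > 0"
  shows "ln (z + b) = ln z + ln (1 + b / z)"
proof -
  have nz: "z \<noteq> 0" "1 + b / z \<noteq> 0" using assms by (metis less_irrefl zero_complex.sel(1))+
  have "\<bar>Im (ln z)\<bar> < pi / 2" "\<bar>Im (ln (1 + b / z))\<bar> < pi / 2"
    using Re_Ln_pos_lt[OF nz(1)] Re_Ln_pos_lt[OF nz(2)] assms by blast+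
  then have "- pi < Im (ln z) + Im (ln (1 + b / z))" "Im (ln z) + Im (ln (1 + b / z)) \<le> pi" by linarith+
  then have "ln (z * (1 + b / z)) = ln z + ln (1 + b / z)" using nz by (intro Ln_times_simple)
  moreover have "z * (1 + b / z) = z + b" using nz by (simp add: distrib_left)
  ultimately show ?thesis by simp
qed

lemma stirling_fun_plus1:
  assumes "Re z > 0"
  shows "stirling_fun (z + 1) = stirling_fun z * z * exp (stirling_incr z)"
proof -
  have z: "z \<noteq> 0" using assms by auto
  have "Re (1 / z) > 0" using assms z by (simp add: Re_divide power2_eq_square[symmetric] cmod_power2[symmetric])
  then have ln: "ln (z + 1) = ln z + ln (1 + 1 / z)" using assms by (intro ln_add_right_half) auto
  have "stirling_fun z * z * exp (stirling_incr z) = exp ((z - 1 / 2) * ln z - z) * exp (ln z) * exp (stirling_incr z)"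
    using z by (simp add: stirling_fun_def)
  also have "\<dots> = exp ((z - 1 / 2) * ln z - z + ln z + stirling_incr z)" by (simp add: exp_add)
  also have "(z - 1 / 2) * ln z - z + ln z + stirling_incr z = (z + 1 - 1 / 2) * ln (z + 1) - (z + 1)"
    unfolding ln stirling_incr_def by (simp add: algebra_simps)
  finally show ?thesis by (simp add: stirling_fun_def)
qed

lemma stirling_fun_nz [simp]: "stirling_fun z \<noteq> 0" by (simp add: stirling_fun_def)

lemma Re_pos_not_nonpos_Int: "Re z > 0 \<Longrightarrow> z \<notin> \<int>\<^sub>\<le>\<^sub>0"
  by (auto elim!: nonpos_Ints_cases')

lemma Gamma_stirling_shift:
  assumes "Re z > 0"
  shows "Gamma z / stirling_fun z =
    Gamma (z + of_nat n) / stirling_fun (z + of_nat n) * exp (\<Sum>k<n. stirling_incr (z + of_nat k))"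
proof (induction n)
  case (Suc n)
  have re: "Re (z + of_nat n) > 0" using assms by simp
  then have "z + of_nat n \<notin> \<int>\<^sub>\<le>\<^sub>0" by (rule Re_pos_not_nonpos_Int)
  then have "Gamma (z + of_nat n + 1) = (z + of_nat n) * Gamma (z + of_nat n)" by (rule Gamma_plus1)
  moreover have "z + of_nat n \<noteq> 0" using re by (metis less_irrefl zero_complex.sel(1))
  ultimately have "Gamma (z + of_nat n) / stirling_fun (z + of_nat n) =
      Gamma (z + of_nat n + 1) / stirling_fun (z + of_nat n + 1) * exp (stirling_incr (z + of_nat n))"
    using stirling_fun_plus1[OF re] by simp
  then show ?case unfolding Suc.IH by (simp add: add_ac exp_add)
qed auto

text \<open>The bound 4 / \<open>norm (z + k)\<close>^2 is replaced by the telescoping 4 / ((x - 1)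
  x) with x = \<open>Re z + k\<close>. It depends on \<open>Re z\<close> alone, which is the source
  of uniformity in \<open>Im z\<close>.\<close>

lemma stirling_incr_sum:
  assumes "Re z \<ge> 2"
  shows "summable (\<lambda>k. stirling_incr (z + of_nat k))"
    and "norm (\<Sum>k. stirling_incr (z + of_nat k)) \<le> 4 / (Re z - 1)"
proof -
  define g where "g = (\<lambda>k. 4 / (Re z - 1 + real k))"
  have "(\<lambda>k. g k - g (Suc k)) sums (g 0 - 0)"
    unfolding g_def by (rule telescope_sums') real_asymp
  then have gs: "(\<lambda>k. g k - g (Suc k)) sums (4 / (Re z - 1))" by (simp add: g_def)
  have le: "norm (stirling_incr (z + of_nat k)) \<le> g k - g (Suc k)" for k
  proof -
    define x where "x = Re z + real k"
    have x: "x \<ge> 2" using assms by (simp add: x_def)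
    have xn: "x \<le> norm (z + of_nat k)" using complex_Re_le_cmod[of "z + of_nat k"] by (simp add: x_def)
    have "norm (stirling_incr (z + of_nat k)) \<le> 4 / (norm (z + of_nat k))\<^sup>2"
      using xn x by (intro norm_stirling_incr) simp
    also have "\<dots> \<le> 4 / x\<^sup>2" using x xn by (intro divide_left_mono power_mono mult_pos_pos zero_less_power) auto
    also have "\<dots> \<le> 4 / ((x - 1) * x)" using x
      by (intro divide_left_mono mult_pos_pos) (auto simp: power2_eq_square)
    also have "\<dots> = 4 / (x - 1) - 4 / x" using x by (simp add: field_simps)
    finally show ?thesis by (simp add: g_def x_def algebra_simps)
  qed
  show "summable (\<lambda>k. stirling_incr (z + of_nat k))"
    by (rule summable_comparison_test'[OF sums_summable[OF gs]]) (rule le)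
  show "norm (\<Sum>k. stirling_incr (z + of_nat k)) \<le> 4 / (Re z - 1)"
  proof -
    have "norm (\<Sum>k. stirling_incr (z + of_nat k)) \<le> (\<Sum>k. g k - g (Suc k))"
      by (rule norm_suminf_le[OF le sums_summable[OF gs]])
    then show ?thesis using gs by (simp add: sums_iff)
  qed
qed

text \<open>The value at 0 is filled in so that the limit holds along \<open>nhds 0\<close>: it is
  composed with \<open>b / v x\<close>, which is identically 0 when \<open>b = 0\<close>.\<close>

lemma ln_1_plus_quotient_tendsto:
  "((\<lambda>x::complex. if x = 0 then 1 else ln (1 + x) / x) \<longlongrightarrow> 1) (nhds 0)"
proof -
  have "((\<lambda>x::complex. ln (1 + x)) has_field_derivative 1) (at 0)"
    using has_field_derivative_ln_1_plus[of 0 UNIV] by simp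
  then have "((\<lambda>x::complex. ln (1 + x) / x) \<longlongrightarrow> 1) (at 0)" by (simp add: has_field_derivative_iff)
  then have "((\<lambda>x::complex. if x = 0 then 1 else ln (1 + x) / x) \<longlongrightarrow> 1) (at 0)"
    by (rule Lim_transform_eventually) (auto simp: eventually_at_filter)
  then show ?thesis by (auto simp: tendsto_nhds_iff)
qed

text \<open>The quotient is the exponential of (v + b - 1/2) ln (1 + b/v) - b, which tends to 0. The
  filter is left general to serve both for integers and for \<open>Re z\<close> tending to
  infinity.\<close>

lemma stirling_fun_shift_asymp:
  fixes v :: "'a \<Rightarrow> complex" and b :: complex
  assumes v: "filterlim v at_infinity F" and re: "eventually (\<lambda>x. Re (v x) > 0) F"
  shows "((\<lambda>x. stirling_fun (v x + b) / exp ((v x + b - 1 / 2) * ln (v x) - v x)) \<longlongrightarrow> 1) F"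
proof -
  define k where "k = (\<lambda>x::complex. if x = 0 then 1 else ln (1 + x) / x)"
  have bv: "((\<lambda>x. b / v x) \<longlongrightarrow> 0) F" by (rule tendsto_divide_0[OF tendsto_const v])
  have "((\<lambda>x. k (b / v x)) \<longlongrightarrow> 1) F"
    unfolding k_def by (rule filterlim_compose[OF ln_1_plus_quotient_tendsto bv])
  then have "((\<lambda>x. exp (b * (1 + (b - 1 / 2) / v x) * k (b / v x) - b)) \<longlongrightarrow> exp (b * (1 + 0) * 1 - b)) F"
    by (intro tendsto_intros tendsto_divide_0[OF tendsto_const v])
  then have lim: "((\<lambda>x. exp (b * (1 + (b - 1 / 2) / v x) * k (b / v x) - b)) \<longlongrightarrow> 1) F" by simp
  have "((\<lambda>x. Re (1 + b / v x)) \<longlongrightarrow> Re (1 + 0)) F" by (intro tendsto_intros bv)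
  then have "eventually (\<lambda>x. Re (1 + b / v x) > 0) F"
    by (rule order_tendstoD) simp
  then have "\<forall>\<^sub>F x in F. exp (b * (1 + (b - 1 / 2) / v x) * k (b / v x) - b) =
      stirling_fun (v x + b) / exp ((v x + b - 1 / 2) * ln (v x) - v x)"
    using re
  proof eventually_elim
    case (elim x)
    have nz: "v x \<noteq> 0" using elim by auto
    have ln: "ln (v x + b) = ln (v x) + ln (1 + b / v x)" using elim by (intro ln_add_right_half) auto
    define L where "L = ln (1 + b / v x)"
    have "L = b / v x * k (b / v x)" using nz by (simp add: k_def L_def)
    then have "(v x + b - 1 / 2) * L = ((v x + b - 1 / 2) * (b / v x)) * k (b / v x)" by simp
    also have "(v x + b - 1 / 2) * (b / v x) = b * (1 + (b - 1 / 2) / v x)" using nz by (simp add: field_simps)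
    finally have h: "b * (1 + (b - 1 / 2) / v x) * k (b / v x) = (v x + b - 1 / 2) * L" by simp
    have "((v x + b - 1 / 2) * (ln (v x) + L) - (v x + b)) - ((v x + b - 1 / 2) * ln (v x) - v x) =
        (v x + b - 1 / 2) * L - b" by (simp add: algebra_simps)
    then show ?case unfolding stirling_fun_def ln h L_def[symmetric] exp_diff[symmetric] by (simp only:)
  qed
  then show ?thesis by (rule Lim_transform_eventually[OF lim])
qed

text \<open>By Gauss's limit formula, \<open>Gamma (z + n)\<close> behaves like n! n^(z-1), and the
  shift lemma treats \<open>stirling_fun (z + n)\<close> likewise. So the quotient is asymptotic to
  a sequence \<open>s\<close> free of \<open>z\<close>, and the convergence of \<open>s\<close> to a
  nonzero limit need only be checked at one point.\<close>

lemma Gamma_div_stirling_fun_tendsto_aux: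
  obtains c :: complex where "c \<noteq> 0" and
    "\<And>z. Re z > 0 \<Longrightarrow> (\<lambda>n. Gamma (z + of_nat n) / stirling_fun (z + of_nat n)) \<longlonglongrightarrow> c"
proof -
  define s where "s = (\<lambda>n. fact n / exp ((of_nat n + 1 / 2) * ln (of_nat n) - of_nat n) :: complex)"
  have step: "(\<lambda>n. Gamma (z + of_nat n) / stirling_fun (z + of_nat n) / s n) \<longlonglongrightarrow> 1" if "Re z > 0" for z
  proof -
    have zn: "z \<notin> \<int>\<^sub>\<le>\<^sub>0" using that by (rule Re_pos_not_nonpos_Int)
    have G0: "Gamma z \<noteq> 0" using zn by (simp add: Gamma_eq_zero_iff)
    have 1: "(\<lambda>n. stirling_fun (of_nat n + z) / exp ((of_nat n + z - 1 / 2) * ln (of_nat n) - of_nat n)) \<longlonglongrightarrow> 1"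
    proof (rule stirling_fun_shift_asymp)
      show "filterlim (of_nat :: nat \<Rightarrow> complex) at_infinity sequentially" by (rule tendsto_of_nat)
      show "\<forall>\<^sub>F n in sequentially. Re (of_nat n) > 0" using eventually_gt_at_top[of 0] by eventually_elim simp
    qed
    have 2: "(\<lambda>n. Gamma_series z n / Gamma z) \<longlonglongrightarrow> Gamma z / Gamma z"
      by (intro tendsto_divide Gamma_series_LIMSEQ tendsto_const G0)
    have 3: "(\<lambda>n. (z + of_nat n) / of_nat n) \<longlonglongrightarrow> 1"
    proof -
      have "(\<lambda>n. z / of_nat n + 1) \<longlonglongrightarrow> 0 + 1"
        by (intro tendsto_add tendsto_const tendsto_divide_0[OF tendsto_const tendsto_of_nat])
      then have "(\<lambda>n. z / of_nat n + 1) \<longlonglongrightarrow> 1" by simp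
      moreover have "\<forall>\<^sub>F n in sequentially. z / of_nat n + 1 = (z + of_nat n) / of_nat n"
        using eventually_gt_at_top[of 0] by eventually_elim (simp add: add_divide_distrib)
      ultimately show ?thesis by (rule Lim_transform_eventually)
    qed
    have "(\<lambda>n. 1 / ((stirling_fun (of_nat n + z) / exp ((of_nat n + z - 1 / 2) * ln (of_nat n) - of_nat n)) *
        (Gamma_series z n / Gamma z) * ((z + of_nat n) / of_nat n))) \<longlonglongrightarrow> 1 / (1 * (Gamma z / Gamma z) * 1)"
      using G0 by (intro tendsto_intros 1 2 3) auto
    then have lim: "(\<lambda>n. 1 / ((stirling_fun (of_nat n + z) / exp ((of_nat n + z - 1 / 2) * ln (of_nat n) - of_nat n)) *
        (Gamma_series z n / Gamma z) * ((z + of_nat n) / of_nat n))) \<longlonglongrightarrow> 1" using G0 by simp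
    have "\<forall>\<^sub>F n in sequentially. 1 / ((stirling_fun (of_nat n + z) / exp ((of_nat n + z - 1 / 2) * ln (of_nat n) - of_nat n)) *
        (Gamma_series z n / Gamma z) * ((z + of_nat n) / of_nat n)) =
        Gamma (z + of_nat n) / stirling_fun (z + of_nat n) / s n"
      using eventually_gt_at_top[of 0]
    proof eventually_elim
      case (elim n)
      define l where "l = ln (of_nat n :: complex)"
      have el: "exp l = of_nat n" unfolding l_def using elim by (intro exp_Ln) simp
      have zn0: "z + of_nat n \<noteq> 0" using that by (auto simp: complex_eq_iff)
      have p0: "pochhammer z n \<noteq> 0" using zn pochhammer_eq_0_imp_nonpos_Int by blast
      have gs: "Gamma_series z n = fact n * exp (z * l) / (pochhammer z n * (z + of_nat n))"
        using elim by (simp add: Gamma_series_def pochhammer_Suc l_def Ln_of_nat)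
      have G: "Gamma (z + of_nat n) = Gamma z * pochhammer z n"
        using pochhammer_Gamma[OF zn, of n] G0 by (simp add: field_simps)
      have e: "exp ((of_nat n + z - 1 / 2) * l - of_nat n) * of_nat n =
          exp (z * l) * exp ((of_nat n + 1 / 2) * l - of_nat n)"
        unfolding el[symmetric] exp_add[symmetric] unfolding el by (simp add: algebra_simps)
      have n0: "(of_nat n :: complex) \<noteq> 0" using elim by simp
      have "1 / ((stirling_fun (of_nat n + z) / exp ((of_nat n + z - 1 / 2) * l - of_nat n)) *
        (Gamma_series z n / Gamma z) * ((z + of_nat n) / of_nat n)) =
         (exp ((of_nat n + z - 1 / 2) * l - of_nat n) * of_nat n) * Gamma z * pochhammer z n /
           (stirling_fun (z + of_nat n) * fact n * exp (z * l))"
      proof -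
        have "1 / ((S / X) * ((f * Y / (p * w)) / G) * (w / m)) = (X * m) * G * p / (S * f * Y)"
          if "w \<noteq> 0" for S X f Y p w G m :: complex
          using that by (simp add: field_simps)
        then show ?thesis unfolding gs add.commute[of "of_nat n" z] using zn0 by blast
      qed
      also have "\<dots> = Gamma (z + of_nat n) / stirling_fun (z + of_nat n) / s n"
        unfolding e G s_def l_def[symmetric] by (simp add: field_simps)
      finally show ?case by (simp add: l_def)
    qed
    then show ?thesis by (rule Lim_transform_eventually[OF lim])
  qed
  have s0: "s n \<noteq> 0" for n by (simp add: s_def)
  \<comment> \<open>The test point is 2 because \<open>stirling_incr_sum\<close> requires
    \<open>Re z >= 2\<close>; the convergent sum of increments yields a nonzero limit.\<close>
  define d where "d = Gamma 2 / stirling_fun 2 / exp (\<Sum>k. stirling_incr (2 + of_nat k))"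
  have "Gamma (2 :: complex) = 1" using Gamma_fact[of 1, where 'a = complex] by simp
  then have d0: "d \<noteq> 0" by (simp add: d_def)
  have "(\<lambda>n. Gamma 2 / stirling_fun 2 / exp (\<Sum>k<n. stirling_incr (2 + of_nat k))) \<longlonglongrightarrow> d"
    unfolding d_def by (intro tendsto_intros summable_LIMSEQ stirling_incr_sum) auto
  then have dl: "(\<lambda>n. Gamma (2 + of_nat n) / stirling_fun (2 + of_nat n)) \<longlonglongrightarrow> d"
  proof -
    have "Gamma (2 + of_nat n) / stirling_fun (2 + of_nat n) =
        Gamma 2 / stirling_fun 2 / exp (\<Sum>k<n. stirling_incr (2 + of_nat k))" for n
    proof -
      have "Gamma 2 / stirling_fun 2 =
        Gamma (2 + of_nat n) / stirling_fun (2 + of_nat n) * exp (\<Sum>k<n. stirling_incr (2 + of_nat k))"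
        by (rule Gamma_stirling_shift) simp
      then show ?thesis by (metis exp_not_eq_zero nonzero_mult_div_cancel_right)
    qed
    then show ?thesis using \<open>_ \<longlonglongrightarrow> d\<close> by (simp only:)
  qed
  have "(\<lambda>n. Gamma (2 + of_nat n) / stirling_fun (2 + of_nat n) / (Gamma (2 + of_nat n) / stirling_fun (2 + of_nat n) / s n)) \<longlonglongrightarrow> d / 1"
    by (intro tendsto_divide dl step) auto
  moreover have "Gamma (2 + of_nat n) / stirling_fun (2 + of_nat n) / (Gamma (2 + of_nat n) / stirling_fun (2 + of_nat n) / s n) = s n" for n
  proof -
    have "(2 + of_nat n :: complex) \<notin> \<int>\<^sub>\<le>\<^sub>0" by (rule Re_pos_not_nonpos_Int) simp
    then show ?thesis using s0[of n] by (simp add: Gamma_eq_zero_iff)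
  qed
  ultimately have sl: "s \<longlonglongrightarrow> d" by simp
  show thesis
  proof (rule that[OF d0])
    fix z :: complex assume "Re z > 0"
    from tendsto_mult[OF step[OF this] sl] s0
    show "(\<lambda>n. Gamma (z + of_nat n) / stirling_fun (z + of_nat n)) \<longlonglongrightarrow> d" by simp
  qed
qed

text \<open>The right half-planes form a basis of this filter, so a limit along it is automatically
  uniform in \<open>Im z\<close>.\<close>

abbreviation re_at_top :: "complex filter" where "re_at_top \<equiv> filtercomap Re at_top"

lemma filterlim_re_at_top_at_infinity: "filterlim (\<lambda>z. z) at_infinity re_at_top"
proof -
  have "filterlim Re at_top re_at_top" by (rule filterlim_filtercomap)
  then have "filterlim norm at_top re_at_top"
    by (rule filterlim_at_top_mono) (auto simp: complex_Re_le_cmod)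
  then show ?thesis by (simp add: filterlim_at_infinity_conv_norm_at_top)
qed

lemma eventually_re_at_top: "eventually (\<lambda>z. Re z > x) re_at_top"
  by (rule filterlim_at_top_dense[THEN iffD1, OF filterlim_filtercomap, rule_format])

text \<open>Pointwise limits along \<open>z + n\<close> become a limit along
  \<open>re_at_top\<close> because the remaining sum of increments is at most
  \<open>4 / (Re z - 1)\<close>. Writing \<open>ln a + ln z\<close> separately lets the exponents of
  different factors be added later.\<close>

lemma Gamma_affine_asymp_aux:
  obtains c :: complex where "c \<noteq> 0" and
    "\<And>a b :: real. a > 0 \<Longrightarrow> ((\<lambda>z. Gamma (of_real a * z + of_real b) /
      exp ((of_real a * z + of_real b - 1 / 2) * (of_real (ln a) + ln z) - of_real a * z)) \<longlongrightarrow> c) re_at_top"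
proof (rule Gamma_div_stirling_fun_tendsto_aux)
  fix c :: complex
  assume c0: "c \<noteq> 0" and
    c: "\<And>z. Re z > 0 \<Longrightarrow> (\<lambda>n. Gamma (z + of_nat n) / stirling_fun (z + of_nat n)) \<longlonglongrightarrow> c"
  let ?J = "\<lambda>z. \<Sum>k. stirling_incr (z + of_nat k)"
  have J: "(?J \<longlongrightarrow> 0) re_at_top"
  proof (rule Lim_null_comparison)
    show "\<forall>\<^sub>F z in re_at_top. norm (?J z) \<le> 4 / (Re z - 1)"
      using eventually_re_at_top[of 2] by eventually_elim (rule stirling_incr_sum(2), simp)
    have "((\<lambda>x::real. 4 / (x - 1)) \<longlongrightarrow> 0) at_top" by real_asymp
    then show "((\<lambda>z. 4 / (Re z - 1)) \<longlongrightarrow> 0) re_at_top"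
      by (rule filterlim_compose[OF _ filterlim_filtercomap])
  qed
  have "((\<lambda>z. c * exp (?J z)) \<longlongrightarrow> c * exp 0) re_at_top" by (intro tendsto_intros J)
  moreover have "\<forall>\<^sub>F z in re_at_top. c * exp (?J z) = Gamma z / stirling_fun z"
    using eventually_re_at_top[of 2]
  proof eventually_elim
    case (elim z)
    have "(\<lambda>n. Gamma (z + of_nat n) / stirling_fun (z + of_nat n) * exp (\<Sum>k<n. stirling_incr (z + of_nat k))) \<longlonglongrightarrow> c * exp (?J z)"
      using elim by (intro tendsto_intros c summable_LIMSEQ stirling_incr_sum) auto
    then have "(\<lambda>n. Gamma z / stirling_fun z) \<longlonglongrightarrow> c * exp (?J z)"
      using Gamma_stirling_shift[of z] elim by simp
    then show ?case by (simp add: LIMSEQ_const_iff)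
  qed
  ultimately have G: "((\<lambda>z. Gamma z / stirling_fun z) \<longlongrightarrow> c) re_at_top"
    using Lim_transform_eventually by fastforce
  show thesis
  proof (rule that[OF c0])
    fix a b :: real assume a: "a > 0"
    have lin: "filterlim (\<lambda>z. of_real a * z + of_real b) re_at_top re_at_top"
    proof (subst filterlim_filtercomap_iff)
      have "filterlim (\<lambda>x. a * x + b) at_top at_top" using a by real_asymp
      then have "filterlim (\<lambda>z. a * Re z + b) at_top re_at_top"
        by (rule filterlim_compose[OF _ filterlim_filtercomap])
      then show "filterlim (Re \<circ> (\<lambda>z. of_real a * z + of_real b)) at_top re_at_top" by (simp add: o_def)
    qed
    have 1: "((\<lambda>z. Gamma (of_real a * z + of_real b) / stirling_fun (of_real a * z + of_real b)) \<longlongrightarrow> c) re_at_top"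
      by (rule filterlim_compose[OF G lin])
    have 2: "((\<lambda>z. stirling_fun (of_real a * z + of_real b) /
        exp ((of_real a * z + of_real b - 1 / 2) * ln (of_real a * z) - of_real a * z)) \<longlongrightarrow> 1) re_at_top"
    proof (rule stirling_fun_shift_asymp)
      show "filterlim (\<lambda>z. complex_of_real a * z) at_infinity re_at_top"
        using a by (intro tendsto_mult_filterlim_at_infinity[OF tendsto_const] filterlim_re_at_top_at_infinity) auto
      show "\<forall>\<^sub>F z in re_at_top. Re (of_real a * z) > 0"
        using eventually_re_at_top[of 0] by eventually_elim (use a in simp)
    qed
    have "((\<lambda>z. Gamma (of_real a * z + of_real b) / stirling_fun (of_real a * z + of_real b) * (stirling_fun (of_real a * z + of_real b) /
        exp ((of_real a * z + of_real b - 1 / 2) * ln (of_real a * z) - of_real a * z))) \<longlongrightarrow> c * 1) re_at_top"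
      by (rule tendsto_mult[OF 1 2])
    moreover have "\<forall>\<^sub>F z in re_at_top. Gamma (of_real a * z + of_real b) / stirling_fun (of_real a * z + of_real b) * (stirling_fun (of_real a * z + of_real b) /
        exp ((of_real a * z + of_real b - 1 / 2) * ln (of_real a * z) - of_real a * z)) =
        Gamma (of_real a * z + of_real b) / exp ((of_real a * z + of_real b - 1 / 2) * (of_real (ln a) + ln z) - of_real a * z)"
      using eventually_re_at_top[of 0]
    proof eventually_elim
      case (elim z)
      then have "z \<noteq> 0" by auto
      then have "ln (of_real a * z) = of_real (ln a) + ln z" using a by (simp add: Ln_times_of_real Ln_of_real)
      then show ?case by simp
    qed
    ultimately show "((\<lambda>z. Gamma (of_real a * z + of_real b) /
      exp ((of_real a * z + of_real b - 1 / 2) * (of_real (ln a) + ln z) - of_real a * z)) \<longlongrightarrow> c) re_at_top"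
      using Lim_transform_eventually by fastforce
  qed
qed

section \<open>The constant in Stirling's formula and decay on vertical lines\<close>

lemma sqrt_eq_exp:
  fixes x :: real
  assumes "x > 0"
  shows "sqrt x = exp (ln x / 2)"
proof -
  have "ln x / 2 = ln (sqrt x)" using ln_sqrt[of x] assms by linarith
  then show ?thesis using assms by (simp only: exp_ln real_sqrt_gt_zero)
qed

text \<open>Legendre's duplication formula: the combination \<open>A z * B z / E z\<close> equals
  \<open>sqrt (2 * pi)\<close> identically, while its limit is c c / c.\<close>

theorem Gamma_affine_asymp:
  fixes a b :: real
  assumes "a > 0"
  shows "((\<lambda>z. Gamma (of_real a * z + of_real b) /
      exp ((of_real a * z + of_real b - 1 / 2) * (of_real (ln a) + ln z) - of_real a * z)) \<longlongrightarrow> of_real (sqrt (2 * pi))) re_at_top"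
proof (rule Gamma_affine_asymp_aux)
  fix c :: complex
  assume c0: "c \<noteq> 0" and
    c: "\<And>a b :: real. a > 0 \<Longrightarrow> ((\<lambda>z. Gamma (of_real a * z + of_real b) /
      exp ((of_real a * z + of_real b - 1 / 2) * (of_real (ln a) + ln z) - of_real a * z)) \<longlongrightarrow> c) re_at_top"
  define A where "A = (\<lambda>z::complex. Gamma z / exp ((z - 1 / 2) * ln z - z))"
  define B where "B = (\<lambda>z::complex. Gamma (z + 1 / 2) / exp (z * ln z - z))"
  define E where "E = (\<lambda>z::complex. Gamma (2 * z) / exp ((2 * z - 1 / 2) * (of_real (ln 2) + ln z) - 2 * z))"
  have A: "(A \<longlongrightarrow> c) re_at_top" using c[of 1 0] by (simp add: A_def)
  have B: "(B \<longlongrightarrow> c) re_at_top" using c[of 1 "1 / 2"] by (simp add: B_def)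
  have E: "(E \<longlongrightarrow> c) re_at_top" using c[of 2 0] by (simp add: E_def)
  have lim: "((\<lambda>z. A z * B z / E z) \<longlongrightarrow> c * c / c) re_at_top" by (intro tendsto_intros A B E c0)
  have ev: "\<forall>\<^sub>F z in re_at_top. A z * B z / E z = of_real (sqrt (2 * pi))"
    using eventually_re_at_top[of 0]
  proof eventually_elim
    case (elim z)
    have n: "z \<notin> \<int>\<^sub>\<le>\<^sub>0" "z + 1 / 2 \<notin> \<int>\<^sub>\<le>\<^sub>0" "2 * z \<notin> \<int>\<^sub>\<le>\<^sub>0"
      using elim by (auto intro!: Re_pos_not_nonpos_Int)
    have leg: "Gamma z * Gamma (z + 1 / 2) = exp ((1 - 2 * z) * of_real (ln 2)) * of_real (sqrt pi) * Gamma (2 * z)"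
      by (rule Gamma_legendre_duplication[OF n(1,2)])
    have "A z * B z = Gamma z * Gamma (z + 1 / 2) / exp ((2 * z - 1 / 2) * ln z - 2 * z)"
      by (simp add: A_def B_def exp_add[symmetric] algebra_simps)
    also have "\<dots> = E z * of_real (sqrt pi) * exp (of_real (ln 2) / 2)"
    proof -
      have "exp ((1 - 2 * z) * L) / exp ((2 * z - 1 / 2) * l - 2 * z) =
          exp (L / 2) / exp ((2 * z - 1 / 2) * (L + l) - 2 * z)" for L l
        unfolding exp_diff[symmetric] by (rule arg_cong[of _ _ exp]) (simp add: field_simps)
      note eq = this[of "of_real (ln 2)" "ln z"]
      have "x * p * g / y = g / w * p * v" if "x / y = v / w" for x y p g v w :: complex
      proof -
        have "x * p * g / y = (x / y) * (p * g)" by simp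
        also have "\<dots> = v / w * (p * g)" by (simp only: that)
        finally show ?thesis by (simp add: mult_ac)
      qed
      from this[OF eq] show ?thesis unfolding leg E_def .
    qed
    also have "exp (of_real (ln 2) / 2) = complex_of_real (exp (ln 2 / 2))" by (simp flip: exp_of_real)
    also have "exp (ln 2 / 2) = sqrt 2" by (simp add: sqrt_eq_exp)
    finally show ?case using n(3) by (simp add: E_def Gamma_eq_zero_iff real_sqrt_mult)
  qed
  have "((\<lambda>z. complex_of_real (sqrt (2 * pi))) \<longlongrightarrow> c) re_at_top"
    using Lim_transform_eventually[OF lim ev] c0 by simp
  moreover have "re_at_top \<noteq> bot"
  proof (rule filtercomap_neq_bot)
    show "\<And>P. eventually P at_top \<Longrightarrow> \<exists>x. P (Re x)"
      by (metis Re_complex_of_real eventually_at_top_linorder order_refl)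
  qed
  ultimately have "c = of_real (sqrt (2 * pi))" by (simp add: tendsto_const_iff)
  then show ?thesis using c[OF assms] by simp
qed

text \<open>In Euler's product the quotient of \<open>Gamma x\<close> by the left-hand side is a
  product of factors \<open>f k >= 1\<close>. About 2x of them, each with square at least 1 + t^2 /
  (25 x^2), already give the claim by Bernoulli's inequality.\<close>

lemma norm_Gamma_decay:
  fixes x t :: real
  assumes x: "x \<ge> 1"
  shows "norm (Gamma (Complex x t)) \<le> Gamma x / (1 + t\<^sup>2 / (25 * x))"
proof -
  define w where "w = Complex x t"
  define q where "q = 1 + t\<^sup>2 / (25 * x)"
  have q: "q > 0" unfolding q_def using x by (intro add_pos_nonneg) auto
  \<comment> \<open>For \<open>k < 2 * m\<close> one has \<open>x + k <= 3 * x + 2 <= 5 * x\<close>,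
    whence 25. The even number \<open>2 * m\<close> of factors turns bounds on the squares into an
    \<open>m\<close>-th power, and \<open>m >= x\<close> lets Bernoulli reach t^2 / (25 x).\<close>
  define m where "m = nat \<lceil>x\<rceil>"
  have m: "x \<le> real m" "real m \<le> x + 1" using x by (auto simp: m_def)
  define f where "f = (\<lambda>k. norm (w + of_nat k) / (x + real k))"
  have f1: "f k \<ge> 1" for k
    using complex_Re_le_cmod[of "w + of_nat k"] x by (simp add: f_def w_def)
  have fq: "f k ^ 2 \<ge> 1 + t\<^sup>2 / (25 * x\<^sup>2)" if "k < 2 * m" for k
  proof -
    have "real k \<le> 2 * x + 2" using that m by linarith
    then have "x + real k \<le> 5 * x" using x by linarith
    then have "(x + real k)\<^sup>2 \<le> (5 * x)\<^sup>2" using x by (intro power_mono) auto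
    then have le: "t\<^sup>2 / (25 * x\<^sup>2) \<le> t\<^sup>2 / (x + real k)\<^sup>2"
      using x by (intro divide_left_mono) (auto simp: power_mult_distrib)
    have "f k ^ 2 = ((x + real k)\<^sup>2 + t\<^sup>2) / (x + real k)\<^sup>2"
      by (simp add: f_def w_def power_divide cmod_power2)
    also have "\<dots> = 1 + t\<^sup>2 / (x + real k)\<^sup>2" using x by (simp add: add_divide_distrib)
    finally show ?thesis using le by simp
  qed
  have prod: "q \<le> (\<Prod>k<n. f k)" if "n \<ge> 2 * m" for n
  proof -
    define v where "v = t\<^sup>2 / (25 * x\<^sup>2)"
    have v: "v \<ge> 0" using x by (simp add: v_def)
    have "((1 + v) ^ m)\<^sup>2 = (\<Prod>k<2 * m. 1 + v)" by (simp add: power_mult[symmetric] mult.commute)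
    also have "\<dots> \<le> (\<Prod>k<2 * m. f k ^ 2)" using fq v by (intro prod_mono) (auto simp: v_def)
    also have "\<dots> = (\<Prod>k<2 * m. f k)\<^sup>2" by (simp add: prod_power_distrib)
    finally have "(1 + v) ^ m \<le> (\<Prod>k<2 * m. f k)"
      by (rule power2_le_imp_le) (use f1 in \<open>auto intro!: prod_nonneg intro: order_trans[OF zero_le_one]\<close>)
    moreover have "1 + real m * v \<le> (1 + v) ^ m" using Bernoulli_inequality[of v m] v by simp
    moreover have "q \<le> 1 + real m * v"
    proof -
      have "t\<^sup>2 / (25 * x) = x * v" using x by (simp add: v_def power2_eq_square)
      also have "\<dots> \<le> real m * v" using m v by (intro mult_right_mono) auto
      finally show ?thesis by (simp add: q_def)
    qed
    moreover have "(\<Prod>k<2 * m. f k) \<le> (\<Prod>k<n. f k)"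
      using that f1 by (intro prod_mono2) (auto intro: order_trans[OF zero_le_one])
    ultimately show ?thesis by linarith
  qed
  have le: "norm (Gamma_series w n) \<le> Gamma_series x n / q" if n: "n \<ge> 2 * m" "n > 0" for n
  proof -
    have px: "pochhammer x (n + 1) > 0" using x by (intro pochhammer_pos) simp
    have "norm (pochhammer w (n + 1)) = pochhammer x (n + 1) * (\<Prod>k<n + 1. f k)"
    proof -
      have "norm (pochhammer w (n + 1)) = (\<Prod>k<n + 1. norm (w + of_nat k))"
        by (simp add: pochhammer_prod prod_norm atLeast0LessThan del: prod.lessThan_Suc)
      also have "\<dots> = (\<Prod>k<n + 1. (x + real k) * f k)"
        using x by (intro prod.cong) (auto simp: f_def)
      finally show ?thesis by (simp add: pochhammer_prod prod.distrib atLeast0LessThan del: prod.lessThan_Suc)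
    qed
    moreover have "q \<le> (\<Prod>k<n + 1. f k)" using n by (intro prod) auto
    ultimately have "norm (pochhammer w (n + 1)) \<ge> pochhammer x (n + 1) * q"
      using px by simp
    moreover have "norm (exp (w * of_real (ln (of_nat n)))) = exp (x * ln (real n))"
      by (simp add: w_def)
    ultimately show ?thesis
    proof -
      assume le: "norm (pochhammer w (n + 1)) \<ge> pochhammer x (n + 1) * q"
        and e: "norm (exp (w * of_real (ln (of_nat n)))) = exp (x * ln (real n))"
      have p0: "pochhammer x (n + 1) * q > 0" using px q by simp
      have "norm (Gamma_series w n) = fact n * exp (x * ln (real n)) / norm (pochhammer w (n + 1))"
        unfolding Gamma_series_def norm_divide norm_mult e by simp
      also have "\<dots> \<le> fact n * exp (x * ln (real n)) / (pochhammer x (n + 1) * q)"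
        by (intro divide_left_mono le mult_pos_pos[OF less_le_trans[OF p0 le] p0]) simp
      finally show ?thesis by (simp add: Gamma_series_def)
    qed
  qed
  have "norm (Gamma w) \<le> Gamma x / q"
  proof (rule tendsto_le[of sequentially])
    show "(\<lambda>n. Gamma_series x n / q) \<longlonglongrightarrow> Gamma x / q" using q by (intro tendsto_intros) auto
    show "(\<lambda>n. norm (Gamma_series w n)) \<longlonglongrightarrow> norm (Gamma w)" by (intro tendsto_intros)
    show "\<forall>\<^sub>F n in sequentially. norm (Gamma_series w n) \<le> Gamma_series x n / q"
      using eventually_ge_at_top[of "2 * m"] eventually_gt_at_top[of 0] by eventually_elim (rule le)
  qed simp
  then show ?thesis by (simp add: w_def q_def)
qed

section \<open>Gamma quotients without negative poles\<close>

text \<open>For \<open>a > 0\<close> the poles of \<open>Gamma (a s + b)\<close> accumulate at \<open>-\<infinity>\<close>. Euler's reflection formula moves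
  them into the factor \<open>1 / sin2\<close>; the remaining factor, as a function of \<open>z = -s\<close>, is the following.\<close>

definition refl_Gamma :: "real \<Rightarrow> real \<Rightarrow> complex \<Rightarrow> complex" where
  "refl_Gamma a b z = (if a < 0 then Gamma (of_real (- a) * z + of_real b)
     else of_real (2 * pi) / Gamma (of_real a * z + of_real (1 - b)))"

text \<open>To the right of this abscissa both |a| z + b and |a| z + 1 - b have positive real part,
  whichever case of \<open>refl_Gamma\<close> applies.\<close>

definition refl_bound :: "real \<Rightarrow> real \<Rightarrow> real" where
  "refl_bound a b = (\<bar>b\<bar> + 1) / \<bar>a\<bar>"

lemma refl_bound_pos:
  assumes "a \<noteq> 0" "x > refl_bound a b"
  shows "\<bar>a\<bar> * x > \<bar>b\<bar> + 1"
  using assms by (simp add: refl_bound_def field_simps)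

lemma refl_Gamma_arg_pos:
  assumes "a \<noteq> 0" "Re z > refl_bound a b"
  shows "a < 0 \<Longrightarrow> Re (of_real (- a) * z + of_real b) > 0"
    and "\<not> a < 0 \<Longrightarrow> Re (of_real a * z + of_real (1 - b)) > 0"
  using refl_bound_pos[OF assms] assms(1) by (auto simp: abs_if split: if_splits)

lemma refl_Gamma_nonzero:
  assumes "a \<noteq> 0" "Re z > refl_bound a b"
  shows "refl_Gamma a b z \<noteq> 0"
  using refl_Gamma_arg_pos[OF assms] Re_pos_not_nonpos_Int
  by (auto simp: refl_Gamma_def Gamma_eq_zero_iff)

lemma refl_Gamma_holomorphic:
  assumes "a \<noteq> 0" "\<And>z. z \<in> A \<Longrightarrow> Re z > refl_bound a b"
  shows "refl_Gamma a b holomorphic_on A"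
proof (cases "a < 0")
  case True
  have "(\<lambda>z. Gamma (of_real (- a) * z + of_real b)) holomorphic_on A"
    using refl_Gamma_arg_pos(1)[OF assms(1) assms(2) True] Re_pos_not_nonpos_Int
    by (intro holomorphic_intros) blast
  then show ?thesis using True by (simp add: refl_Gamma_def [abs_def])
next
  case False
  have n: "of_real a * z + of_real (1 - b) \<notin> \<int>\<^sub>\<le>\<^sub>0" if "z \<in> A" for z
    using refl_Gamma_arg_pos(2)[OF assms(1) assms(2)[OF that] False] by (rule Re_pos_not_nonpos_Int)
  have "(\<lambda>z. of_real (2 * pi) / Gamma (of_real a * z + of_real (1 - b))) holomorphic_on A"
    using n by (intro holomorphic_intros) (auto simp: Gamma_eq_zero_iff)
  then show ?thesis using False by (simp add: refl_Gamma_def [abs_def])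
qed

text \<open>Positivity on the real axis later fixes the argument of the unimodular constant.\<close>

lemma refl_Gamma_real:
  assumes "a \<noteq> 0" "x > refl_bound a b"
  shows "\<exists>r>0. refl_Gamma a b (of_real x) = of_real r"
proof (cases "a < 0")
  case True
  have "- a * x + b > 0" using refl_Gamma_arg_pos(1)[of a b "of_real x"] assms True by simp
  then have "Gamma (- a * x + b) > 0" by (rule Gamma_real_pos)
  moreover have "refl_Gamma a b (of_real x) = of_real (Gamma (- a * x + b))"
    using True by (simp add: refl_Gamma_def Gamma_complex_of_real[symmetric])
  ultimately show ?thesis by blast
next
  case False
  have "a * x + (1 - b) > 0" using refl_Gamma_arg_pos(2)[of a b "of_real x"] assms False by simp
  then have "2 * pi / Gamma (a * x + (1 - b)) > 0" using Gamma_real_pos by simp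
  moreover have "refl_Gamma a b (of_real x) = of_real (2 * pi / Gamma (a * x + (1 - b)))"
    using False by (simp add: refl_Gamma_def Gamma_complex_of_real[symmetric])
  ultimately show ?thesis by blast
qed

text \<open>Integers are excluded because at a pole \<open>Gamma\<close> takes the default value 0,
  whereas its product with the sine has a nonzero limit.\<close>

lemma Gamma_mult_sin2:
  assumes "a > 0" "a * x + b \<notin> \<int>"
  shows "Gamma (of_real a * of_real x + of_real b) * sin2 a b (of_real x) = refl_Gamma a b (- of_real x)"
proof -
  define w where "w = complex_of_real a * of_real x + of_real b"
  have w: "w = of_real (a * x + b)" by (simp add: w_def)
  have "w \<notin> \<int>" using assms(2) unfolding w by (metis of_real_in_Ints_iff)
  then have s: "sin (of_real pi * w) \<noteq> 0"
  proof -
    have "sin (pi * (a * x + b)) \<noteq> 0"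
      using assms(2) by (auto simp: sin_zero_iff_int2)
    then show ?thesis unfolding w of_real_mult[symmetric] sin_of_real by simp
  qed
  have refl: "Gamma w * Gamma (1 - w) = of_real pi / sin (of_real pi * w)" by (rule Gamma_reflection_complex)
  have G1: "Gamma (1 - w) \<noteq> 0"
    using refl s by auto
  have "Gamma w * (2 * sin (of_real pi * w)) = of_real (2 * pi) / Gamma (1 - w)"
    using refl s G1 by (simp add: field_simps)
  moreover have "refl_Gamma a b (- of_real x) = of_real (2 * pi) / Gamma (1 - w)"
  proof -
    have arg: "of_real a * (- of_real x) + of_real (1 - b) = 1 - w" by (simp add: w_def)
    show ?thesis unfolding refl_Gamma_def arg using assms(1) by simp
  qed
  ultimately show ?thesis by (simp only: sin2_def w_def[symmetric])
qed

text \<open>One Stirling exponent for both signs of \<open>a\<close>: taking the reciprocal turns a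
  z + (1 - b) - 1/2 into - a z + b - 1/2.\<close>

definition refl_Gamma_approx :: "real \<Rightarrow> real \<Rightarrow> complex \<Rightarrow> complex" where
  "refl_Gamma_approx a b z =
     (- of_real a * z + of_real b - 1 / 2) * (of_real (ln \<bar>a\<bar>) + ln z) + of_real a * z"

text \<open>The factor 2 pi in \<open>refl_Gamma\<close>, produced by the doubled sine, makes the
  constants agree: 2 pi divided by its square root is that square root.\<close>

lemma refl_Gamma_asymp:
  assumes "a \<noteq> 0"
  shows "((\<lambda>z. refl_Gamma a b z / exp (refl_Gamma_approx a b z)) \<longlongrightarrow> of_real (sqrt (2 * pi))) re_at_top"
proof (cases "a < 0")
  case True
  then show ?thesis
    using Gamma_affine_asymp[of "- a" b] by (simp add: refl_Gamma_def refl_Gamma_approx_def)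
next
  case False
  with assms have a: "a > 0" by simp
  have "((\<lambda>z. of_real (2 * pi) / (Gamma (of_real a * z + of_real (1 - b)) /
      exp ((of_real a * z + of_real (1 - b) - 1 / 2) * (of_real (ln a) + ln z) - of_real a * z)))
      \<longlongrightarrow> of_real (2 * pi) / of_real (sqrt (2 * pi))) re_at_top"
    by (intro tendsto_divide tendsto_const Gamma_affine_asymp a) simp
  moreover have "of_real (2 * pi) / of_real (sqrt (2 * pi)) = complex_of_real (sqrt (2 * pi))"
    by (simp only: of_real_divide[symmetric] real_div_sqrt) (simp add: real_div_sqrt)
  moreover have "of_real (2 * pi) / (Gamma (of_real a * z + of_real (1 - b)) /
      exp ((of_real a * z + of_real (1 - b) - 1 / 2) * (of_real (ln a) + ln z) - of_real a * z)) =
      refl_Gamma a b z / exp (refl_Gamma_approx a b z)" for z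
  proof -
    define v where "v = (of_real a * z + of_real (1 - b) - 1 / 2) * (of_real (ln a) + ln z) - of_real a * z"
    have "refl_Gamma_approx a b z = - v"
      using a by (simp add: refl_Gamma_approx_def v_def algebra_simps)
    then show ?thesis using False unfolding v_def[symmetric] by (simp add: refl_Gamma_def exp_minus divide_inverse)
  qed
  ultimately show ?thesis by simp
qed

section \<open>The Gamma quotient as a meromorphic function and its reflected form\<close>

lemma analytic_Gamma_affine:
  assumes "of_real a * z + of_real b \<notin> \<int>\<^sub>\<le>\<^sub>0"
  shows "(\<lambda>s. Gamma (of_real a * s + of_real b :: complex)) analytic_on {z}"
  using assms by (intro analytic_intros) auto

text \<open>Each Gamma factor is the reciprocal of the entire function \<open>rGamma\<close>, so no
  list of poles is needed.\<close>

lemma gamma_quotient_nicely_meromorphic: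
  "gamma_quotient J K C D a b a' b' nicely_meromorphic_on UNIV"
proof -
  have G: "(\<lambda>s. Gamma (of_real p * s + of_real q :: complex)) meromorphic_on UNIV" for p q :: real
  proof -
    have "(\<lambda>s::complex. inverse (rGamma (of_real p * s + of_real q))) meromorphic_on UNIV"
      by (intro meromorphic_intros analytic_on_imp_meromorphic_on analytic_intros)
    then show ?thesis by (simp add: rGamma_inverse_Gamma)
  qed
  have P: "(\<lambda>s::complex. of_real D powr s) meromorphic_on UNIV"
  proof (cases "D = 0")
    case False
    then have "(\<lambda>s::complex. of_real D powr s) = (\<lambda>s. exp (s * ln (of_real D)))" by (simp add: powr_def fun_eq_iff)
    then show ?thesis
      by (simp only:) (intro analytic_on_imp_meromorphic_on analytic_intros)
  qed (simp add: meromorphic_on_const)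
  show ?thesis unfolding gamma_quotient_def
    by (intro remove_sings_nicely_meromorphic meromorphic_intros G P)
qed

text \<open>All integers are excluded, not only the nonpositive ones, so that at such a point no
  factor has a pole, \<open>remove_sings\<close> leaves the value alone, and the sines of the
  reflection formula do not vanish either.\<close>

definition gamma_regular :: "nat \<Rightarrow> nat \<Rightarrow> (nat \<Rightarrow> real) \<Rightarrow> (nat \<Rightarrow> real) \<Rightarrow> (nat \<Rightarrow> real) \<Rightarrow> (nat \<Rightarrow> real) \<Rightarrow> real \<Rightarrow> bool" where
  "gamma_regular J K a b a' b' x \<longleftrightarrow>
     (\<forall>j\<in>{1..J}. a j * x + b j \<notin> \<int>) \<and> (\<forall>k\<in>{1..K}. a' k * x + b' k \<notin> \<int>)"

lemma gamma_irregular_countable: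
  assumes "\<forall>j\<in>{1..J}. a j \<noteq> 0" "\<forall>k\<in>{1..K}. a' k \<noteq> 0"
  shows "countable {x. \<not> gamma_regular J K a b a' b' x}"
proof (rule countable_subset)
  show "{x. \<not> gamma_regular J K a b a' b' x} \<subseteq>
      (\<Union>j\<in>{1..J}. range (\<lambda>n::int. (of_int n - b j) / a j)) \<union> (\<Union>k\<in>{1..K}. range (\<lambda>n::int. (of_int n - b' k) / a' k))"
  proof
    fix x assume "x \<in> {x. \<not> gamma_regular J K a b a' b' x}"
    then consider j where "j \<in> {1..J}" "a j * x + b j \<in> \<int>" | k where "k \<in> {1..K}" "a' k * x + b' k \<in> \<int>"
      by (auto simp: gamma_regular_def)
    then show "x \<in> (\<Union>j\<in>{1..J}. range (\<lambda>n::int. (of_int n - b j) / a j)) \<union> (\<Union>k\<in>{1..K}. range (\<lambda>n::int. (of_int n - b' k) / a' k))"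
    proof cases
      case 1
      then obtain n where "a j * x + b j = of_int n" by (auto elim: Ints_cases)
      then have "x = (of_int n - b j) / a j" using assms 1 by (auto simp: field_simps)
      then show ?thesis using 1 by blast
    next
      case 2
      then obtain n where "a' k * x + b' k = of_int n" by (auto elim: Ints_cases)
      then have "x = (of_int n - b' k) / a' k" using assms 2 by (auto simp: field_simps)
      then show ?thesis using 2 by blast
    qed
  qed
qed auto

lemma gamma_quotient_regular:
  assumes "D > 0" "gamma_regular J K a b a' b' x"
  shows "gamma_quotient J K C D a b a' b' (of_real x) =
     of_real C * of_real D powr (of_real x) *
       (\<Prod>j=1..J. Gamma (of_real (a j) * of_real x + of_real (b j))) /
       (\<Prod>k=1..K. Gamma (of_real (a' k) * of_real x + of_real (b' k)))"
proof -
  have ni: "of_real p * of_real x + of_real q \<notin> (\<int>\<^sub>\<le>\<^sub>0 :: complex set)" if "p * x + q \<notin> \<int>" for p q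
  proof
    assume "of_real p * of_real x + of_real q \<in> (\<int>\<^sub>\<le>\<^sub>0 :: complex set)"
    then have "complex_of_real (p * x + q) \<in> \<int>" using nonpos_Ints_subset_Ints by auto
    then show False using that by (metis of_real_in_Ints_iff)
  qed
  have "(\<lambda>s. of_real C * of_real D powr s * (\<Prod>j=1..J. Gamma (of_real (a j) * s + of_real (b j))) /
       (\<Prod>k=1..K. Gamma (of_real (a' k) * s + of_real (b' k)))) analytic_on {complex_of_real x}"
  proof (intro analytic_on_divide analytic_on_mult analytic_on_prod analytic_Gamma_affine ni analytic_on_const)
    have "(\<lambda>s::complex. of_real D powr s) = (\<lambda>s. exp (s * ln (of_real D)))"
      using assms(1) by (simp add: powr_def fun_eq_iff)
    then show "(\<lambda>s::complex. of_real D powr s) analytic_on {complex_of_real x}"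
      by (simp only:) (intro analytic_intros)
  next
    fix z assume "z \<in> {complex_of_real x}"
    then show "(\<Prod>k=1..K. Gamma (of_real (a' k) * z + of_real (b' k))) \<noteq> 0"
      using assms(2) ni by (auto simp: gamma_regular_def Gamma_eq_zero_iff)
  qed (use assms(2) in \<open>auto simp: gamma_regular_def\<close>)
  then show ?thesis unfolding gamma_quotient_def by (rule remove_sings_at_analytic)
qed

definition refl_quotient ::
  "nat \<Rightarrow> nat \<Rightarrow> real \<Rightarrow> (nat \<Rightarrow> real) \<Rightarrow> (nat \<Rightarrow> real) \<Rightarrow> (nat \<Rightarrow> real) \<Rightarrow> (nat \<Rightarrow> real) \<Rightarrow> complex \<Rightarrow> complex" where
  "refl_quotient J K D a b a' b' z = exp (- z * of_real (ln D)) *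
     (\<Prod>j=1..J. refl_Gamma (a j) (b j) z) / (\<Prod>k=1..K. refl_Gamma (a' k) (b' k) z)"

text \<open>A positive \<open>a j\<close> puts its sine on the left, a positive \<open>a' k\<close>
  on the right. In this cross-multiplied form the zeros of the sines cause no singularities when the
  identity is continued.\<close>

lemma gamma_quotient_eq_refl_quotient:
  assumes "D > 0" "gamma_regular J K a b a' b' x"
    and "\<forall>j\<in>{1..J}. a j \<noteq> 0" "\<forall>k\<in>{1..K}. a' k \<noteq> 0"
    and "\<And>j. j \<in> {1..J} \<Longrightarrow> - x > refl_bound (a j) (b j)" "\<And>k. k \<in> {1..K} \<Longrightarrow> - x > refl_bound (a' k) (b' k)"
  shows "gamma_quotient J K C D a b a' b' (of_real x) * (\<Prod>j\<in>{j\<in>{1..J}. a j > 0}. sin2 (a j) (b j) (of_real x)) =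
     of_real C * refl_quotient J K D a b a' b' (- of_real x) * (\<Prod>k\<in>{k\<in>{1..K}. a' k > 0}. sin2 (a' k) (b' k) (of_real x))"
proof -
  have P: "(\<Prod>j=1..N. Gamma (of_real (p j) * of_real x + of_real (q j))) * (\<Prod>j\<in>{j\<in>{1..N}. p j > 0}. sin2 (p j) (q j) (of_real x))
      = (\<Prod>j=1..N. refl_Gamma (p j) (q j) (- of_real x))"
    if "\<forall>j\<in>{1..N}. p j \<noteq> 0" "\<forall>j\<in>{1..N}. p j * x + q j \<notin> \<int>" for N and p q :: "nat \<Rightarrow> real"
  proof -
    have "(\<Prod>j\<in>{j\<in>{1..N}. p j > 0}. sin2 (p j) (q j) (complex_of_real x)) = (\<Prod>j=1..N. if p j > 0 then sin2 (p j) (q j) (of_real x) else 1)"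
      by (rule prod.inter_filter) simp
    then have "(\<Prod>j=1..N. Gamma (of_real (p j) * of_real x + of_real (q j))) * (\<Prod>j\<in>{j\<in>{1..N}. p j > 0}. sin2 (p j) (q j) (of_real x)) =
       (\<Prod>j=1..N. Gamma (of_real (p j) * of_real x + of_real (q j)) * (if p j > 0 then sin2 (p j) (q j) (of_real x) else 1))"
      by (simp only: prod.distrib)
    also have "\<dots> = (\<Prod>j=1..N. refl_Gamma (p j) (q j) (- of_real x))"
    proof (rule prod.cong)
      fix j assume j: "j \<in> {1..N}"
      show "Gamma (of_real (p j) * of_real x + of_real (q j)) * (if p j > 0 then sin2 (p j) (q j) (of_real x) else 1) =
        refl_Gamma (p j) (q j) (- of_real x)"
      proof (cases "p j > 0")
        case True
        then show ?thesis using Gamma_mult_sin2[OF True] that j by auto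
      next
        case False
        then have "p j < 0" using that j by force
        then show ?thesis by (simp add: refl_Gamma_def)
      qed
    qed simp
    finally show ?thesis .
  qed
  have nz: "(\<Prod>k=1..K. refl_Gamma (a' k) (b' k) (- of_real x)) \<noteq> 0"
  proof -
    have "refl_Gamma (a' k) (b' k) (- of_real x) \<noteq> 0" if "k \<in> {1..K}" for k
      using assms(4) assms(6)[OF that] that by (intro refl_Gamma_nonzero) auto
    then show ?thesis by (simp only: prod_zero_iff finite_atLeastAtMost) blast
  qed
  have e: "of_real D powr of_real x = exp (- (- complex_of_real x) * of_real (ln D))"
    using assms(1) by (simp add: powr_def Ln_of_real)
  have 1: "(\<Prod>j=1..J. Gamma (of_real (a j) * of_real x + of_real (b j))) * (\<Prod>j\<in>{j\<in>{1..J}. a j > 0}. sin2 (a j) (b j) (of_real x))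
      = (\<Prod>j=1..J. refl_Gamma (a j) (b j) (- of_real x))"
    by (rule P) (use assms in \<open>auto simp: gamma_regular_def\<close>)
  have 2: "(\<Prod>k=1..K. Gamma (of_real (a' k) * of_real x + of_real (b' k))) * (\<Prod>k\<in>{k\<in>{1..K}. a' k > 0}. sin2 (a' k) (b' k) (of_real x))
      = (\<Prod>k=1..K. refl_Gamma (a' k) (b' k) (- of_real x))"
    by (rule P) (use assms in \<open>auto simp: gamma_regular_def\<close>)
  have alg: "c * d * g / g' * s = c * (d * r / r') * s'" if "g * s = r" "g' * s' = r'" "r' \<noteq> 0" for c d g g' s s' r r' :: complex
    using that by (auto simp: field_simps)
  show ?thesis
    unfolding gamma_quotient_regular[OF assms(1,2)] refl_quotient_def e by (rule alg[OF 1 2 nz])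
qed

section \<open>The Laplace transform as a multiple of the reflected quotient\<close>

lemma prod_pos_real:
  fixes f :: "'a \<Rightarrow> complex"
  assumes "\<And>j. j \<in> A \<Longrightarrow> \<exists>r>0. f j = of_real r"
  shows "\<exists>r>0. prod f A = of_real r"
proof -
  from assms obtain r where r: "\<And>j. j \<in> A \<Longrightarrow> r j > 0 \<and> f j = of_real (r j)" by metis
  then have "prod f A = of_real (prod r A)" by simp
  moreover have "prod r A > 0" using r by (intro prod_pos) auto
  ultimately show ?thesis by blast
qed

lemma refl_quotient_real:
  assumes "\<forall>j\<in>{1..J}. a j \<noteq> 0" "\<forall>k\<in>{1..K}. a' k \<noteq> 0"
    and "\<And>j. j \<in> {1..J} \<Longrightarrow> x > refl_bound (a j) (b j)" "\<And>k. k \<in> {1..K} \<Longrightarrow> x > refl_bound (a' k) (b' k)"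
  shows "\<exists>r>0. refl_quotient J K D a b a' b' (of_real x) = of_real r"
proof -
  obtain p where p: "p > 0" "(\<Prod>j=1..J. refl_Gamma (a j) (b j) (of_real x)) = of_real p"
    using prod_pos_real[of "{1..J}" "\<lambda>j. refl_Gamma (a j) (b j) (of_real x)"] refl_Gamma_real assms by blast
  obtain q where q: "q > 0" "(\<Prod>k=1..K. refl_Gamma (a' k) (b' k) (of_real x)) = of_real q"
    using prod_pos_real[of "{1..K}" "\<lambda>j. refl_Gamma (a' j) (b' j) (of_real x)"] refl_Gamma_real assms by blast
  have "refl_quotient J K D a b a' b' (of_real x) = of_real (exp (- x * ln D) * p / q)"
    unfolding refl_quotient_def p(2) q(2) by (simp add: exp_of_real[symmetric])
  moreover have "exp (- x * ln D) * p / q > 0" using p q by simp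
  ultimately show ?thesis by blast
qed

text \<open>The identity with the sines is first known at real points outside a countable set; this
  is the accumulation point inside the half-plane that the identity theorem requires.\<close>

lemma islimpt_co_countable:
  fixes R :: real
  assumes "countable B"
  shows "complex_of_real (-R - 1) islimpt (complex_of_real ` {x. x < -R \<and> x \<notin> B})"
  unfolding islimpt_approachable
proof (intro allI impI)
  fix e :: real assume "e > 0"
  define I where "I = {-R - 1<..<-R - 1 + min e 1}"
  have "uncountable I" using \<open>e > 0\<close> by (simp add: I_def uncountable_open_interval)
  then have "\<not> I \<subseteq> B" using assms countable_subset by blast
  then obtain x where x: "x \<in> I" "x \<notin> B" by blast
  then have "\<bar>x - (-R - 1)\<bar> < e" "x < -R" "x \<noteq> -R - 1" by (auto simp: I_def)
  then show "\<exists>x'\<in>complex_of_real ` {x. x < -R \<and> x \<notin> B}. x' \<noteq> complex_of_real (-R - 1) \<and> dist x' (complex_of_real (-R - 1)) < e"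
    using x by (intro bexI[of _ "complex_of_real x"]) (auto simp: dist_norm simp flip: of_real_diff)
qed

text \<open>The function \<open>G = m / (C * N)\<close>, with \<open>m\<close> the moment function
  and \<open>N\<close> the reflected quotient, is the quotient of sine products: numerator factors
  put their sines into \<open>Q\<close>, denominator factors into \<open>P\<close>. It is nonzero on
  the real axis since moments are positive. So it is a constant \<open>c\<close> of modulus 1, and
  positivity of \<open>m\<close> and \<open>N\<close> at one real point turns \<open>c * C\<close>
  into \<open>|C|\<close>.\<close>

theorem gamma_type_moments_refl:
  fixes M :: "'w measure" and Y :: "'w \<Rightarrow> real" and l u :: real
  assumes M: "prob_space M" and Y [measurable]: "Y \<in> borel_measurable M" and D: "D > 0"
    and a0: "\<forall>j\<in>{1..J}. a j \<noteq> 0" and a'0: "\<forall>k\<in>{1..K}. a' k \<noteq> 0"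
    and lu: "l < u"
    and int: "\<And>x. l < x \<Longrightarrow> x < u \<Longrightarrow> integrable M (\<lambda>\<omega>. exp (x * Y \<omega>))"
    and eq: "\<And>x. l < x \<Longrightarrow> x < u \<Longrightarrow> gamma_quotient J K C D a b a' b' (of_real x) = of_real (\<integral>\<omega>. exp (x * Y \<omega>) \<partial>M)"
    and nopole: "\<And>x::real. x < 0 \<Longrightarrow> \<not> is_pole (gamma_quotient J K C D a b a' b') (of_real x)"
  shows "\<exists>R. (\<forall>x>R. integrable M (\<lambda>\<omega>. exp (- x * Y \<omega>))) \<and>
     (\<forall>z. Re z > R \<longrightarrow> (\<integral>\<omega>. exp (- z * of_real (Y \<omega>)) \<partial>M) = of_real \<bar>C\<bar> * refl_quotient J K D a b a' b' z) \<and>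
     (\<Sum>k\<in>{k\<in>{1..K}. a' k > 0}. a' k) = (\<Sum>j\<in>{j\<in>{1..J}. a j > 0}. a j) \<and> C \<noteq> 0"
proof -
  interpret prob_space M by fact
  define F where "F = gamma_quotient J K C D a b a' b'"
  define N where "N = refl_quotient J K D a b a' b'"
  have ana: "F analytic_on {of_real x}" if "\<not> is_pole F (of_real x)" for x :: real
    using nicely_meromorphic_on_imp_analytic_at[OF gamma_quotient_nicely_meromorphic _ that[unfolded F_def]]
    by (simp add: F_def)
  have ext: "integrable M (\<lambda>\<omega>. exp (x * Y \<omega>)) \<and> F (of_real x) = of_real (\<integral>\<omega>. exp (x * Y \<omega>) \<partial>M)" if "x < u" for x
    by (rule laplace_extends_left[OF M Y lu int _ ana _ that]) (use eq nopole in \<open>auto simp: F_def\<close>)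
  \<comment> \<open>This puts all \<open>x < - R\<close> below \<open>u\<close> and dominates every
    \<open>refl_bound\<close>.\<close>
  define R where "R = \<bar>u\<bar> + (\<Sum>j=1..J. \<bar>refl_bound (a j) (b j)\<bar>) + (\<Sum>k=1..K. \<bar>refl_bound (a' k) (b' k)\<bar>)"
  have Ru: "R \<ge> \<bar>u\<bar>" unfolding R_def by (simp add: sum_nonneg)
  have Rj: "R \<ge> refl_bound (a j) (b j)" if "j \<in> {1..J}" for j
  proof -
    have "\<bar>refl_bound (a j) (b j)\<bar> \<le> (\<Sum>j=1..J. \<bar>refl_bound (a j) (b j)\<bar>)"
      using that by (intro member_le_sum) auto
    moreover have "(\<Sum>k=1..K. \<bar>refl_bound (a' k) (b' k)\<bar>) \<ge> 0" by (simp add: sum_nonneg)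
    ultimately show ?thesis unfolding R_def by linarith
  qed
  have Rk: "R \<ge> refl_bound (a' k) (b' k)" if "k \<in> {1..K}" for k
  proof -
    have "\<bar>refl_bound (a' k) (b' k)\<bar> \<le> (\<Sum>k=1..K. \<bar>refl_bound (a' k) (b' k)\<bar>)"
      using that by (intro member_le_sum) auto
    moreover have "(\<Sum>j=1..J. \<bar>refl_bound (a j) (b j)\<bar>) \<ge> 0" by (simp add: sum_nonneg)
    ultimately show ?thesis unfolding R_def by linarith
  qed
  define m where "m = (\<lambda>s::complex. \<integral>\<omega>. exp (s * of_real (Y \<omega>)) \<partial>M)"
  have intR: "integrable M (\<lambda>\<omega>. exp (x * Y \<omega>))" if "x < -R" for x using ext[of x] Ru that by auto
  have m_hol: "m holomorphic_on {s. Re s < -R}"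
    using laplace_holomorphic[OF Y open_lessThan[of "-R"]] intR by (simp add: m_def)
  have m_real: "m (of_real x) = of_real (\<integral>\<omega>. exp (x * Y \<omega>) \<partial>M)" for x
    unfolding m_def by (simp add: exp_of_real flip: of_real_mult)
  have m_pos: "(\<integral>\<omega>. exp (x * Y \<omega>) \<partial>M) > 0" if "x < -R" for x
  proof -
    have "(\<integral>\<omega>. exp (x * Y \<omega>) \<partial>M) \<noteq> 0"
      using integral_nonneg_eq_0_iff_AE[OF intR[OF that]] by simp
    moreover have "(\<integral>\<omega>. exp (x * Y \<omega>) \<partial>M) \<ge> 0" by simp
    ultimately show ?thesis by linarith
  qed
  have mF: "F (of_real x) = m (of_real x)" if "x < -R" for x
    using ext[of x] Ru that by (simp add: m_real)
  define B where "B = {x. \<not> gamma_regular J K a b a' b' x}"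
  have cB: "countable B" unfolding B_def by (rule gamma_irregular_countable[OF a0 a'0])
  have lim: "complex_of_real (-R - 1) islimpt (complex_of_real ` {x. x < -R \<and> x \<notin> B})"
    by (rule islimpt_co_countable[OF cB])
  \<comment> \<open>With \<open>C = 0\<close> the positive moment at a regular point would
    vanish.\<close>
  have C0: "C \<noteq> 0"
  proof
    assume "C = 0"
    have "complex_of_real ` {x. x < -R \<and> x \<notin> B} \<noteq> {}" using lim by (metis islimpt_EMPTY)
    then obtain x where x: "x < -R" "gamma_regular J K a b a' b' x" by (auto simp: B_def)
    then have "m (of_real x) = 0"
      using mF[of x] gamma_quotient_regular[OF D x(2)] \<open>C = 0\<close> by (simp add: F_def)
    then show False using m_pos[OF x(1)] by (simp add: m_real)
  qed
  have N_nz: "N (- s) \<noteq> 0" if "Re s < -R" for s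
  proof -
    have "refl_Gamma (a j) (b j) (- s) \<noteq> 0" if "j \<in> {1..J}" for j
      using a0 that Rj[OF that] \<open>Re s < -R\<close> by (intro refl_Gamma_nonzero) auto
    moreover have "refl_Gamma (a' k) (b' k) (- s) \<noteq> 0" if "k \<in> {1..K}" for k
      using a'0 that Rk[OF that] \<open>Re s < -R\<close> by (intro refl_Gamma_nonzero) auto
    ultimately show ?thesis by (auto simp: N_def refl_quotient_def)
  qed
  have N_hol: "(\<lambda>s. N (- s)) holomorphic_on {s. Re s < -R}"
  proof -
    have h: "(\<lambda>s. refl_Gamma p q (- s)) holomorphic_on {s. Re s < -R}" if "p \<noteq> 0" "R \<ge> refl_bound p q" for p q
    proof -
      have "refl_Gamma p q holomorphic_on {s. Re s > R}" by (rule refl_Gamma_holomorphic) (use that in auto)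
      then have "(refl_Gamma p q \<circ> uminus) holomorphic_on {s. Re s < -R}"
        by (intro holomorphic_on_compose_gen holomorphic_intros) auto
      then show ?thesis by (simp add: o_def)
    qed
    have nz: "(\<Prod>k=1..K. refl_Gamma (a' k) (b' k) (- s)) \<noteq> 0" if "Re s < -R" for s
      using N_nz[OF that] by (auto simp: N_def refl_quotient_def)
    show ?thesis unfolding N_def refl_quotient_def
      using a0 a'0 Rj Rk nz by (intro holomorphic_intros h) auto
  qed
  define G where "G = (\<lambda>s. m s / (of_real C * N (- s)))"
  have G_hol: "G holomorphic_on {s. Re s < -R}"
    unfolding G_def using C0 N_nz by (intro holomorphic_intros m_hol N_hol) auto
  define I where "I = {k\<in>{1..K}. a' k > 0}"
  define L where "L = {j\<in>{1..J}. a j > 0}"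
  define P where "P = (\<lambda>s. \<Prod>k\<in>I. sin2 (a' k) (b' k) s)"
  define Q where "Q = (\<lambda>s. \<Prod>j\<in>L. sin2 (a j) (b j) s)"
  have reg: "G (of_real x) * Q (of_real x) = P (of_real x)" if x: "x < -R" "x \<notin> B" for x
  proof -
    have "F (of_real x) * Q (of_real x) = of_real C * N (- of_real x) * P (of_real x)"
      unfolding F_def Q_def P_def I_def L_def N_def
      using x Rj Rk by (intro gamma_quotient_eq_refl_quotient D a0 a'0) (force simp: B_def)+
    then show ?thesis
      unfolding G_def mF[OF x(1)] using C0 N_nz[of "of_real x"] x(1) by (simp add: field_simps)
  qed
  have GQP: "G s * Q s = P s" if "Re s < -R" for s
  proof -
    have "(\<lambda>s. G s * Q s - P s) holomorphic_on {s. Re s < -R}"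
      unfolding P_def Q_def by (intro holomorphic_intros G_hol)
    then have "G s * Q s - P s = 0"
    proof (rule analytic_continuation[OF _ _ _ _ _ lim])
      show "connected {s. Re s < -R}" by (intro convex_connected convex_halfspace_Re_lt)
    qed (use reg that in \<open>auto intro: open_halfspace_Re_lt\<close>)
    then show ?thesis by simp
  qed
  have "\<exists>c. norm c = 1 \<and> (\<forall>s. Re s < -R \<longrightarrow> G s = c) \<and> sum a' I = sum a L"
  proof (rule sin2_quotient_constant[where \<beta> = b' and \<beta>' = b])
    show "G (of_real x) \<noteq> 0" if "x < -R" for x
      using m_pos[OF that] C0 N_nz[of "of_real x"] that by (simp add: G_def m_real)
  qed (use GQP G_hol in \<open>auto simp: I_def L_def P_def Q_def\<close>)
  then obtain c where c: "norm c = 1" "\<And>s. Re s < -R \<Longrightarrow> G s = c" and sums: "sum a' I = sum a L" by blast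
  have mc: "m s = c * of_real C * N (- s)" if "Re s < -R" for s
    using c(2)[OF that] C0 N_nz[OF that] by (simp add: G_def field_simps)
  obtain r where r: "r > 0" "N (of_real (R + 1)) = of_real r"
    using refl_quotient_real[OF a0 a'0, where x = "R + 1" and b = b and b' = b' and D = D] Rj Rk unfolding N_def by force
  define t where "t = (\<integral>\<omega>. exp ((-R - 1) * Y \<omega>) \<partial>M) / r"
  have t: "t > 0" using m_pos[of "-R - 1"] r by (simp add: t_def)
  have "m (of_real (-R - 1)) = c * of_real C * N (- of_real (-R - 1))" by (rule mc) simp
  also have "- complex_of_real (-R - 1) = of_real (R + 1)" by simp
  finally have cC: "c * of_real C = of_real t"
    unfolding m_real r(2) using r(1) by (simp add: t_def field_simps)
  have "\<bar>C\<bar> = norm (c * of_real C)" using c(1) by (simp add: norm_mult)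
  also have "\<dots> = t" unfolding cC using t by simp
  finally have "c * of_real C = of_real \<bar>C\<bar>" using cC by simp
  then have "(\<integral>\<omega>. exp (- z * of_real (Y \<omega>)) \<partial>M) = of_real \<bar>C\<bar> * N z" if "Re z > R" for z
    using mc[of "- z"] that by (simp add: m_def)
  moreover have "integrable M (\<lambda>\<omega>. exp (- x * Y \<omega>))" if "x > R" for x
    using intR[of "- x"] that by simp
  ultimately show ?thesis using sums C0 unfolding N_def I_def L_def by blast
qed

text \<open>Adding the Stirling exponents of all factors leaves \<open>\<gamma>\<close>,
  \<open>\<delta>\<close> and \<open>\<kappa>\<close> as coefficients. The terms free of
  \<open>z\<close> form \<open>W\<close>, which together with \<open>|C|\<close> and the powers of
  \<open>sqrt (2 * pi)\<close> makes up \<open>par_C1\<close>.\<close>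

theorem refl_quotient_asymp:
  fixes J K :: nat and C D :: real and a b a' b' :: "nat \<Rightarrow> real"
  defines "\<gamma> \<equiv> par_gamma J K a a'" and "\<delta> \<equiv> par_delta J K b b'" and "\<kappa> \<equiv> par_kappa J K D a a'"
  assumes a0: "\<forall>j\<in>{1..J}. a j \<noteq> 0" and a'0: "\<forall>k\<in>{1..K}. a' k \<noteq> 0" and C0: "C \<noteq> 0"
    and sums: "(\<Sum>k\<in>{k\<in>{1..K}. a' k > 0}. a' k) = (\<Sum>j\<in>{j\<in>{1..J}. a j > 0}. a j)"
  shows "((\<lambda>z. of_real \<bar>C\<bar> * refl_quotient J K D a b a' b' z /
      exp (- of_real \<kappa> * z + (of_real \<gamma> * z + of_real \<delta>) * ln z - of_real \<gamma> * z))
      \<longlongrightarrow> of_real (par_C1 J K C a b a' b')) re_at_top"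
proof -
  define T where "T = (\<lambda>z. (\<Sum>j=1..J. refl_Gamma_approx (a j) (b j) z) - (\<Sum>k=1..K. refl_Gamma_approx (a' k) (b' k) z))"
  define W where "W = (\<Sum>j=1..J. (b j - 1 / 2) * ln \<bar>a j\<bar>) - (\<Sum>k=1..K. (b' k - 1 / 2) * ln \<bar>a' k\<bar>)"
  have lim: "((\<lambda>z. (\<Prod>j=1..J. refl_Gamma (a j) (b j) z / exp (refl_Gamma_approx (a j) (b j) z)) /
      (\<Prod>k=1..K. refl_Gamma (a' k) (b' k) z / exp (refl_Gamma_approx (a' k) (b' k) z))) \<longlongrightarrow>
      (\<Prod>j=1..J. of_real (sqrt (2 * pi))) / (\<Prod>k=1..K. of_real (sqrt (2 * pi)))) re_at_top"
    using a0 a'0 by (intro tendsto_divide tendsto_prod refl_Gamma_asymp) auto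
  have lim2: "((\<lambda>z. of_real (\<bar>C\<bar> * exp W) * ((\<Prod>j=1..J. refl_Gamma (a j) (b j) z / exp (refl_Gamma_approx (a j) (b j) z)) /
      (\<Prod>k=1..K. refl_Gamma (a' k) (b' k) z / exp (refl_Gamma_approx (a' k) (b' k) z)))) \<longlongrightarrow>
      of_real (\<bar>C\<bar> * exp W) * ((\<Prod>j=1..J. of_real (sqrt (2 * pi))) / (\<Prod>k=1..K. of_real (sqrt (2 * pi))))) re_at_top"
    by (rule tendsto_mult[OF tendsto_const lim])
  have abs_sum: "(\<Sum>j\<in>A. \<bar>p j\<bar>) = - (\<Sum>j\<in>A. p j) + 2 * (\<Sum>j\<in>{j\<in>A. p j > 0}. p j)" if "finite A" for p :: "nat \<Rightarrow> real" and A
  proof -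
    have "(\<Sum>j\<in>{j\<in>A. p j > 0}. p j) = (\<Sum>j\<in>A. if p j > 0 then p j else 0)"
      using that by (rule sum.inter_filter)
    moreover have "(\<Sum>j\<in>A. \<bar>p j\<bar>) = (\<Sum>j\<in>A. - p j + 2 * (if p j > 0 then p j else 0))"
      by (intro sum.cong) auto
    ultimately show ?thesis by (simp add: sum.distrib sum_negf sum_subtractf sum_distrib_left)
  qed
  \<comment> \<open>As |p| = -p + 2 max(p, 0), the equality of the positive parts replaces the
    absolute values by minus the signed sums, which is what Stirling's formula yields.\<close>
  have gam: "\<gamma> = - ((\<Sum>j=1..J. a j) - (\<Sum>k=1..K. a' k))"
    unfolding \<gamma>_def par_gamma_def using sums by (simp add: abs_sum)
  have approx_sum: "(\<Sum>j=1..n. refl_Gamma_approx (p j) (q j) z) =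
      - z * of_real (\<Sum>j=1..n. p j * ln \<bar>p j\<bar>) + of_real (\<Sum>j=1..n. (q j - 1 / 2) * ln \<bar>p j\<bar>) +
      (- z * of_real (\<Sum>j=1..n. p j) + of_real ((\<Sum>j=1..n. q j) - real n / 2)) * ln z + z * of_real (\<Sum>j=1..n. p j)"
    for n and p q :: "nat \<Rightarrow> real" and z
  proof -
    have "refl_Gamma_approx (p j) (q j) z = - z * of_real (p j * ln \<bar>p j\<bar>) + of_real ((q j - 1 / 2) * ln \<bar>p j\<bar>) +
      (- z * of_real (p j) + of_real (q j - 1 / 2)) * ln z + z * of_real (p j)" for j
      by (simp add: refl_Gamma_approx_def algebra_simps)
    then have "(\<Sum>j=1..n. refl_Gamma_approx (p j) (q j) z) = (\<Sum>j=1..n. - z * of_real (p j * ln \<bar>p j\<bar>) + of_real ((q j - 1 / 2) * ln \<bar>p j\<bar>) +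
      (- z * of_real (p j) + of_real (q j - 1 / 2)) * ln z + z * of_real (p j))" by simp
    also have "\<dots> = - z * of_real (\<Sum>j=1..n. p j * ln \<bar>p j\<bar>) + of_real (\<Sum>j=1..n. (q j - 1 / 2) * ln \<bar>p j\<bar>) +
      (- z * of_real (\<Sum>j=1..n. p j) + of_real (\<Sum>j=1..n. q j - 1 / 2)) * ln z + z * of_real (\<Sum>j=1..n. p j)"
      by (simp only: sum.distrib of_real_sum sum_distrib_left[symmetric] sum_distrib_right[symmetric])
    also have "(\<Sum>j=1..n. q j - 1 / 2) = (\<Sum>j=1..n. q j) - real n / 2" by (simp add: sum_subtractf)
    finally show ?thesis .
  qed
  have T: "T z - z * of_real (ln D) = of_real W + (- of_real \<kappa> * z + (of_real \<gamma> * z + of_real \<delta>) * ln z - of_real \<gamma> * z)" for z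
    unfolding T_def approx_sum W_def gam \<kappa>_def \<delta>_def par_kappa_def par_delta_def
    by (simp add: algebra_simps add_divide_distrib diff_divide_distrib)
  have "of_real (\<bar>C\<bar> * exp W) * ((\<Prod>j=1..J. refl_Gamma (a j) (b j) z / exp (refl_Gamma_approx (a j) (b j) z)) /
      (\<Prod>k=1..K. refl_Gamma (a' k) (b' k) z / exp (refl_Gamma_approx (a' k) (b' k) z))) =
      of_real \<bar>C\<bar> * refl_quotient J K D a b a' b' z /
      exp (- of_real \<kappa> * z + (of_real \<gamma> * z + of_real \<delta>) * ln z - of_real \<gamma> * z)" for z
  proof -
    define E where "E = exp (- of_real \<kappa> * z + (of_real \<gamma> * z + of_real \<delta>) * ln z - of_real \<gamma> * z)"
    have e: "exp (T z) * exp (- z * of_real (ln D)) = of_real (exp W) * E"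
    proof -
      have "exp (T z) * exp (- z * of_real (ln D)) = exp (T z - z * of_real (ln D))"
        by (simp add: exp_diff exp_minus divide_inverse)
      also have "\<dots> = of_real (exp W) * E" by (simp only: T exp_add E_def exp_of_real)
      finally show ?thesis .
    qed
    have e1: "(\<Prod>j=1..J. exp (refl_Gamma_approx (a j) (b j) z)) / (\<Prod>k=1..K. exp (refl_Gamma_approx (a' k) (b' k) z)) = exp (T z)"
      by (simp add: T_def exp_diff exp_sum)
    have alg: "of_real (cc * w) * ((g / p) / (g' / p')) = of_real cc * (d * g / g') / ee"
      if "p / p' * d = of_real w * ee" "p \<noteq> 0" "p' \<noteq> 0" "ee \<noteq> 0" for cc w :: real and g p g' p' d ee :: complex
    proof -
      have "d = of_real w * ee * p' / p" using that by (simp add: field_simps)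
      then show ?thesis using that by simp
    qed
    have "(\<Prod>j=1..J. exp (refl_Gamma_approx (a j) (b j) z)) / (\<Prod>k=1..K. exp (refl_Gamma_approx (a' k) (b' k) z)) *
        exp (- z * of_real (ln D)) = of_real (exp W) * E"
      unfolding e1 by (rule e)
    then show ?thesis unfolding prod_dividef refl_quotient_def E_def[symmetric]
      by (rule alg) (auto simp: E_def)
  qed
  moreover have "of_real (\<bar>C\<bar> * exp W) * ((\<Prod>j=1..J. of_real (sqrt (2 * pi))) / (\<Prod>k=1..K. of_real (sqrt (2 * pi)))) =
     complex_of_real (par_C1 J K C a b a' b')"
  proof -
    have s: "sqrt (2 * pi) ^ n = exp (real n / 2 * ln (2 * pi))" for n
    proof -
      have "sqrt (2 * pi) = exp (ln (2 * pi) / 2)" by (rule sqrt_eq_exp) simp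
      then show ?thesis by (simp add: exp_of_nat_mult[symmetric])
    qed
    have p: "(\<Prod>j=1..n. \<bar>p j\<bar> powr (q j - 1 / 2)) = exp (\<Sum>j=1..n. (q j - 1 / 2) * ln \<bar>p j\<bar>)"
      if "\<forall>j\<in>{1..n}. p j \<noteq> 0" for n and p q :: "nat \<Rightarrow> real"
      using that by (simp add: exp_sum powr_def)
    have "par_C1 J K C a b a' b' = \<bar>C\<bar> * exp ((real J - real K) / 2 * ln (2 * pi)) * exp (\<Sum>j=1..J. (b j - 1 / 2) * ln \<bar>a j\<bar>) / exp (\<Sum>k=1..K. (b' k - 1 / 2) * ln \<bar>a' k\<bar>)"
      unfolding par_C1_def p[OF a0] p[OF a'0] by (simp add: powr_def)
    also have "\<dots> = \<bar>C\<bar> * exp W * (sqrt (2 * pi) ^ J / sqrt (2 * pi) ^ K)"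
    proof -
      have "exp ((real J - real K) / 2 * x) = exp (real J / 2 * x) / exp (real K / 2 * x)" for x :: real
        unfolding exp_diff[symmetric] by (rule arg_cong[of _ _ exp]) (simp add: field_simps)
      then show ?thesis unfolding s W_def by (simp only: exp_diff) (simp add: mult_ac)
    qed
    finally show ?thesis by simp
  qed
  ultimately show ?thesis using lim2 by simp
qed

section \<open>The comparison density\<close>

text \<open>For \<open>c > 0\<close> a multiple of the density of
  \<open>\<kappa> - \<gamma> * ln (T / \<gamma>)\<close>, where \<open>T\<close> is Gamma
  distributed with shape \<open>c\<close>.\<close>

definition log_saddle_density :: "real \<Rightarrow> real \<Rightarrow> real \<Rightarrow> real \<Rightarrow> real \<Rightarrow> real" where
  "log_saddle_density A \<kappa> \<gamma> c y = A * exp (- (c / \<gamma>) * (y - \<kappa>) - \<gamma> * exp (- (y - \<kappa>) / \<gamma>))"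

definition log_saddle_laplace :: "real \<Rightarrow> real \<Rightarrow> real \<Rightarrow> real \<Rightarrow> complex \<Rightarrow> complex" where
  "log_saddle_laplace A \<kappa> \<gamma> c z =
     of_real (A * \<gamma>) * exp (- of_real \<kappa> * z - (of_real \<gamma> * z + of_real c) * of_real (ln \<gamma>)) * Gamma (of_real \<gamma> * z + of_real c)"

text \<open>The substitution \<open>t = h y\<close>, a decreasing bijection onto the positive reals,
  turns the integral into Euler's integral for \<open>Gamma\<close> at
  \<open>\<gamma> * z + c\<close>.\<close>

lemma log_saddle_laplace:
  assumes \<gamma>: "\<gamma> > 0" and z: "\<gamma> * Re z + c > 0"
  shows "integrable lborel (\<lambda>y. of_real (log_saddle_density A \<kappa> \<gamma> c y) * exp (- z * of_real y))"
    and "(\<integral>y. of_real (log_saddle_density A \<kappa> \<gamma> c y) * exp (- z * of_real y) \<partial>lborel) = log_saddle_laplace A \<kappa> \<gamma> c z"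
proof -
  define w where "w = of_real \<gamma> * z + of_real c"
  have w: "Re w > 0" using z by (simp add: w_def)
  define h where "h = (\<lambda>y. \<gamma> * exp (- (y - \<kappa>) / \<gamma>))"
  have hpos: "h y > 0" for y using \<gamma> by (simp add: h_def)
  define f where "f = (\<lambda>t. complex_of_real t powr (w - 1) / of_real (exp t))"
  have der: "(h has_field_derivative - exp (- (y - \<kappa>) / \<gamma>)) (at y within UNIV)" for y
    unfolding h_def using \<gamma> by (auto intro!: derivative_eq_intros)
  have inj: "inj h" using \<gamma> by (auto simp: inj_def h_def)
  have ran: "range h = {0<..}"
  proof (intro set_eqI iffI)
    fix t :: real assume "t \<in> {0<..}"
    then have "t = h (\<kappa> - \<gamma> * ln (t / \<gamma>))" using \<gamma> by (simp add: h_def)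
    then show "t \<in> range h" by blast
  qed (use hpos in auto)
  have "f absolutely_integrable_on {0<..} \<and> integral {0<..} f = Gamma w"
    using absolutely_integrable_Gamma_integral'[OF w] integral_unique[OF Gamma_integral_complex'[OF w]]
    by (simp add: f_def)
  then have cv: "(\<lambda>y. \<bar>- exp (- (y - \<kappa>) / \<gamma>)\<bar> *\<^sub>R f (h y)) absolutely_integrable_on UNIV \<and>
      integral UNIV (\<lambda>y. \<bar>- exp (- (y - \<kappa>) / \<gamma>)\<bar> *\<^sub>R f (h y)) = Gamma w"
    using has_absolute_integral_change_of_variables_real[OF _ der inj, of f "Gamma w"] ran by simp
  define k where "k = (\<lambda>y. exp (w * of_real (ln \<gamma>) + of_real \<kappa> * z) / of_real \<gamma> *
      (of_real (exp (- (c / \<gamma>) * (y - \<kappa>) - \<gamma> * exp (- (y - \<kappa>) / \<gamma>))) * exp (- z * of_real y)))"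
  have k_eq: "\<bar>- exp (- (y - \<kappa>) / \<gamma>)\<bar> *\<^sub>R f (h y) = k y" for y
  proof -
    define L where "L = ln \<gamma> - (y - \<kappa>) / \<gamma>"
    have eL: "exp L = \<gamma> * exp (- (y - \<kappa>) / \<gamma>)"
    proof -
      have "exp L = exp (ln \<gamma>) * exp (- (y - \<kappa>) / \<gamma>)"
        unfolding L_def exp_add[symmetric] by (rule arg_cong[of _ _ exp]) (simp add: minus_divide_left)
      then show ?thesis using \<gamma> by (simp only: exp_ln)
    qed
    have hL: "h y = exp L" by (simp only: h_def eL)
    have e: "exp (- (y - \<kappa>) / \<gamma>) = exp L / \<gamma>" using \<gamma> by (simp only: eL) simp
    have "complex_of_real (h y) powr (w - 1) = exp ((w - 1) * of_real L)"
      unfolding hL by (simp add: powr_def exp_of_real Ln_of_real del: of_real_exp)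
    then have "\<bar>- exp (- (y - \<kappa>) / \<gamma>)\<bar> *\<^sub>R f (h y) = of_real (exp L / \<gamma>) * (exp ((w - 1) * of_real L) / of_real (exp (h y)))"
      unfolding f_def e using \<gamma> by (simp add: scaleR_conv_of_real)
    also have "\<dots> = exp (w * of_real L) / of_real \<gamma> * of_real (exp (- h y))"
    proof -
      have "exp (w * of_real L) = of_real (exp L) * exp ((w - 1) * of_real L)"
        by (simp add: exp_of_real[symmetric] exp_add[symmetric] algebra_simps)
      then show ?thesis by (simp add: exp_minus field_simps)
    qed
    also have "exp (w * of_real L) = exp (w * of_real (ln \<gamma>) + of_real \<kappa> * z) * (exp (- z * of_real y) * of_real (exp (- (c / \<gamma>) * (y - \<kappa>))))"
    proof -
      have "w * of_real L = w * of_real (ln \<gamma>) - (z + of_real (c / \<gamma>)) * of_real (y - \<kappa>)"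
      proof -
        define k where "k = complex_of_real (c / \<gamma>)"
        have w': "w = of_real \<gamma> * (z + k)" using \<gamma> by (simp add: w_def k_def distrib_left)
        have "\<gamma> * L = \<gamma> * ln \<gamma> - (y - \<kappa>)" using \<gamma> by (simp add: L_def field_simps)
        then have gL: "of_real \<gamma> * complex_of_real L = of_real \<gamma> * of_real (ln \<gamma>) - of_real (y - \<kappa>)"
          by (metis of_real_mult of_real_diff)
        have "w * of_real L = (z + k) * (of_real \<gamma> * of_real L)" by (simp add: w')
        also have "\<dots> = w * of_real (ln \<gamma>) - (z + k) * of_real (y - \<kappa>)"
          unfolding gL w' by (simp add: algebra_simps)
        finally show ?thesis by (simp only: k_def)
      qed
      also have "\<dots> = (w * of_real (ln \<gamma>) + of_real \<kappa> * z) + (- z * of_real y + of_real (- (c / \<gamma>) * (y - \<kappa>)))"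
        by (simp add: algebra_simps)
      finally show ?thesis by (simp only: exp_add exp_of_real)
    qed
    also have "exp (- h y) = exp (- (\<gamma> * exp (- (y - \<kappa>) / \<gamma>)))" by (simp add: h_def)
    finally show ?thesis
      unfolding k_def by (simp add: exp_add[symmetric] exp_diff exp_minus divide_inverse mult_ac)
  qed
  have kint: "k absolutely_integrable_on UNIV" "integral UNIV k = Gamma w"
    using cv unfolding k_eq by auto
  \<comment> \<open>The change of variables speaks about the completed Lebesgue measure; Borel
    measurability brings the result back to \<open>lborel\<close>.\<close>
  have kmeas: "k \<in> borel_measurable lborel" unfolding k_def by simp
  have ki: "integrable lborel k"
    using kint(1) integrable_completion[OF kmeas] by (simp add: set_integrable_def)
  have kI: "integral\<^sup>L lborel k = Gamma w"
    using set_lebesgue_integral_eq_integral(2)[OF kint(1)] kint(2) integral_completion[OF kmeas]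
    by (simp add: set_lebesgue_integral_def)
  define B where "B = of_real (A * \<gamma>) * exp (- of_real \<kappa> * z - w * of_real (ln \<gamma>))"
  have eq: "of_real (log_saddle_density A \<kappa> \<gamma> c y) * exp (- z * of_real y) = B * k y" for y
  proof -
    have "exp (- of_real \<kappa> * z - w * of_real (ln \<gamma>)) * exp (w * of_real (ln \<gamma>) + of_real \<kappa> * z) = 1"
      unfolding exp_add[symmetric] by (simp add: algebra_simps)
    then have "B * (exp (w * of_real (ln \<gamma>) + of_real \<kappa> * z) / of_real \<gamma>) = of_real A"
      using \<gamma> by (simp add: B_def mult.assoc)
    then show ?thesis unfolding k_def log_saddle_density_def
      by (simp only: mult.assoc[symmetric] of_real_mult)
  qed
  show "integrable lborel (\<lambda>y. of_real (log_saddle_density A \<kappa> \<gamma> c y) * exp (- z * of_real y))"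
    unfolding eq using ki by simp
  show "(\<integral>y. of_real (log_saddle_density A \<kappa> \<gamma> c y) * exp (- z * of_real y) \<partial>lborel) = log_saddle_laplace A \<kappa> \<gamma> c z"
    unfolding eq by (simp add: kI B_def log_saddle_laplace_def w_def)
qed

text \<open>The shape \<open>\<delta> + 1 / 2\<close> compensates the -1/2 in Stirling's exponent.
  Of the prefactor \<open>\<gamma>\<close>, only its square root survives the normalising power of
  \<open>\<gamma>\<close>.\<close>

lemma log_saddle_laplace_asymp:
  assumes \<gamma>: "\<gamma> > 0"
  shows "((\<lambda>z. log_saddle_laplace A \<kappa> \<gamma> (\<delta> + 1 / 2) z /
      exp (- of_real \<kappa> * z + (of_real \<gamma> * z + of_real \<delta>) * ln z - of_real \<gamma> * z))
      \<longlongrightarrow> of_real (A * sqrt (2 * pi * \<gamma>))) re_at_top"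
proof -
  define E where "E = (\<lambda>z::complex. exp ((of_real \<gamma> * z + of_real (\<delta> + 1 / 2) - 1 / 2) * (of_real (ln \<gamma>) + ln z) - of_real \<gamma> * z))"
  have "((\<lambda>z. of_real (A * sqrt \<gamma>) * (Gamma (of_real \<gamma> * z + of_real (\<delta> + 1 / 2)) / E z)) \<longlongrightarrow>
      of_real (A * sqrt \<gamma>) * of_real (sqrt (2 * pi))) re_at_top"
    unfolding E_def by (intro tendsto_mult tendsto_const Gamma_affine_asymp \<gamma>)
  moreover have "of_real (A * sqrt \<gamma>) * of_real (sqrt (2 * pi)) = complex_of_real (A * sqrt (2 * pi * \<gamma>))"
    by (simp add: real_sqrt_mult)
  moreover have "of_real (A * sqrt \<gamma>) * (Gamma (of_real \<gamma> * z + of_real (\<delta> + 1 / 2)) / E z) =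
     log_saddle_laplace A \<kappa> \<gamma> (\<delta> + 1 / 2) z /
      exp (- of_real \<kappa> * z + (of_real \<gamma> * z + of_real \<delta>) * ln z - of_real \<gamma> * z)" for z
  proof -
    define G where "G = Gamma (of_real \<gamma> * z + of_real (\<delta> + 1 / 2))"
    define l where "l = complex_of_real (ln \<gamma>)"
    define N where "N = exp (- of_real \<kappa> * z + (of_real \<gamma> * z + of_real \<delta>) * ln z - of_real \<gamma> * z)"
    have g: "of_real \<gamma> = of_real (sqrt \<gamma>) * exp (l / 2)"
    proof -
      have "exp (l / 2) = complex_of_real (exp (ln \<gamma> / 2))" by (simp add: l_def exp_of_real[symmetric])
      also have "exp (ln \<gamma> / 2) = sqrt \<gamma>" using sqrt_eq_exp[OF \<gamma>] by simp
      finally show ?thesis using \<gamma> by (simp flip: of_real_mult)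
    qed
    have "exp (l / 2) * exp (- of_real \<kappa> * z - (of_real \<gamma> * z + of_real (\<delta> + 1 / 2)) * l) * E z = N"
      unfolding E_def N_def l_def[symmetric] exp_add[symmetric]
      by (rule arg_cong[of _ _ exp]) (simp add: algebra_simps)
    then have "exp (l / 2) * exp (- of_real \<kappa> * z - (of_real \<gamma> * z + of_real (\<delta> + 1 / 2)) * l) / N = 1 / E z"
      by (simp add: E_def N_def field_simps)
    then have H: "of_real (A * sqrt \<gamma>) * G * (exp (l / 2) * exp (- of_real \<kappa> * z - (of_real \<gamma> * z + of_real (\<delta> + 1 / 2)) * l) / N) =
        of_real (A * sqrt \<gamma>) * G * (1 / E z)" by simp
    have eA: "of_real (A * \<gamma>) = of_real (A * sqrt \<gamma>) * exp (l / 2)" using g by simp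
    show ?thesis
      unfolding log_saddle_laplace_def G_def[symmetric] l_def[symmetric] N_def[symmetric] eA
      using H by (simp only: times_divide_eq_right times_divide_eq_left mult_1_right mult_1_left mult_ac)
  qed
  ultimately show ?thesis by (simp only:)
qed

lemma lorentzian_integral:
  assumes "s > 0"
  shows "integrable lborel (\<lambda>t::real. 1 / (1 + t\<^sup>2 / s\<^sup>2))" and "(\<integral>t. 1 / (1 + t\<^sup>2 / s\<^sup>2) \<partial>lborel) = s * pi"
proof -
  have i: "integrable lborel (\<lambda>x::real. inverse (1 + x\<^sup>2))"
    using integrable_inverse_1_plus_square by (simp add: set_integrable_def)
  have I: "(\<integral>x. inverse (1 + x\<^sup>2) \<partial>lborel) = pi"
    using LBINT_inverse_1_plus_square by (simp add: interval_lebesgue_integral_def set_lebesgue_integral_def)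
  have eq: "1 / (1 + t\<^sup>2 / s\<^sup>2) = inverse (1 + (0 + 1 / s * t)\<^sup>2)" for t :: real
    by (simp add: power_divide divide_inverse power_mult_distrib power_inverse mult.commute)
  show "integrable lborel (\<lambda>t::real. 1 / (1 + t\<^sup>2 / s\<^sup>2))"
    unfolding eq by (rule lborel_integrable_real_affine[OF i]) (use assms in simp)
  have "pi = \<bar>1 / s\<bar> *\<^sub>R (\<integral>t. inverse (1 + (0 + 1 / s * t)\<^sup>2) \<partial>lborel)"
    unfolding I[symmetric] by (rule lborel_integral_real_affine) (use assms in simp)
  then show "(\<integral>t. 1 / (1 + t\<^sup>2 / s\<^sup>2) \<partial>lborel) = s * pi"
    unfolding eq using assms by (simp add: field_simps)
qed

text \<open>The width of this Lorentzian is of order \<open>sqrt u / \<gamma>\<close>, as is that of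
  the transform itself near the saddle point, so integrating the bound loses only a constant factor.
  The 5 is the root of the 25 in \<open>norm_Gamma_decay\<close>.\<close>

lemma norm_log_saddle_laplace:
  assumes \<gamma>: "\<gamma> > 0" and A: "A > 0" and u: "u = \<gamma> * \<sigma> + c" "u \<ge> 1"
  shows "norm (log_saddle_laplace A \<kappa> \<gamma> c (Complex \<sigma> t)) \<le>
    A * \<gamma> * exp (- \<kappa> * \<sigma> - u * ln \<gamma>) * Gamma u * (1 / (1 + t\<^sup>2 / (5 * sqrt u / \<gamma>)\<^sup>2))"
proof -
  have w: "of_real \<gamma> * Complex \<sigma> t + of_real c = Complex u (\<gamma> * t)" by (simp add: u(1) complex_eq_iff)
  have "norm (log_saddle_laplace A \<kappa> \<gamma> c (Complex \<sigma> t)) =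
      A * \<gamma> * exp (- \<kappa> * \<sigma> - u * ln \<gamma>) * norm (Gamma (Complex u (\<gamma> * t)))"
    using \<gamma> A by (simp add: log_saddle_laplace_def w norm_mult)
  also have "\<dots> \<le> A * \<gamma> * exp (- \<kappa> * \<sigma> - u * ln \<gamma>) * (Gamma u / (1 + (\<gamma> * t)\<^sup>2 / (25 * u)))"
    using \<gamma> A by (intro mult_left_mono norm_Gamma_decay u) auto
  also have "(\<gamma> * t)\<^sup>2 / (25 * u) = t\<^sup>2 / (5 * sqrt u / \<gamma>)\<^sup>2"
    using u(2) \<gamma> by (simp add: power_mult_distrib power_divide)
  finally show ?thesis by simp
qed

section \<open>A pointwise bound by the Fourier transform\<close>

lemma gaussian_fourier_scaled:
  assumes "n > 0"
  shows "(CLINT t|lborel. std_normal_density (t / n) *\<^sub>R iexp (v * t)) =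
           complex_of_real (sqrt (2 * pi) * (n * std_normal_density (n * v)))"
proof -
  have "char std_normal_distribution (n * v) = exp (- (n * v)\<^sup>2 / 2)"
    by (simp add: char_std_normal_distribution)
  then have "(CLINT t|lborel. std_normal_density t *\<^sub>R iexp (n * v * t)) = exp (- (n * v)\<^sup>2 / 2)"
    unfolding char_def by (subst (asm) integral_density) (auto simp: normal_density_nonneg)
  moreover have "(CLINT t|lborel. std_normal_density t *\<^sub>R iexp (n * v * t)) =
      \<bar>1 / n\<bar> *\<^sub>R (CLINT t|lborel. std_normal_density (0 + 1 / n * t) *\<^sub>R iexp (n * v * (0 + 1 / n * t)))"
    by (rule lborel_integral_real_affine) (use assms in simp)
  ultimately have "(CLINT t|lborel. std_normal_density (t / n) *\<^sub>R iexp (v * t)) = of_real (n * exp (- (n * v)\<^sup>2 / 2))"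
    using assms by (simp add: scaleR_conv_of_real field_simps)
  also have "n * exp (- (n * v)\<^sup>2 / 2) = sqrt (2 * pi) * (n * std_normal_density (n * v))"
    by (simp add: std_normal_density_def)
  finally show ?thesis .
qed

lemma integrable_std_normal_density_scaled:
  assumes "n > 0"
  shows "integrable lborel (\<lambda>t. std_normal_density (t / n))"
proof -
  have "integrable lborel std_normal_density" by simp
  then have "integrable lborel (\<lambda>x. std_normal_density (0 + (1 / n) * x))"
    using assms by (intro lborel_integrable_real_affine) auto
  then show ?thesis by simp
qed

lemma std_normal_density_le: "std_normal_density x \<le> 1 / sqrt (2 * pi)"
  unfolding std_normal_density_def by (intro mult_left_le) auto

text \<open>The Gaussian kernel is written as a Fourier integral and the integrals are interchanged,
  which the Gaussian weight in \<open>t\<close> permits. That weight is at most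
  \<open>1 / sqrt (2 * pi)\<close>, so the bound is free of \<open>n\<close>.\<close>

lemma gaussian_smoothing_bound:
  fixes q b :: "real \<Rightarrow> real"
  assumes q: "integrable lborel q" and b: "integrable lborel b"
    and hat: "\<And>t. norm (CLINT x|lborel. q x *\<^sub>R iexp (- (t * x))) \<le> b t"
    and n: "n > 0"
  shows "\<bar>LINT x|lborel. q x * (n * std_normal_density (n * (y - x)))\<bar> \<le> (LINT t|lborel. b t) / (2 * pi)"
proof -
  have [measurable]: "q \<in> borel_measurable borel" using q by auto
  define A where "A = (LINT x|lborel. q x * (n * std_normal_density (n * (y - x))))"
  define f where "f = (\<lambda>(x, t). of_real (q x) * (std_normal_density (t / n) *\<^sub>R iexp ((y - x) * t)))"
  define Q where "Q = (\<lambda>t. CLINT x|lborel. q x *\<^sub>R iexp (- (t * x)))"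
  have nf: "norm (f (x, t)) = \<bar>q x\<bar> * std_normal_density (t / n)" for x t
    by (simp add: f_def norm_mult normal_density_nonneg)
  have fac: "f (x, t) = (std_normal_density (t / n) *\<^sub>R iexp (y * t)) * (q x *\<^sub>R iexp (- (t * x)))" for x t
    by (simp add: f_def scaleR_conv_of_real exp_add[symmetric] algebra_simps)
  have inner: "(CLINT x|lborel. f (x, t)) = (std_normal_density (t / n) *\<^sub>R iexp (y * t)) * Q t" for t
    by (simp only: fac integral_mult_right_zero Q_def)
  have b0: "b t \<ge> 0" for t using hat[of t] by (rule order_trans[rotated]) simp
  have fi: "integrable (lborel \<Otimes>\<^sub>M lborel) f"
  proof (rule lborel_pair.Fubini_integrable)
    show "f \<in> borel_measurable (lborel \<Otimes>\<^sub>M lborel)" unfolding f_def by measurable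
    show "integrable lborel (\<lambda>x. \<integral>t. norm (f (x, t)) \<partial>lborel)" using q by (simp add: nf)
    show "AE x in lborel. integrable lborel (\<lambda>t. f (x, t))"
    proof (rule AE_I2)
      fix x
      show "integrable lborel (\<lambda>t. f (x, t))"
      proof (rule Bochner_Integration.integrable_bound)
        show "integrable lborel (\<lambda>t. \<bar>q x\<bar> * std_normal_density (t / n))"
          by (intro integrable_mult_right integrable_std_normal_density_scaled n)
        show "(\<lambda>t. f (x, t)) \<in> borel_measurable lborel" unfolding f_def by simp
        show "AE t in lborel. norm (f (x, t)) \<le> norm (\<bar>q x\<bar> * std_normal_density (t / n))"
          by (simp add: nf)
      qed
    qed
  qed
  have "complex_of_real (sqrt (2 * pi) * A) = (CLINT x|lborel. of_real (q x) * complex_of_real (sqrt (2 * pi) * (n * std_normal_density (n * (y - x)))))"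
    unfolding A_def integral_mult_right_zero[symmetric] integral_complex_of_real[symmetric]
    by (intro Bochner_Integration.integral_cong) auto
  also have "\<dots> = (CLINT x|lborel. CLINT t|lborel. f (x, t))"
    by (simp only: gaussian_fourier_scaled[OF n, symmetric] f_def prod.case integral_mult_right_zero)
  also have "\<dots> = (CLINT t|lborel. CLINT x|lborel. f (x, t))"
    using lborel_pair.Fubini_integral[of "\<lambda>x t. f (x, t)"] fi by simp
  also have "norm \<dots> \<le> (LINT t|lborel. norm (CLINT x|lborel. f (x, t)))" by (rule integral_norm_bound)
  also have "\<dots> \<le> (LINT t|lborel. b t / sqrt (2 * pi))"
  proof (rule integral_mono)
    show "integrable lborel (\<lambda>t. norm (CLINT x|lborel. f (x, t)))"
      using lborel_pair.integrable_snd[of "\<lambda>x t. f (x, t)"] fi by simp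
    show "norm (CLINT x|lborel. f (x, t)) \<le> b t / sqrt (2 * pi)" for t
    proof -
      have "norm (CLINT x|lborel. f (x, t)) = std_normal_density (t / n) * norm (Q t)"
        unfolding inner by (simp add: norm_mult normal_density_nonneg)
      also have "\<dots> \<le> 1 / sqrt (2 * pi) * b t"
        unfolding Q_def by (intro mult_mono std_normal_density_le hat) (auto simp: normal_density_nonneg)
      finally show ?thesis by simp
    qed
  qed (use b in simp)
  finally have "sqrt (2 * pi) * \<bar>A\<bar> \<le> (LINT t|lborel. b t) / sqrt (2 * pi)"
    by (simp only: norm_of_real abs_mult) simp
  then have "\<bar>A\<bar> \<le> (LINT t|lborel. b t) / sqrt (2 * pi) / sqrt (2 * pi)"
    by (simp add: field_simps)
  then show ?thesis by (simp add: A_def)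
qed

text \<open>Since \<open>q\<close> need not be bounded, it is cut at a ball around \<open>y\<close>.
  Inside, continuity bounds it and rescaling gives a fixed Gaussian; outside, the kernels are
  bounded uniformly in \<open>n\<close> and tend to 0, so a multiple of \<open>|q|\<close>
  dominates.\<close>

lemma gaussian_smoothing_tendsto:
  fixes q :: "real \<Rightarrow> real"
  assumes q: "integrable lborel q" and cont: "isCont q y"
  shows "(\<lambda>n. LINT x|lborel. q x * (real (Suc n) * std_normal_density (real (Suc n) * (y - x)))) \<longlonglongrightarrow> q y"
proof -
  have [measurable]: "q \<in> borel_measurable borel" using q by auto
  define k where "k = (\<lambda>n v. real (Suc n) * std_normal_density (real (Suc n) * v))"
  have k0: "k n v \<ge> 0" for n v by (simp add: k_def normal_density_nonneg)
  have [measurable]: "k n \<in> borel_measurable borel" for n unfolding k_def by measurable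
  obtain \<delta> where \<delta>: "\<delta> > 0" "\<And>x. \<bar>x - y\<bar> < \<delta> \<Longrightarrow> \<bar>q x - q y\<bar> < 1"
    using cont unfolding continuous_at_eps_delta real_norm_def dist_real_def
    by (metis zero_less_one)
  have [measurable]: "ball y \<delta> \<in> sets borel" by simp
  define q1 where "q1 = (\<lambda>x. indicator (ball y \<delta>) x * q x)"
  define q2 where "q2 = (\<lambda>x. indicator (- ball y \<delta>) x * q x)"
  have [measurable]: "q1 \<in> borel_measurable borel" "q2 \<in> borel_measurable borel"
    unfolding q1_def q2_def by measurable
  \<comment> \<open>The crude bound e^(-s) <= 1/s with s = \<open>N * a\<close> suffices: one factor
    \<open>N\<close> cancels the height of the kernel, and \<open>1 / a <= 2 / \<delta>^2\<close>
    since \<open>N >= 1\<close>.\<close>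
  have kle: "k n v \<le> 2 / \<delta>\<^sup>2" if "\<bar>v\<bar> \<ge> \<delta>" for n v
  proof -
    define N where "N = real (Suc n)"
    have N: "N \<ge> 1" by (simp add: N_def)
    define a where "a = N * \<delta>\<^sup>2 / 2"
    have a: "a > 0" using N \<delta>(1) by (simp add: a_def)
    have v2: "\<delta>\<^sup>2 \<le> v\<^sup>2" using that \<delta>(1) by (metis abs_le_square_iff abs_of_pos)
    have "N * a = (N\<^sup>2 * \<delta>\<^sup>2) / 2" by (simp add: a_def power2_eq_square)
    also have "\<dots> \<le> (N * v)\<^sup>2 / 2" using v2 N by (simp add: power_mult_distrib)
    finally have "exp (- (N * v)\<^sup>2 / 2) \<le> exp (- (N * a))" by simp
    also have "\<dots> = 1 / exp (N * a)" by (simp add: exp_minus divide_inverse)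
    also have "\<dots> \<le> 1 / (N * a)"
    proof -
      have "N * a \<le> exp (N * a)" using exp_ge_add_one_self[of "N * a"] by linarith
      then show ?thesis using N a by (intro divide_left_mono mult_pos_pos) auto
    qed
    finally have e: "exp (- (N * v)\<^sup>2 / 2) \<le> 1 / (N * a)" .
    have "std_normal_density (N * v) \<le> exp (- (N * v)\<^sup>2 / 2)"
    proof -
      have "1 / sqrt (2 * pi) \<le> 1" using pi_ge_two by simp
      then show ?thesis unfolding std_normal_density_def by (intro mult_left_le_one_le) auto
    qed
    then have "k n v \<le> N * (1 / (N * a))" unfolding k_def N_def[symmetric]
      using e N by (intro mult_left_mono) linarith+
    also have "\<dots> = 1 / a" using N by simp
    also have "\<dots> \<le> 2 / \<delta>\<^sup>2" using N \<delta>(1) by (simp add: a_def field_simps)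
    finally show ?thesis .
  qed
  have int2: "integrable lborel (\<lambda>x. 2 / \<delta>\<^sup>2 * \<bar>q x\<bar>)" using q by simp
  have int1: "integrable lborel (\<lambda>u. (\<bar>q y\<bar> + 1) * std_normal_density u)" by simp
  have lim2: "(\<lambda>n. LINT x|lborel. q2 x * k n (y - x)) \<longlonglongrightarrow> (LINT x::real|lborel. (0::real))"
  proof (rule integral_dominated_convergence[OF _ _ int2])
    show "AE x in lborel. (\<lambda>n. q2 x * k n (y - x)) \<longlonglongrightarrow> 0"
    proof (rule AE_I2)
      fix x
      show "(\<lambda>n. q2 x * k n (y - x)) \<longlonglongrightarrow> 0"
      proof (cases "x = y")
        case False
        define c where "c = (y - x)\<^sup>2"
        have c: "c > 0" using False by (simp add: c_def)
        have "(\<lambda>n. real (Suc n) * (1 / sqrt (2 * pi) * exp (- (real (Suc n))\<^sup>2 * c / 2))) \<longlonglongrightarrow> 0"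
          using c by real_asymp
        then have "(\<lambda>n. k n (y - x)) \<longlonglongrightarrow> 0"
          by (simp only: k_def std_normal_density_def power_mult_distrib c_def mult_minus_left)
        then show ?thesis by (rule tendsto_mult_right_zero)
      qed (use \<delta>(1) in \<open>simp add: q2_def\<close>)
    qed
    show "AE x in lborel. norm (q2 x * k n (y - x)) \<le> 2 / \<delta>\<^sup>2 * \<bar>q x\<bar>" for n
    proof (rule AE_I2)
      fix x
      show "norm (q2 x * k n (y - x)) \<le> 2 / \<delta>\<^sup>2 * \<bar>q x\<bar>"
      proof (cases "x \<in> ball y \<delta>")
        case False
        then have "\<bar>y - x\<bar> \<ge> \<delta>" by (simp add: dist_real_def)
        then have "k n (y - x) * \<bar>q x\<bar> \<le> 2 / \<delta>\<^sup>2 * \<bar>q x\<bar>" by (intro mult_right_mono kle) auto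
        moreover have "norm (q2 x * k n (y - x)) = k n (y - x) * \<bar>q x\<bar>"
          using False k0[of n "y - x"] by (simp add: q2_def abs_mult)
        ultimately show ?thesis by simp
      qed (simp add: q2_def)
    qed
  qed (use q in auto)
  have lim1: "(\<lambda>n. LINT u|lborel. q1 (y + u / real (Suc n)) * std_normal_density u) \<longlonglongrightarrow> (LINT u|lborel. q y * std_normal_density u)"
  proof (rule integral_dominated_convergence[OF _ _ int1])
    show "AE u in lborel. (\<lambda>n. q1 (y + u / real (Suc n)) * std_normal_density u) \<longlonglongrightarrow> q y * std_normal_density u"
    proof (rule AE_I2)
      fix u
      have l0: "(\<lambda>n. y + u / real (Suc n)) \<longlonglongrightarrow> y" by real_asymp
      have "(\<lambda>n. q (y + u / real (Suc n))) \<longlonglongrightarrow> q y"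
        by (rule isCont_tendsto_compose[OF cont l0])
      moreover have "\<forall>\<^sub>F n in sequentially. q (y + u / real (Suc n)) = q1 (y + u / real (Suc n))"
        using tendstoD[OF l0 \<delta>(1)] by eventually_elim (simp add: q1_def dist_commute)
      ultimately have "(\<lambda>n. q1 (y + u / real (Suc n))) \<longlonglongrightarrow> q y" by (rule Lim_transform_eventually)
      then show "(\<lambda>n. q1 (y + u / real (Suc n)) * std_normal_density u) \<longlonglongrightarrow> q y * std_normal_density u"
        by (intro tendsto_intros)
    qed
    show "AE u in lborel. norm (q1 (y + u / real (Suc n)) * std_normal_density u) \<le> (\<bar>q y\<bar> + 1) * std_normal_density u" for n
    proof (rule AE_I2)
      fix u
      have "\<bar>q1 x\<bar> \<le> \<bar>q y\<bar> + 1" for x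
        using \<delta>(2)[of x] by (auto simp: q1_def indicator_def dist_real_def abs_minus_commute[of y x])
      then show "norm (q1 (y + u / real (Suc n)) * std_normal_density u) \<le> (\<bar>q y\<bar> + 1) * std_normal_density u"
        by (simp add: abs_mult normal_density_nonneg mult_right_mono)
    qed
  qed auto
  have sub: "(LINT x|lborel. q1 x * k n (y - x)) = (LINT u|lborel. q1 (y + u / real (Suc n)) * std_normal_density u)" for n
  proof -
    have "(LINT x|lborel. q1 x * k n (y - x)) = \<bar>1 / real (Suc n)\<bar> *\<^sub>R (LINT u|lborel. q1 (y + 1 / real (Suc n) * u) * k n (y - (y + 1 / real (Suc n) * u)))"
      by (rule lborel_integral_real_affine) simp
    also have "\<dots> = (LINT u|lborel. \<bar>1 / real (Suc n)\<bar> * (q1 (y + 1 / real (Suc n) * u) * k n (y - (y + 1 / real (Suc n) * u))))"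
      by simp
    also have "\<dots> = (LINT u|lborel. q1 (y + u / real (Suc n)) * std_normal_density u)"
      by (intro Bochner_Integration.integral_cong) (auto simp: k_def std_normal_density_def field_simps simp del: of_nat_Suc)
    finally show ?thesis .
  qed
  have kb: "k n v \<le> real (Suc n)" for n v
  proof -
    have "1 / sqrt (2 * pi) \<le> 1" using pi_ge_two by simp
    then have "std_normal_density (real (Suc n) * v) \<le> 1" using std_normal_density_le order_trans by blast
    then show ?thesis unfolding k_def by (intro mult_left_le) auto
  qed
  have "(LINT x|lborel. q x * k n (y - x)) = (LINT x|lborel. q1 x * k n (y - x)) + (LINT x|lborel. q2 x * k n (y - x))" for n
  proof -
    have i: "integrable lborel (\<lambda>x. real (Suc n) * \<bar>q x\<bar>)" using q by simp
    have "integrable lborel (\<lambda>x. q1 x * k n (y - x))"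
      by (rule Bochner_Integration.integrable_bound[OF i])
         (use kb k0 in \<open>auto simp: q1_def indicator_def abs_mult mult.commute[of "\<bar>q _\<bar>"] intro!: mult_right_mono simp del: of_nat_Suc\<close>)
    moreover have "integrable lborel (\<lambda>x. q2 x * k n (y - x))"
      by (rule Bochner_Integration.integrable_bound[OF i])
         (use kb k0 in \<open>auto simp: q2_def indicator_def abs_mult mult.commute[of "\<bar>q _\<bar>"] intro!: mult_right_mono simp del: of_nat_Suc\<close>)
    ultimately have "(LINT x|lborel. q1 x * k n (y - x) + q2 x * k n (y - x)) = (LINT x|lborel. q1 x * k n (y - x)) + (LINT x|lborel. q2 x * k n (y - x))"
      by (rule Bochner_Integration.integral_add)
    moreover have "q1 x * k n (y - x) + q2 x * k n (y - x) = q x * k n (y - x)" for x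
      by (auto simp: q1_def q2_def indicator_def)
    ultimately show ?thesis by simp
  qed
  then have "(\<lambda>n. LINT x|lborel. q x * k n (y - x)) \<longlonglongrightarrow> q y"
    using tendsto_add[OF lim1 lim2] sub by simp
  then show ?thesis by (simp only: k_def)
qed

text \<open>Inversion as an inequality: the smoothed values obey the bound for all \<open>n\<close>,
  and continuity at the one point \<open>y\<close> passes it to the limit.\<close>

theorem abs_le_integral_fourier_bound:
  fixes q b :: "real \<Rightarrow> real"
  assumes q: "integrable lborel q" and cont: "isCont q y" and b: "integrable lborel b"
    and hat: "\<And>t. norm (CLINT x|lborel. q x *\<^sub>R iexp (- (t * x))) \<le> b t"
  shows "\<bar>q y\<bar> \<le> (LINT t|lborel. b t) / (2 * pi)"
proof (rule tendsto_upperbound[OF tendsto_rabs[OF gaussian_smoothing_tendsto[OF q cont]]])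
  show "\<forall>\<^sub>F n in sequentially. \<bar>LINT x|lborel. q x * (real (Suc n) * std_normal_density (real (Suc n) * (y - x)))\<bar> \<le> (LINT t|lborel. b t) / (2 * pi)"
    by (intro always_eventually allI gaussian_smoothing_bound[OF q b hat]) auto
qed simp

section \<open>Saddle-point asymptotics of the density\<close>

lemma exp_laplace_density:
  fixes M :: "'w measure" and fY :: "real \<Rightarrow> real"
  assumes dist: "distributed M lborel Y (\<lambda>y. ennreal (fY y))" and nn: "\<And>y. fY y \<ge> 0"
  shows "integrable M (\<lambda>\<omega>. exp (x * Y \<omega>)) \<longleftrightarrow> integrable lborel (\<lambda>y. fY y * exp (x * y))"
    and "(\<integral>\<omega>. exp (z * of_real (Y \<omega>)) \<partial>M) = (CLINT y|lborel. of_real (fY y) * exp (z * of_real y))"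
proof -
  have [measurable]: "Y \<in> borel_measurable M" using distributed_measurable[OF dist] by simp
  have [measurable]: "fY \<in> borel_measurable borel"
    using distributed_real_measurable[OF _ dist] nn by simp
  show "integrable M (\<lambda>\<omega>. exp (x * Y \<omega>)) \<longleftrightarrow> integrable lborel (\<lambda>y. fY y * exp (x * y))"
    using distributed_integrable[OF dist, of "\<lambda>y. exp (x * y)"] nn by simp
  have "(\<integral>\<omega>. exp (z * of_real (Y \<omega>)) \<partial>M) = (\<integral>y. exp (z * of_real y) \<partial>distr M lborel Y)"
    by (rule integral_distr[symmetric]) simp_all
  also have "distr M lborel Y = density lborel (\<lambda>y. ennreal (fY y))"
    by (rule distributed_distr_eq_density[OF dist])
  also have "(\<integral>y. exp (z * of_real y) \<partial>density lborel (\<lambda>y. ennreal (fY y))) = (CLINT y|lborel. fY y *\<^sub>R exp (z * of_real y))"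
    by (rule integral_density) (use nn in auto)
  finally show "(\<integral>\<omega>. exp (z * of_real (Y \<omega>)) \<partial>M) = (CLINT y|lborel. of_real (fY y) * exp (z * of_real y))"
    by (simp add: scaleR_conv_of_real)
qed

text \<open>This expression is the factor in \<open>density_difference_bound\<close>; its
  boundedness makes the error there comparable with the density.\<close>

lemma Gamma_real_stirling:
  "((\<lambda>u::real. Gamma u * sqrt u * exp (u - u * ln u)) \<longlongrightarrow> sqrt (2 * pi)) at_top"
proof -
  have f: "filterlim complex_of_real re_at_top at_top"
    unfolding filterlim_filtercomap_iff by (simp add: o_def filterlim_ident)
  let ?v = "\<lambda>u. (complex_of_real u - 1 / 2) * ln (complex_of_real u) - complex_of_real u"
  have lim: "((\<lambda>u::real. norm (Gamma (complex_of_real u) / exp (?v u))) \<longlongrightarrow> norm (complex_of_real (sqrt (2 * pi)))) at_top"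
    using filterlim_compose[OF tendsto_norm[OF Gamma_affine_asymp[of 1 0]] f] by (simp add: o_def)
  have ev: "\<forall>\<^sub>F u::real in at_top. norm (Gamma (complex_of_real u) / exp (?v u)) = Gamma u * sqrt u * exp (u - u * ln u)"
    using eventually_gt_at_top[of 0]
  proof eventually_elim
    case (elim u)
    have e: "sqrt u * exp (u - u * ln u) = exp (- ((u - 1 / 2) * ln u - u))"
      unfolding sqrt_eq_exp[OF elim] exp_add[symmetric] by (rule arg_cong[of _ _ exp]) (simp add: algebra_simps)
    have n1: "norm (Gamma (complex_of_real u)) = Gamma u"
      using elim by (simp add: Gamma_complex_of_real)
    have n2: "norm (exp (?v u)) = exp ((u - 1 / 2) * ln u - u)"
      using elim by (simp add: Ln_of_real)
    show ?case unfolding norm_divide n1 n2 mult.assoc e by (simp only: exp_minus divide_inverse)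
  qed
  show ?thesis using Lim_transform_eventually[OF lim ev] by simp
qed

text \<open>The line of integration \<open>Re z = \<sigma>\<close> is chosen through the saddle point, which makes the bound on
  the inverse Fourier integral comparable with the density itself.\<close>

lemma density_difference_bound:
  fixes fY :: "real \<Rightarrow> real" and A \<kappa> \<gamma> c \<epsilon> \<sigma> y :: real
  assumes \<gamma>: "\<gamma> > 0" and A: "A > 0" and \<epsilon>: "\<epsilon> \<ge> 0"
    and cont: "isCont fY y"
    and int: "integrable lborel (\<lambda>x. fY x * exp (- \<sigma> * x))"
    and close: "\<And>t. norm ((CLINT x|lborel. of_real (fY x) * exp (- Complex \<sigma> t * of_real x)) - log_saddle_laplace A \<kappa> \<gamma> c (Complex \<sigma> t))
        \<le> \<epsilon> * norm (log_saddle_laplace A \<kappa> \<gamma> c (Complex \<sigma> t))"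
    and u: "u = \<gamma> * exp (- (y - \<kappa>) / \<gamma>)" "\<gamma> * \<sigma> + c = u" "u \<ge> 1"
  shows "\<bar>fY y - log_saddle_density A \<kappa> \<gamma> c y\<bar> \<le>
    5 / 2 * \<epsilon> * (Gamma u * sqrt u * exp (u - u * ln u)) * log_saddle_density A \<kappa> \<gamma> c y"
proof -
  define g where "g = log_saddle_density A \<kappa> \<gamma> c"
  define Gh where "Gh = log_saddle_laplace A \<kappa> \<gamma> c"
  \<comment> \<open>The tilt makes the Fourier transform of \<open>q\<close> the difference of the
    Laplace transforms on the line \<open>Re z = \<sigma>\<close>.\<close>
  define q where "q = (\<lambda>x. (fY x - g x) * exp (- \<sigma> * x))"
  have gi: "integrable lborel (\<lambda>x. of_real (g x) * exp (- Complex \<sigma> t * of_real x))"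
    and gI: "(CLINT x|lborel. of_real (g x) * exp (- Complex \<sigma> t * of_real x)) = Gh (Complex \<sigma> t)" for t
    unfolding g_def Gh_def using u by (intro log_saddle_laplace \<gamma>; simp)+
  have "integrable lborel (\<lambda>x. Re (of_real (g x) * exp (- Complex \<sigma> 0 * of_real x)))"
    by (rule integrable_Re[OF gi])
  moreover have "Re (of_real (g x) * exp (- Complex \<sigma> 0 * of_real x)) = g x * exp (- \<sigma> * x)" for x
    by (simp add: Re_exp)
  ultimately have gr: "integrable lborel (\<lambda>x. g x * exp (- \<sigma> * x))" by (simp only:)
  have qi: "integrable lborel q"
    unfolding q_def left_diff_distrib using int gr by (rule Bochner_Integration.integrable_diff)
  have gcont: "isCont g y" unfolding g_def log_saddle_density_def using \<gamma> by (intro continuous_intros) auto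
  have qc: "isCont q y" unfolding q_def by (intro continuous_intros cont gcont)
  have fi: "integrable lborel (\<lambda>x. of_real (fY x) * exp (- Complex \<sigma> t * of_real x))" for t
  proof (rule Bochner_Integration.integrable_bound[OF int])
    have m1: "(\<lambda>x. fY x * exp (- \<sigma> * x)) \<in> borel_measurable lborel" using int by auto
    have "(\<lambda>x. (fY x * exp (- \<sigma> * x)) * exp (\<sigma> * x)) \<in> borel_measurable lborel"
      by (rule borel_measurable_times[OF m1]) simp
    then have "fY \<in> borel_measurable lborel" by (simp add: mult.assoc exp_minus)
    then show "(\<lambda>x. of_real (fY x) * exp (- Complex \<sigma> t * of_real x)) \<in> borel_measurable lborel" by simp
    show "AE x in lborel. norm (of_real (fY x) * exp (- Complex \<sigma> t * of_real x)) \<le> norm (fY x * exp (- \<sigma> * x))"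
      by (simp add: norm_mult abs_mult)
  qed
  define B where "B = A * \<gamma> * exp (- \<kappa> * \<sigma> - u * ln \<gamma>) * Gamma u"
  define s where "s = 5 * sqrt u / \<gamma>"
  have s: "s > 0" using \<gamma> u by (simp add: s_def)
  have hat: "norm (CLINT x|lborel. q x *\<^sub>R iexp (- (t * x))) \<le> \<epsilon> * B * (1 / (1 + t\<^sup>2 / s\<^sup>2))" for t
  proof -
    have "q x *\<^sub>R iexp (- (t * x)) = of_real (fY x) * exp (- Complex \<sigma> t * of_real x) - of_real (g x) * exp (- Complex \<sigma> t * of_real x)" for x
    proof -
      have "exp (- Complex \<sigma> t * of_real x) = of_real (exp (- \<sigma> * x)) * iexp (- (t * x))"
        unfolding exp_of_real[symmetric] exp_add[symmetric]
        by (rule arg_cong[of _ _ exp]) (simp add: complex_eq_iff)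
      then show ?thesis by (simp add: q_def scaleR_conv_of_real algebra_simps)
    qed
    then have "(CLINT x|lborel. q x *\<^sub>R iexp (- (t * x))) =
        (CLINT x|lborel. of_real (fY x) * exp (- Complex \<sigma> t * of_real x)) - Gh (Complex \<sigma> t)"
      using Bochner_Integration.integral_diff[OF fi gi] gI by simp
    then have "norm (CLINT x|lborel. q x *\<^sub>R iexp (- (t * x))) \<le> \<epsilon> * norm (Gh (Complex \<sigma> t))"
      using close[of t] by (simp add: Gh_def)
    also have "\<dots> \<le> \<epsilon> * (B * (1 / (1 + t\<^sup>2 / s\<^sup>2)))"
      unfolding Gh_def B_def s_def using u by (intro mult_left_mono norm_log_saddle_laplace \<gamma> A \<epsilon>) auto
    finally show ?thesis by simp
  qed
  have "\<bar>q y\<bar> \<le> (LINT t|lborel. \<epsilon> * B * (1 / (1 + t\<^sup>2 / s\<^sup>2))) / (2 * pi)"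
    by (rule abs_le_integral_fourier_bound[OF qi qc _ hat]) (intro integrable_mult_right lorentzian_integral s)
  \<comment> \<open>The Lorentzian integral \<open>s * pi\<close> over \<open>2 * pi\<close> leaves
    \<open>s / 2\<close>, and \<open>s = 5 * sqrt u / \<gamma>\<close> accounts for the constant
    \<open>5 / 2\<close>.\<close>
  also have "\<dots> = \<epsilon> * B * s / 2"
    by (simp only: integral_mult_right_zero lorentzian_integral(2)[OF s]) simp
  finally have qy: "\<bar>q y\<bar> \<le> \<epsilon> * B * s / 2" .
  have "\<bar>fY y - g y\<bar> = exp (\<sigma> * y) * \<bar>q y\<bar>"
    by (simp add: q_def abs_mult exp_minus)
  also have "\<dots> \<le> exp (\<sigma> * y) * (\<epsilon> * B * s / 2)" by (intro mult_left_mono qy) simp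
  also have "\<dots> = 5 / 2 * \<epsilon> * Gamma u * sqrt u * (A * (exp (\<sigma> * y) * exp (- \<kappa> * \<sigma> - u * ln \<gamma>)))"
    using \<gamma> by (simp add: B_def s_def)
  also have "A * (exp (\<sigma> * y) * exp (- \<kappa> * \<sigma> - u * ln \<gamma>)) = exp (u - u * ln u) * g y"
  proof -
    \<comment> \<open>The saddle-point relations
      \<open>y - \<kappa> = \<gamma> * (ln \<gamma> - ln u)\<close> and
      \<open>\<gamma> * \<sigma> = u - c\<close> collapse the exponent to that of the density plus
      \<open>u - u * ln u\<close>, the Stirling correction to \<open>Gamma u\<close>.\<close>
    have lu: "ln u = ln \<gamma> - (y - \<kappa>) / \<gamma>" using \<gamma> by (simp add: u(1) ln_mult diff_divide_distrib)
    have e1: "y - \<kappa> = \<gamma> * (ln \<gamma> - ln u)" using \<gamma> by (simp add: lu)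
    have e2: "\<gamma> * \<sigma> = u - c" using u(2) by simp
    have "\<sigma> * y + (- \<kappa> * \<sigma> - u * ln \<gamma>) = \<sigma> * (y - \<kappa>) - u * ln \<gamma>" by (simp add: algebra_simps)
    also have "\<sigma> * (y - \<kappa>) = (\<gamma> * \<sigma>) * (ln \<gamma> - ln u)" unfolding e1 by simp
    also have "\<dots> = (u - c) * (ln \<gamma> - ln u)" by (simp only: e2)
    finally have "\<sigma> * y + (- \<kappa> * \<sigma> - u * ln \<gamma>) = (u - u * ln u) + (- c * (ln \<gamma> - ln u) - u)"
      by (simp add: algebra_simps)
    moreover have "- c * (ln \<gamma> - ln u) = - (c / \<gamma>) * (y - \<kappa>)" unfolding e1 using \<gamma> by simp
    ultimately have "exp (\<sigma> * y) * exp (- \<kappa> * \<sigma> - u * ln \<gamma>) = exp (u - u * ln u) * exp (- (c / \<gamma>) * (y - \<kappa>) - u)"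
      by (simp only: exp_add[symmetric])
    moreover have "g y = A * exp (- (c / \<gamma>) * (y - \<kappa>) - u)"
      by (simp only: g_def log_saddle_density_def u(1))
    ultimately show ?thesis by (simp only: mult.left_commute)
  qed
  finally show ?thesis unfolding g_def[symmetric] by (simp only: mult.assoc)
qed

text \<open>The saddle abscissa \<open>(u y - c) / \<gamma>\<close> tends to infinity as
  \<open>y\<close> tends to minus infinity, so \<open>lim\<close> controls the whole line through it
  with one relative error.\<close>

theorem density_asymp_of_laplace:
  fixes fY :: "real \<Rightarrow> real" and A \<kappa> \<gamma> c :: real and m :: "complex \<Rightarrow> complex"
  assumes \<gamma>: "\<gamma> > 0" and A: "A > 0"
    and cont: "continuous_on UNIV fY"
    and int: "\<And>x. x > R \<Longrightarrow> integrable lborel (\<lambda>y. fY y * exp (- x * y))"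
    and lim: "((\<lambda>z. (CLINT y|lborel. of_real (fY y) * exp (- z * of_real y)) / log_saddle_laplace A \<kappa> \<gamma> c z) \<longlongrightarrow> 1) re_at_top"
  shows "fY \<sim>[at_bot] log_saddle_density A \<kappa> \<gamma> c"
proof (rule asymp_equivI')
  define g where "g = log_saddle_density A \<kappa> \<gamma> c"
  have g0: "g y > 0" for y using A by (simp add: g_def log_saddle_density_def)
  define u where "u = (\<lambda>y. \<gamma> * exp (- (y - \<kappa>) / \<gamma>))"
  have ulim: "filterlim u at_top at_bot" unfolding u_def using \<gamma> by real_asymp
  have slim: "filterlim (\<lambda>y. (u y - c) / \<gamma>) at_top at_bot"
  proof -
    have "filterlim (\<lambda>v. (v - c) / \<gamma>) at_top at_top" using \<gamma> by real_asymp
    then show ?thesis by (rule filterlim_compose[OF _ ulim])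
  qed
  have st: "\<forall>\<^sub>F y in at_bot. Gamma (u y) * sqrt (u y) * exp (u y - u y * ln (u y)) < 4"
  proof -
    have "sqrt (2 * pi) < 4"
    proof -
      have "sqrt (2 * pi) < sqrt 16" using pi_less_4 by (intro real_sqrt_less_mono) simp
      also have "sqrt 16 = (4::real)" by (rule real_sqrt_unique) simp_all
      finally show ?thesis .
    qed
    from order_tendstoD(2)[OF filterlim_compose[OF Gamma_real_stirling ulim] this]
    show ?thesis .
  qed
  show "((\<lambda>y. fY y / log_saddle_density A \<kappa> \<gamma> c y) \<longlongrightarrow> 1) at_bot"
  proof (rule tendstoI)
    fix e :: real assume e: "e > 0"
    \<comment> \<open>Since 4 eventually bounds Stirling's factor, the relative error is
      \<open>5 / 2 * (e / 20) * 4 = e / 2\<close>.\<close>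
    define \<epsilon> where "\<epsilon> = e / 20"
    have \<epsilon>: "\<epsilon> > 0" using e by (simp add: \<epsilon>_def)
    let ?m = "\<lambda>z. CLINT y|lborel. of_real (fY y) * exp (- z * of_real y)"
    let ?G = "log_saddle_laplace A \<kappa> \<gamma> c"
    have "\<forall>\<^sub>F z in re_at_top. dist (?m z / ?G z) 1 < \<epsilon>" by (rule tendstoD[OF lim \<epsilon>])
    \<comment> \<open>Here uniformity in \<open>Im z\<close> is extracted: the threshold concerns
      the real part only, and every point of the line is covered.\<close>
    then have "\<forall>\<^sub>F x in at_top. \<forall>z. Re z = x \<longrightarrow> dist (?m z / ?G z) 1 < \<epsilon>"
      by (simp add: eventually_filtercomap)
         (auto elim: eventually_mono)
    then have ev1: "\<forall>\<^sub>F y in at_bot. \<forall>z. Re z = (u y - c) / \<gamma> \<longrightarrow> dist (?m z / ?G z) 1 < \<epsilon>"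
      by (rule eventually_compose_filterlim[OF _ slim])
    have ev2: "\<forall>\<^sub>F y in at_bot. (u y - c) / \<gamma> > R" by (rule filterlim_at_top_dense[THEN iffD1, OF slim, rule_format])
    have ev3: "\<forall>\<^sub>F y in at_bot. u y > 1" by (rule filterlim_at_top_dense[THEN iffD1, OF ulim, rule_format])
    show "\<forall>\<^sub>F y in at_bot. dist (fY y / log_saddle_density A \<kappa> \<gamma> c y) 1 < e"
      using ev1 ev2 ev3 st
    proof eventually_elim
      case (elim y)
      define \<sigma> where "\<sigma> = (u y - c) / \<gamma>"
      have us: "\<gamma> * \<sigma> + c = u y" using \<gamma> by (simp add: \<sigma>_def)
      have close: "norm (?m (Complex \<sigma> t) - ?G (Complex \<sigma> t)) \<le> \<epsilon> * norm (?G (Complex \<sigma> t))" for t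
      proof -
        have "Re (of_real \<gamma> * Complex \<sigma> t + of_real c) > 0" using us elim(3) by simp
        then have nz: "?G (Complex \<sigma> t) \<noteq> 0"
          using Re_pos_not_nonpos_Int[of "of_real \<gamma> * Complex \<sigma> t + of_real c"] A \<gamma>
          by (simp add: log_saddle_laplace_def Gamma_eq_zero_iff)
        have "norm (?m (Complex \<sigma> t) / ?G (Complex \<sigma> t) - 1) < \<epsilon>"
          using elim(1) by (simp add: \<sigma>_def dist_norm)
        moreover have "?m (Complex \<sigma> t) - ?G (Complex \<sigma> t) = (?m (Complex \<sigma> t) / ?G (Complex \<sigma> t) - 1) * ?G (Complex \<sigma> t)"
          using nz by (simp add: left_diff_distrib)
        ultimately show ?thesis by (simp only: norm_mult) (intro mult_right_mono, auto)
      qed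
      define Q where "Q = Gamma (u y) * sqrt (u y) * exp (u y - u y * ln (u y))"
      have "\<bar>fY y - g y\<bar> \<le> 5 / 2 * \<epsilon> * Q * g y"
        unfolding g_def Q_def
      proof (rule density_difference_bound[OF \<gamma> A _ _ _ close _ us])
        show "isCont fY y" using cont by (simp add: continuous_on_eq_continuous_at)
        show "integrable lborel (\<lambda>x. fY x * exp (- \<sigma> * x))" using elim(2) by (intro int) (simp add: \<sigma>_def)
      qed (use \<epsilon> elim(3) in \<open>auto simp: u_def\<close>)
      also have "\<dots> \<le> 5 / 2 * \<epsilon> * 4 * g y"
        using elim(4) \<epsilon> g0[of y] by (intro mult_right_mono mult_left_mono) (auto simp: Q_def)
      also have "\<dots> < e * g y" using e g0[of y] by (simp add: \<epsilon>_def)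
      finally have "\<bar>fY y - g y\<bar> < e * g y" .
      moreover have "dist (fY y / g y) 1 = \<bar>fY y - g y\<bar> / g y"
        using g0[of y] by (simp add: dist_real_def diff_divide_distrib[symmetric] abs_divide field_simps)
      ultimately show ?case using g0[of y] by (simp add: g_def pos_divide_less_eq)
    qed
  qed
qed

section \<open>From the density of the logarithm to the density of the variable\<close>

lemma continuous_density_antiderivative:
  fixes f :: "real \<Rightarrow> real"
  assumes dist: "distributed M lborel X (\<lambda>x. ennreal (f x))" and nn: "\<And>x. f x \<ge> 0"
    and der: "\<And>x. p \<le> x \<Longrightarrow> x \<le> q \<Longrightarrow> (\<Phi> has_real_derivative f x) (at x)" and pq: "p \<le> q"
  shows "emeasure M (X -` {p..q} \<inter> space M) = ennreal (\<Phi> q - \<Phi> p)"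
proof -
  have [measurable]: "f \<in> borel_measurable borel"
    using distributed_real_measurable[OF _ dist] nn by simp
  have "emeasure M (X -` {p..q} \<inter> space M) = (\<integral>\<^sup>+x. ennreal (f x) * indicator {p..q} x \<partial>lborel)"
    by (rule distributed_emeasure[OF dist]) simp
  also have "\<dots> = ennreal (\<Phi> q - \<Phi> p)"
    by (rule nn_integral_FTC_Icc) (use der nn pq in auto)
  finally show ?thesis .
qed

text \<open>A density is determined only almost everywhere; continuity allows the pointwise values
  to be recovered by differentiating the probabilities of intervals, which agree for
  \<open>X\<close> and \<open>ln X\<close> after the substitution \<open>exp\<close>.\<close>

lemma log_density:
  fixes fX fY :: "real \<Rightarrow> real"
  assumes distX: "distributed M lborel X (\<lambda>x. ennreal (fX x))" and nnX: "\<And>x. fX x \<ge> 0"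
    and distY: "distributed M lborel (\<lambda>\<omega>. ln (X \<omega>)) (\<lambda>y. ennreal (fY y))" and nnY: "\<And>y. fY y \<ge> 0"
    and cX: "continuous_on {0<..} fX" and cY: "continuous_on UNIV fY"
    and pos: "AE \<omega> in M. X \<omega> > 0"
  shows "fY y = fX (exp y) * exp y"
proof -
  have X [measurable]: "X \<in> borel_measurable M" using distributed_measurable[OF distX] by simp
  \<comment> \<open>The base points lie at \<open>y - 2\<close> while the intervals start at
    \<open>y - 1\<close>, so that the antiderivatives have two-sided derivatives at all points
    used.\<close>
  define \<Phi> where "\<Phi> = (\<lambda>t. integral {y - 2..t} fY)"
  define \<Psi> where "\<Psi> = (\<lambda>t. integral {exp (y - 2)..t} fX)"
  have dY: "(\<Phi> has_real_derivative fY t) (at t)" if "y - 2 < t" "t < y + 2" for t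
  proof -
    have 1: "(\<Phi> has_real_derivative fY t) (at t within {y - 2..y + 2})"
      unfolding \<Phi>_def by (rule integral_has_real_derivative) (use that cY continuous_on_subset in auto)
    have 2: "t \<in> interior {y - 2..y + 2}" using that by simp
    show ?thesis using 1 unfolding at_within_interior[OF 2] .
  qed
  have dX: "(\<Psi> has_real_derivative fX t) (at t)" if "exp (y - 2) < t" "t < exp (y + 2)" for t
  proof -
    have "{exp (y - 2)..exp (y + 2)} \<subseteq> {0<..}" by (auto intro: less_le_trans[OF exp_gt_zero])
    then have 1: "(\<Psi> has_real_derivative fX t) (at t within {exp (y - 2)..exp (y + 2)})"
      unfolding \<Psi>_def by (intro integral_has_real_derivative) (use that cX continuous_on_subset in auto)
    have 2: "t \<in> interior {exp (y - 2)..exp (y + 2)}" using that by simp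
    show ?thesis using 1 unfolding at_within_interior[OF 2] .
  qed
  have eq: "\<Phi> t - \<Phi> (y - 1) = \<Psi> (exp t) - \<Psi> (exp (y - 1))" if t: "y - 1 \<le> t" "t \<le> y + 1" for t
  proof -
    have mono: "\<Phi> (y - 1) \<le> \<Phi> t"
    proof (rule DERIV_nonneg_imp_nondecreasing[OF t(1)])
      fix x assume "y - 1 \<le> x" "x \<le> t"
      then show "\<exists>d. (\<Phi> has_real_derivative d) (at x) \<and> 0 \<le> d" using dY[of x] t nnY[of x] by force
    qed
    have mono': "\<Psi> (exp (y - 1)) \<le> \<Psi> (exp t)"
    proof (rule DERIV_nonneg_imp_nondecreasing[where f = \<Psi>])
      show "exp (y - 1) \<le> exp t" using t by simp
      fix x assume x: "exp (y - 1) \<le> x" "x \<le> exp t"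
      have "exp (y - 2) < exp (y - 1)" "exp t < exp (y + 2)" using t by simp_all
      then have "exp (y - 2) < x" "x < exp (y + 2)" using x by linarith+
      then show "\<exists>d. (\<Psi> has_real_derivative d) (at x) \<and> 0 \<le> d"
        by (intro exI[of _ "fX x"] conjI dX nnX)
    qed
    have "emeasure M ((\<lambda>\<omega>. ln (X \<omega>)) -` {y - 1..t} \<inter> space M) = ennreal (\<Phi> t - \<Phi> (y - 1))"
      by (rule continuous_density_antiderivative[where \<Phi> = \<Phi>, OF distY nnY _ t(1)]) (use t dY in auto)
    moreover have "emeasure M (X -` {exp (y - 1)..exp t} \<inter> space M) = ennreal (\<Psi> (exp t) - \<Psi> (exp (y - 1)))"
    proof (rule continuous_density_antiderivative[where \<Phi> = \<Psi>, OF distX nnX])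
      fix x assume x: "exp (y - 1) \<le> x" "x \<le> exp t"
      have "exp (y - 2) < exp (y - 1)" "exp t < exp (y + 2)" using t by simp_all
      then show "(\<Psi> has_real_derivative fX x) (at x)" using x by (intro dX) linarith+
    qed (use t in simp)
    moreover have "emeasure M ((\<lambda>\<omega>. ln (X \<omega>)) -` {y - 1..t} \<inter> space M) = emeasure M (X -` {exp (y - 1)..exp t} \<inter> space M)"
    proof (rule emeasure_eq_AE)
      show "AE \<omega> in M. \<omega> \<in> (\<lambda>\<omega>. ln (X \<omega>)) -` {y - 1..t} \<inter> space M \<longleftrightarrow> \<omega> \<in> X -` {exp (y - 1)..exp t} \<inter> space M"
        using pos by eventually_elim (auto simp: ln_ge_iff exp_le_cancel_iff[symmetric, of "ln _"] simp del: exp_le_cancel_iff)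
    qed measurable
    ultimately have "ennreal (\<Phi> t - \<Phi> (y - 1)) = ennreal (\<Psi> (exp t) - \<Psi> (exp (y - 1)))" by simp
    then show ?thesis using mono mono' by (simp add: ennreal_inj)
  qed
  have d1: "((\<lambda>t. \<Phi> t - \<Phi> (y - 1)) has_real_derivative fY y) (at y)"
    using DERIV_diff[OF dY[of y] DERIV_const[of "\<Phi> (y - 1)"]] by simp
  have d2: "((\<lambda>t. \<Psi> (exp t) - \<Psi> (exp (y - 1))) has_real_derivative fX (exp y) * exp y) (at y)"
    using DERIV_diff[OF DERIV_chain2[OF dX[of "exp y"] DERIV_exp[of y]] DERIV_const[of "\<Psi> (exp (y - 1))"]] by simp
  have "((\<lambda>t. \<Phi> t - \<Phi> (y - 1)) has_real_derivative fX (exp y) * exp y) (at y)"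
  proof (rule has_field_derivative_transform_within_open[OF d2])
    show "open {y - 1<..<y + 1}" by simp
  qed (use eq in auto)
  then show ?thesis using d1 DERIV_unique by blast
qed

theorem theorem6p7:
  fixes M :: "'w measure" and X Y :: "'w \<Rightarrow> real"
    and J K :: nat and C D :: real and a b a' b' :: "nat \<Rightarrow> real"
    and \<gamma> \<delta> \<kappa> C1 c1 c3 C3 :: real
    and fX fY :: "real \<Rightarrow> real"
  assumes "prob_space M"
    and "X \<in> borel_measurable M"
    and "AE \<omega> in M. X \<omega> > 0"
    and "gamma_type_moments M X J K C D a b a' b'"
    and "Y = (\<lambda>\<omega>. ln (X \<omega>))"
    and "\<gamma> = par_gamma J K a a'"
    and "\<delta> = par_delta J K b b'"
    and "\<kappa> = par_kappa J K D a a'"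
    and "C1 = par_C1 J K C a b a' b'"
    and "rho_minus (gamma_quotient J K C D a b a' b') = -\<infinity>"
    and "\<gamma> > 0"
    and "distributed M lborel X (\<lambda>x. ennreal (fX x))"
    and "\<And>x. fX x \<ge> 0"
    and "continuous_on {0<..} fX"
    and "distributed M lborel Y (\<lambda>y. ennreal (fY y))"
    and "\<And>y. fY y \<ge> 0"
    and "continuous_on UNIV fY"
    and "c1 = (\<delta> + 1 / 2) / \<gamma>"
    and "c3 = \<gamma> * exp (\<kappa> / \<gamma>)"
    and "C3 = C1 / sqrt (2 * pi * \<gamma>) * exp (c1 * \<kappa>)"
  shows "asymp_equiv fX (at_right 0)
           (\<lambda>x. C3 * x powr (- c1 - 1) * exp (- c3 * x powr (- 1 / \<gamma>))) \<and>
         asymp_equiv fY at_bot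
           (\<lambda>y. C1 / sqrt (2 * pi * \<gamma>) *
                exp (- c1 * (y - \<kappa>) - \<gamma> * exp (- (y - \<kappa>) / \<gamma>)))"
proof -
  note X [measurable] = assms(2) and Y_def = assms(5) and \<gamma> = assms(11)
  have Y [measurable]: "Y \<in> borel_measurable M" unfolding Y_def by measurable
  let ?F = "gamma_quotient J K C D a b a' b'"
  obtain l u where D: "D > 0" and a0: "\<forall>j\<in>{1..J}. a j \<noteq> 0" and a'0: "\<forall>k\<in>{1..K}. a' k \<noteq> 0" and lu: "l < u"
    and mom: "\<And>s. l < s \<Longrightarrow> s < u \<Longrightarrow> integrable M (\<lambda>\<omega>. X \<omega> powr s) \<and>
        complex_of_real (\<integral>\<omega>. X \<omega> powr s \<partial>M) = ?F (of_real s)"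
    using assms(4) unfolding gamma_type_moments_def by fastforce
  \<comment> \<open>Where \<open>X\<close> is 0 the left side is 0 and the right side is positive,
    so the equality can hold only almost everywhere.\<close>
  have powr_AE: "AE \<omega> in M. X \<omega> powr s = exp (s * Y \<omega>)" for s
    using assms(3) by eventually_elim (simp add: powr_def Y_def)
  have int: "integrable M (\<lambda>\<omega>. exp (s * Y \<omega>))" and eq: "?F (of_real s) = of_real (\<integral>\<omega>. exp (s * Y \<omega>) \<partial>M)"
    if "l < s" "s < u" for s
    using mom[OF that] integrable_cong_AE[OF _ _ powr_AE[of s]] integral_cong_AE[OF _ _ powr_AE[of s]] by auto
  \<comment> \<open>A negative pole would give \<open>rho_minus\<close> a finite value.\<close>
  have nopole: "\<not> is_pole ?F (of_real x)" if "x < 0" for x :: real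
    using assms(10) that unfolding rho_minus_def by (auto split: if_splits)
  obtain R where R: "\<And>x. x > R \<Longrightarrow> integrable M (\<lambda>\<omega>. exp (- x * Y \<omega>))"
      "\<And>z. Re z > R \<Longrightarrow> (\<integral>\<omega>. exp (- z * of_real (Y \<omega>)) \<partial>M) = of_real \<bar>C\<bar> * refl_quotient J K D a b a' b' z"
    and sums: "(\<Sum>k\<in>{k\<in>{1..K}. a' k > 0}. a' k) = (\<Sum>j\<in>{j\<in>{1..J}. a j > 0}. a j)" and C0: "C \<noteq> 0"
    using gamma_type_moments_refl[OF assms(1) Y D a0 a'0 lu int eq nopole] by blast
  have C1: "C1 > 0"
    unfolding assms(9) par_C1_def using C0 a0 a'0 by (intro divide_pos_pos mult_pos_pos prod_pos) auto
  \<comment> \<open>With this \<open>A\<close> the limit \<open>A * sqrt (2 * pi * \<gamma>)\<close>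
    of the comparison transform relative to \<open>?E\<close> is \<open>C1\<close>, the same as that
    of the moment function.\<close>
  define A where "A = C1 / sqrt (2 * pi * \<gamma>)"
  define c where "c = \<delta> + 1 / 2"
  have A: "A > 0" using C1 \<gamma> by (simp add: A_def)
  let ?E = "\<lambda>z. exp (- of_real \<kappa> * z + (of_real \<gamma> * z + of_real \<delta>) * ln z - of_real \<gamma> * z)"
  have l1: "((\<lambda>z. of_real \<bar>C\<bar> * refl_quotient J K D a b a' b' z / ?E z) \<longlongrightarrow> of_real C1) re_at_top"
    using refl_quotient_asymp[OF a0 a'0 C0 sums] unfolding assms(6-9) .
  have l2: "((\<lambda>z. log_saddle_laplace A \<kappa> \<gamma> c z / ?E z) \<longlongrightarrow> of_real C1) re_at_top"
    using log_saddle_laplace_asymp[OF \<gamma>, of A \<kappa> \<delta>] \<gamma> by (simp add: c_def A_def)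
  have "((\<lambda>z. (of_real \<bar>C\<bar> * refl_quotient J K D a b a' b' z / ?E z) / (log_saddle_laplace A \<kappa> \<gamma> c z / ?E z)) \<longlongrightarrow> of_real C1 / of_real C1) re_at_top"
    using C1 by (intro tendsto_divide l1 l2) simp
  then have lim: "((\<lambda>z. of_real \<bar>C\<bar> * refl_quotient J K D a b a' b' z / log_saddle_laplace A \<kappa> \<gamma> c z) \<longlongrightarrow> 1) re_at_top"
    using C1 by simp
  note dY = assms(15) and nnY = assms(16)
  have "\<forall>\<^sub>F z in re_at_top. of_real \<bar>C\<bar> * refl_quotient J K D a b a' b' z / log_saddle_laplace A \<kappa> \<gamma> c z =
      (CLINT y|lborel. of_real (fY y) * exp (- z * of_real y)) / log_saddle_laplace A \<kappa> \<gamma> c z"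
    using eventually_re_at_top[of R]
    by eventually_elim (simp only: R(2)[symmetric] exp_laplace_density(2)[OF dY nnY])
  with lim have lim': "((\<lambda>z. (CLINT y|lborel. of_real (fY y) * exp (- z * of_real y)) / log_saddle_laplace A \<kappa> \<gamma> c z) \<longlongrightarrow> 1) re_at_top"
    by (rule Lim_transform_eventually)
  have fY: "fY \<sim>[at_bot] log_saddle_density A \<kappa> \<gamma> c"
  proof (rule density_asymp_of_laplace[OF \<gamma> A assms(17) _ lim'])
    show "integrable lborel (\<lambda>y. fY y * exp (- x * y))" if "x > R" for x
      using R(1)[OF that] exp_laplace_density(1)[OF dY nnY, of "- x"] by blast
  qed
  have c1: "c / \<gamma> = c1" by (simp add: c_def assms(18))
  have dens: "log_saddle_density A \<kappa> \<gamma> c y = C1 / sqrt (2 * pi * \<gamma>) * exp (- c1 * (y - \<kappa>) - \<gamma> * exp (- (y - \<kappa>) / \<gamma>))" for y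
    by (simp only: log_saddle_density_def c1 A_def)
  \<comment> \<open>As \<open>fX x = fY (ln x) / x\<close>, the claim for \<open>fX\<close> at 0 is
    the one for \<open>fY\<close> at minus infinity composed with \<open>ln\<close>.\<close>
  have "(fY \<circ> ln) \<sim>[at_right 0] (log_saddle_density A \<kappa> \<gamma> c \<circ> ln)"
    by (rule asymp_equiv_compose[OF fY ln_at_0])
  then have E0: "(\<lambda>x. fY (ln x) * (1 / x)) \<sim>[at_right 0] (\<lambda>x. log_saddle_density A \<kappa> \<gamma> c (ln x) * (1 / x))"
    unfolding o_def by (intro asymp_equiv_intros)
  have E1: "\<forall>\<^sub>F x in at_right 0. fY (ln x) * (1 / x) = fX x"
    using eventually_at_right_less[of 0]
  proof eventually_elim
    case (elim x)
    have "fY (ln x) = fX (exp (ln x)) * exp (ln x)"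
      by (rule log_density[OF assms(12,13) _ nnY assms(14,17,3)]) (use dY Y_def in simp)
    then show ?case using elim by simp
  qed
  have E2: "\<forall>\<^sub>F x in at_right 0. log_saddle_density A \<kappa> \<gamma> c (ln x) * (1 / x) =
      C3 * x powr (- c1 - 1) * exp (- c3 * x powr (- 1 / \<gamma>))"
    using eventually_at_right_less[of 0]
  proof eventually_elim
    case (elim x)
    define L where "L = ln x"
    have xL: "x = exp L" using elim by (simp add: L_def)
    have p1: "x powr (- c1 - 1) = exp (- c1 * L) * (1 / x)"
      unfolding xL by (simp add: powr_def exp_add[symmetric] exp_minus[symmetric] inverse_eq_divide[symmetric] algebra_simps)
    have p2: "c3 * x powr (- 1 / \<gamma>) = \<gamma> * exp (- (L - \<kappa>) / \<gamma>)"
      unfolding xL assms(19) by (simp add: powr_def mult.assoc exp_add[symmetric] diff_divide_distrib)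
    have p3: "exp (- c1 * (L - \<kappa>) - v) = exp (c1 * \<kappa>) * exp (- c1 * L) * exp (- v)" for v
      unfolding exp_add[symmetric] by (rule arg_cong[of _ _ exp]) (simp add: algebra_simps)
    show ?case
      unfolding dens p1 L_def[symmetric] p3 unfolding assms(20) mult_minus_left p2 by simp
  qed
  have "fX \<sim>[at_right 0] (\<lambda>x. C3 * x powr (- c1 - 1) * exp (- c3 * x powr (- 1 / \<gamma>)))"
    using E0 unfolding asymp_equiv_cong[OF E1 E2] .
  then show ?thesis using fY unfolding dens[abs_def] by blast
qed

end
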